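(* Let $(M,g)$ be a (timelike) quaternionic (para)Kähler Heisenberg four-manifold, written as $$g=\varepsilon\,dt^2+\varepsilon\, a(t)^{-2}\,\mathfrak e^1_{t_0}\otimes\mathfrak e^1_{t_0}+b(t)^{-2}\left(\mathfrak e^2_{t_0}\otimes\mathfrak e^2_{t_0}+\mathfrak e^3_{t_0}\otimes\mathfrak e^3_{t_0}\right).$$ Then: – The eigenvalues of the Weyl tensor, understood as a symmetric endomorphism of the bundle of two-forms, are given by $(-2\nu, \nu , \nu)$, where $$\nu=\frac{16 k^3 b^7}{\varepsilon a^3(-3k b^3+a b')}.$$ – $(M,g)$ is conformally Kähler for two complex structures with opposite orientations.
   Context: $\mathrm{H}$ is the three-dimensional Heisenberg group (connected, simply connected, non-abelian nilpotent), with Lie algebra $\mathfrak h$ and one-dimensional center $\mathcal Z$. A Heisenberg four-manifold is a four-dimensional pseudo-Riemannian manifold foliated by the orbits of a principal isometric action of $\mathrm{H}$; orbits are assumed non-degenerate, and (after passing to the universal covering and up to an overall sign of the metric) $M=\mathcal I\times \mathrm{H}$, $\mathcal I$ an open interval, $g=\varepsilon\, dt^2+\chi_t$, $\varepsilon=\pm1$, with $\chi_t$ left-invariant metrics on $\mathrm{H}$, Riemannian if $\varepsilon=1$ and Lorentzian of signature $(-,+,+)$ if $\varepsilon=-1$. For $\varepsilon=-1$ it is timelike if $\mathcal Z$ is timelike for every $\chi_t$. A Riemannian (resp. neutral-signature) orientable four-manifold is quaternionic Kähler (resp. quaternionic paraKähler) if $\mathrm{Ric}^g=\Lambda g$, $\Lambda\neq0$,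 and its Weyl tensor is self-dual for one of the two orientations; that orientation is always the one considered. "(Timelike) quaternionic (para)Kähler" means: quaternionic Kähler ($\varepsilon=1$) or timelike quaternionic paraKähler ($\varepsilon=-1$). Fix $t_0\in\mathcal I$. Every such manifold can be written in the displayed form, with $a(t_0)=b(t_0)=1$, where $(\mathfrak e_{t_0}^i)$ is the coframe dual to a left-invariant $\chi_{t_0}$-orthonormal frame $(\mathfrak e_i^{t_0})$ with $\mathfrak e_1^{t_0}$ spanning the center and only non-vanishing bracket $[\mathfrak e_2^{t_0},\mathfrak e_3^{t_0}]=-2k\,\mathfrak e_1^{t_0}$, $k>0$, and where the functions $a,b$ satisfy $$a'=-\frac{k^2 b^6 +a^2(\varepsilon \Lambda b^2+(b')^2)}{2ab b'},\qquad \varepsilon \Lambda = \frac{3 (k b^3- ab')^3}{ a^2 b^2(-3k b^3+a b')}.$$ The Weyl tensor acts on two-forms by $(\mathrm W^g(\omega))_{\mu\nu}=(\mathrm W^g)_{\mu\nu\rho\sigma}\omega^{\rho\sigma}$. The three eigenvalues are those on self-dual two-forms: the eigenvectors are $\omega_i=dt\wedge\mathfrak e^i_t+\star(dt\wedge\mathfrak e^i_t)$, $i=1,2,3$, with eigenvalues $-2\nu,\nu,\nu$ respectively, where $\mathfrak e^1_t=a^{-1}\mathfrak e^1_{t_0}$, $\mathfrak e^2_t=b^{-1}\mathfrak e^2_{t_0}$, $\mathfrak e^3_t=b^{-1}\mathfrak e^3_{t_0}$ and $\star$ is the Hodge star. Conformally Kähler for a complex structure $J$ means that some metric conformal to $g$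 is Kähler (pseudo-Kähler in the case $\varepsilon=-1$) with respect to $J$.
   Formalization: The formula for ν is corrected: the denominator has a² instead of a³. As printed it fails away from a=1, e.g. for the complex hyperbolic plane (ε=1, k=1, a=e^{-2t}, b=e^{-t}, Λ=-6), where ν=-4 is constant but the printed formula gives -4e^{2t}. *)

theory Defs
  imports "HOL-Analysis.Analysis"
begin

section \<open>Smooth functions\<close>

primrec ck_on :: "nat \<Rightarrow> 'a::euclidean_space set \<Rightarrow> ('a \<Rightarrow> 'b::real_normed_vector) \<Rightarrow> bool" where
  "ck_on 0 S f \<longleftrightarrow> continuous_on S f"
| "ck_on (Suc n) S f \<longleftrightarrow> (\<forall>x\<in>S. f differentiable (at x)) \<and>
     (\<forall>v\<in>Basis. ck_on n S (\<lambda>x. frechet_derivative f (at x) v))"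

definition smooth_on :: "'a::euclidean_space set \<Rightarrow> ('a \<Rightarrow> 'b::real_normed_vector) \<Rightarrow> bool" where
  "smooth_on S f \<longleftrightarrow> (\<forall>n. ck_on n S f)"

definition pd :: "'n \<Rightarrow> (real^'n \<Rightarrow> real) \<Rightarrow> real^'n \<Rightarrow> real" where
  "pd i f x = frechet_derivative f (at x) (axis i 1)"

section \<open>Pseudo-Riemannian geometry of open subsets of coordinate space\<close>

text \<open>A metric is given by its matrix of components \<open>g x $ i $ j\<close>; only its values on the
  open set under consideration matter. A two-form is a skew matrix of components.\<close>

definition pseudo_riemannian :: "(real^'n) set \<Rightarrow> (real^'n \<Rightarrow> real^'n^'n) \<Rightarrow> bool" where
  "pseudo_riemannian M g \<longleftrightarrow> smooth_on M g \<and> (\<forall>x\<in>M. transpose (g x) = g x \<and> invertible (g x))"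

definition riemannian :: "(real^'n) set \<Rightarrow> (real^'n \<Rightarrow> real^'n^'n) \<Rightarrow> bool" where
  "riemannian M g \<longleftrightarrow> pseudo_riemannian M g \<and> (\<forall>x\<in>M. \<forall>v. v \<noteq> 0 \<longrightarrow> v \<bullet> (g x *v v) > 0)"

definition neutral_signature :: "(real^4) set \<Rightarrow> (real^4 \<Rightarrow> real^4^4) \<Rightarrow> bool" where
  "neutral_signature M g \<longleftrightarrow> pseudo_riemannian M g \<and>
     (\<forall>x\<in>M. \<exists>P N. subspace P \<and> subspace N \<and> dim P = 2 \<and> dim N = 2 \<and>
        (\<forall>v\<in>P. v \<noteq> 0 \<longrightarrow> v \<bullet> (g x *v v) > 0) \<and> (\<forall>v\<in>N. v \<noteq> 0 \<longrightarrow> v \<bullet> (g x *v v) < 0))"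

text \<open>\<open>christoffel g x l i j\<close> is $\Gamma^l_{ij}$.\<close>

definition christoffel :: "(real^'n \<Rightarrow> real^'n^'n) \<Rightarrow> real^'n \<Rightarrow> 'n \<Rightarrow> 'n \<Rightarrow> 'n \<Rightarrow> real" where
  "christoffel g x l i j = (\<Sum>m\<in>UNIV. matrix_inv (g x) $ l $ m *
      (pd i (\<lambda>y. g y $ j $ m) x + pd j (\<lambda>y. g y $ i $ m) x - pd m (\<lambda>y. g y $ i $ j) x)) / 2"

text \<open>Conventions: $R(X,Y)Z = \nabla_X\nabla_Y Z - \nabla_Y\nabla_X Z - \nabla_{[X,Y]}Z$;
  \<open>riemann g x l i j k\<close> is the \<open>l\<close>-th component of $R(\partial_i,\partial_j)\partial_k$ and
  \<open>riemann_lower g x i j k l\<close> is $R_{ijkl} = g(R(\partial_i,\partial_j)\partial_k,\partial_l)$. Thus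
  constant curvature $K$ means $R_{ijkl} = K (g_{jk}g_{il} - g_{ik}g_{jl})$, and round
  spheres have positive Ricci curvature.\<close>

definition riemann :: "(real^'n \<Rightarrow> real^'n^'n) \<Rightarrow> real^'n \<Rightarrow> 'n \<Rightarrow> 'n \<Rightarrow> 'n \<Rightarrow> 'n \<Rightarrow> real" where
  "riemann g x l i j k =
     pd i (\<lambda>y. christoffel g y l j k) x - pd j (\<lambda>y. christoffel g y l i k) x
     + (\<Sum>m\<in>UNIV. christoffel g x l i m * christoffel g x m j k
                - christoffel g x l j m * christoffel g x m i k)"

definition riemann_lower :: "(real^'n \<Rightarrow> real^'n^'n) \<Rightarrow> real^'n \<Rightarrow> 'n \<Rightarrow> 'n \<Rightarrow> 'n \<Rightarrow> 'n \<Rightarrow> real" where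
  "riemann_lower g x i j k l = (\<Sum>m\<in>UNIV. riemann g x m i j k * g x $ m $ l)"

definition ricci :: "(real^'n \<Rightarrow> real^'n^'n) \<Rightarrow> real^'n \<Rightarrow> 'n \<Rightarrow> 'n \<Rightarrow> real" where
  "ricci g x j k = (\<Sum>i\<in>UNIV. riemann g x i i j k)"

definition scalar_curvature :: "(real^'n \<Rightarrow> real^'n^'n) \<Rightarrow> real^'n \<Rightarrow> real" where
  "scalar_curvature g x = (\<Sum>i\<in>UNIV. \<Sum>j\<in>UNIV. matrix_inv (g x) $ i $ j * ricci g x i j)"

definition einstein :: "(real^'n) set \<Rightarrow> real \<Rightarrow> (real^'n \<Rightarrow> real^'n^'n) \<Rightarrow> bool" where
  "einstein M \<Lambda> g \<longleftrightarrow> (\<forall>x\<in>M. \<forall>i j. ricci g x i j = \<Lambda> * g x $ i $ j)"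

text \<open>The trace-free part of the curvature tensor in dimension four.\<close>

definition weyl :: "(real^4 \<Rightarrow> real^4^4) \<Rightarrow> real^4 \<Rightarrow> 4 \<Rightarrow> 4 \<Rightarrow> 4 \<Rightarrow> 4 \<Rightarrow> real" where
  "weyl g x i j k l = riemann_lower g x i j k l
     - (ricci g x j k * g x $ i $ l - ricci g x i k * g x $ j $ l
        + g x $ j $ k * ricci g x i l - g x $ i $ k * ricci g x j l) / 2
     + scalar_curvature g x / 6 * (g x $ j $ k * g x $ i $ l - g x $ i $ k * g x $ j $ l)"

definition two_form :: "real^4^4 \<Rightarrow> bool" where
  "two_form \<omega> \<longleftrightarrow> transpose \<omega> = - \<omega>"

definition raise_indices :: "real^4^4 \<Rightarrow> real^4^4 \<Rightarrow> real^4^4" where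
  "raise_indices G \<omega> = matrix_inv G ** \<omega> ** transpose (matrix_inv G)"

text \<open>$(W\omega)_{ij} = W_{ijkl}\,\omega^{kl}$, summed over all \<open>k\<close> and \<open>l\<close>.\<close>

definition weyl_op :: "(real^4 \<Rightarrow> real^4^4) \<Rightarrow> real^4 \<Rightarrow> real^4^4 \<Rightarrow> real^4^4" where
  "weyl_op g x \<omega> =
     (\<chi> i j. \<Sum>k\<in>UNIV. \<Sum>l\<in>UNIV. weyl g x i j k l * raise_indices (g x) \<omega> $ k $ l)"

definition levi_civita :: "4 \<Rightarrow> 4 \<Rightarrow> 4 \<Rightarrow> 4 \<Rightarrow> real" where
  "levi_civita i j k l = det (vector [axis i 1, axis j 1, axis k 1, axis l 1] :: real^4^4)"

text \<open>An orientation of a connected open subset of coordinate space is a sign \<open>\<sigma>\<close>, relative to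
  the orientation given by the order of the coordinates.\<close>

definition hodge :: "real \<Rightarrow> real^4^4 \<Rightarrow> real^4^4 \<Rightarrow> real^4^4" where
  "hodge \<sigma> G \<omega> = (\<chi> i j. \<sigma> * sqrt \<bar>det G\<bar> / 2 *
     (\<Sum>k\<in>UNIV. \<Sum>l\<in>UNIV. levi_civita k l i j * raise_indices G \<omega> $ k $ l))"

definition weyl_self_dual :: "(real^4) set \<Rightarrow> real \<Rightarrow> (real^4 \<Rightarrow> real^4^4) \<Rightarrow> bool" where
  "weyl_self_dual M \<sigma> g \<longleftrightarrow>
     (\<forall>x\<in>M. \<forall>\<omega>. two_form \<omega> \<longrightarrow> hodge \<sigma> (g x) (weyl_op g x \<omega>) = weyl_op g x \<omega>)"

definition quaternionic_kaehler :: "(real^4) set \<Rightarrow> real \<Rightarrow> real \<Rightarrow> (real^4 \<Rightarrow> real^4^4) \<Rightarrow> bool" where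
  "quaternionic_kaehler M \<sigma> \<Lambda> g \<longleftrightarrow>
     riemannian M g \<and> \<Lambda> \<noteq> 0 \<and> einstein M \<Lambda> g \<and> weyl_self_dual M \<sigma> g"

definition quaternionic_parakaehler :: "(real^4) set \<Rightarrow> real \<Rightarrow> real \<Rightarrow> (real^4 \<Rightarrow> real^4^4) \<Rightarrow> bool" where
  "quaternionic_parakaehler M \<sigma> \<Lambda> g \<longleftrightarrow>
     neutral_signature M g \<and> \<Lambda> \<noteq> 0 \<and> einstein M \<Lambda> g \<and> weyl_self_dual M \<sigma> g"

section \<open>Complex structures and conformally Kaehler metrics\<close>

text \<open>\<open>J x $ i $ j\<close> is $J^i_j$. Integrability is the vanishing of the Nijenhuis tensor
  $N^k_{ij}$.\<close>

definition complex_structure :: "(real^'n) set \<Rightarrow> (real^'n \<Rightarrow> real^'n^'n) \<Rightarrow> bool" where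
  "complex_structure M J \<longleftrightarrow> smooth_on M J \<and> (\<forall>x\<in>M. J x ** J x = - mat 1) \<and>
     (\<forall>x\<in>M. \<forall>i j k. (\<Sum>l\<in>UNIV.
          J x $ l $ i * pd l (\<lambda>y. J y $ k $ j) x - J x $ l $ j * pd l (\<lambda>y. J y $ k $ i) x
        - J x $ k $ l * (pd i (\<lambda>y. J y $ l $ j) x - pd j (\<lambda>y. J y $ l $ i) x)) = 0)"

definition closed_two_form :: "(real^'n) set \<Rightarrow> (real^'n \<Rightarrow> real^'n^'n) \<Rightarrow> bool" where
  "closed_two_form M \<omega> \<longleftrightarrow> (\<forall>x\<in>M. \<forall>i j k. pd i (\<lambda>y. \<omega> y $ j $ k) x
       + pd j (\<lambda>y. \<omega> y $ k $ i) x + pd k (\<lambda>y. \<omega> y $ i $ j) x = 0)"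

text \<open>The matrix \<open>transpose (J x) ** g x\<close> represents the fundamental form $g(J\cdot,\cdot)$. For
  positive definite \<open>g\<close> this is the notion of a Kaehler metric.\<close>

definition pseudo_kaehler :: "(real^'n) set \<Rightarrow> (real^'n \<Rightarrow> real^'n^'n) \<Rightarrow> (real^'n \<Rightarrow> real^'n^'n) \<Rightarrow> bool" where
  "pseudo_kaehler M g J \<longleftrightarrow> pseudo_riemannian M g \<and> complex_structure M J \<and>
     (\<forall>x\<in>M. transpose (J x) ** g x ** J x = g x) \<and>
     closed_two_form M (\<lambda>x. transpose (J x) ** g x)"

definition conformally_kaehler :: "(real^'n) set \<Rightarrow> (real^'n \<Rightarrow> real^'n^'n) \<Rightarrow> (real^'n \<Rightarrow> real^'n^'n) \<Rightarrow> bool" where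
  "conformally_kaehler M g J \<longleftrightarrow>
     (\<exists>F. smooth_on M F \<and> (\<forall>x\<in>M. F x > 0) \<and> pseudo_kaehler M (\<lambda>x. F x *\<^sub>R g x) J)"

definition induces_orientation :: "(real^4) set \<Rightarrow> (real^4 \<Rightarrow> real^4^4) \<Rightarrow> real \<Rightarrow> bool" where
  "induces_orientation M J \<sigma> \<longleftrightarrow> (\<forall>x\<in>M. \<forall>u v.
     let B = (vector [u, J x *v u, v, J x *v v] :: real^4^4)
     in det B \<noteq> 0 \<longrightarrow> \<sigma> * det B > 0)"

section \<open>The Heisenberg group\<close>

text \<open>The group of unipotent upper triangular matrices, on the manifold of triples
  $(x,y,z)$.\<close>

definition heis_mult :: "real^3 \<Rightarrow> real^3 \<Rightarrow> real^3" where
  "heis_mult p q = vector [p $ 1 + q $ 1, p $ 2 + q $ 2, p $ 3 + q $ 3 + p $ 1 * q $ 2]"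

definition left_invariant :: "(real^3 \<Rightarrow> real^3) \<Rightarrow> bool" where
  "left_invariant X \<longleftrightarrow>
     (\<forall>h p. frechet_derivative (heis_mult h) (at p) (X p) = X (heis_mult h p))"

definition lie_bracket :: "(real^3 \<Rightarrow> real^3) \<Rightarrow> (real^3 \<Rightarrow> real^3) \<Rightarrow> real^3 \<Rightarrow> real^3" where
  "lie_bracket X Y p = frechet_derivative Y (at p) (X p) - frechet_derivative X (at p) (Y p)"

definition heis_centre :: "(real^3 \<Rightarrow> real^3) set" where
  "heis_centre = {X. left_invariant X \<and> (\<forall>Y. left_invariant Y \<longrightarrow> lie_bracket X Y = (\<lambda>p. 0))}"

definition heis_frame :: "real \<Rightarrow> (3 \<Rightarrow> real^3 \<Rightarrow> real^3) \<Rightarrow> bool" where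
  "heis_frame k e \<longleftrightarrow> (\<forall>i. left_invariant (e i)) \<and>
     (\<forall>p. inj (\<lambda>i. e i p) \<and> independent (range (\<lambda>i. e i p))) \<and>
     heis_centre = range (\<lambda>c p. c *\<^sub>R e 1 p) \<and>
     lie_bracket (e 1) (e 2) = (\<lambda>p. 0) \<and> lie_bracket (e 1) (e 3) = (\<lambda>p. 0) \<and>
     lie_bracket (e 2) (e 3) = (\<lambda>p. (- 2 * k) *\<^sub>R e 1 p)"

definition dual_coframe :: "(3 \<Rightarrow> real^3 \<Rightarrow> real^3) \<Rightarrow> (3 \<Rightarrow> real^3 \<Rightarrow> real^3) \<Rightarrow> bool" where
  "dual_coframe e \<theta> \<longleftrightarrow> (\<forall>i j p. \<theta> i p \<bullet> e j p = (if i = j then 1 else 0))"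

section \<open>Heisenberg four-manifolds\<close>

text \<open>The product of the interval \<open>I\<close> and the Heisenberg group has coordinates $(t,x,y,z)$.\<close>

definition heis_manifold :: "real set \<Rightarrow> (real^4) set" where
  "heis_manifold I = {x. x $ 1 \<in> I}"

definition hpart :: "real^4 \<Rightarrow> real^3" where
  "hpart x = vector [x $ 2, x $ 3, x $ 4]"

text \<open>A vector field or one-form on the group, viewed on the product.\<close>

definition lift :: "(real^3 \<Rightarrow> real^3) \<Rightarrow> real^4 \<Rightarrow> real^4" where
  "lift X x = (let v = X (hpart x) in vector [0, v $ 1, v $ 2, v $ 3])"

definition dt :: "real^4" where
  "dt = axis 1 1"

definition tensor :: "real^4 \<Rightarrow> real^4 \<Rightarrow> real^4^4" where
  "tensor \<alpha> \<beta> = (\<chi> i j. \<alpha> $ i * \<beta> $ j)"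

definition wedge :: "real^4 \<Rightarrow> real^4 \<Rightarrow> real^4^4" where
  "wedge \<alpha> \<beta> = tensor \<alpha> \<beta> - tensor \<beta> \<alpha>"

definition heis_metric ::
    "real \<Rightarrow> (real \<Rightarrow> real) \<Rightarrow> (real \<Rightarrow> real) \<Rightarrow> (3 \<Rightarrow> real^3 \<Rightarrow> real^3) \<Rightarrow> real^4 \<Rightarrow> real^4^4" where
  "heis_metric \<epsilon> a b \<theta> x =
     \<epsilon> *\<^sub>R tensor dt dt
     + (\<epsilon> / (a (x $ 1))\<^sup>2) *\<^sub>R tensor (lift (\<theta> 1) x) (lift (\<theta> 1) x)
     + (1 / (b (x $ 1))\<^sup>2) *\<^sub>R
         (tensor (lift (\<theta> 2) x) (lift (\<theta> 2) x) + tensor (lift (\<theta> 3) x) (lift (\<theta> 3) x))"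

definition timelike_centre :: "(real^4) set \<Rightarrow> (real^4 \<Rightarrow> real^4^4) \<Rightarrow> bool" where
  "timelike_centre M g \<longleftrightarrow> (\<forall>Z\<in>heis_centre. Z \<noteq> (\<lambda>p. 0) \<longrightarrow>
     (\<forall>x\<in>M. lift Z x \<bullet> (g x *v lift Z x) < 0))"

text \<open>At zeros of \<open>b'\<close> the quotient for \<open>a'\<close> has the indeterminate form \<open>0/0\<close> (its numerator
  vanishes by the second equation), so nothing is required of \<open>a'\<close> there. The denominator
  in the second equation is automatically nonzero when \<open>\<Lambda> \<noteq> 0\<close>.\<close>

definition heis_ode ::
    "real set \<Rightarrow> real \<Rightarrow> real \<Rightarrow> real \<Rightarrow> (real \<Rightarrow> real) \<Rightarrow> (real \<Rightarrow> real) \<Rightarrow> bool" where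
  "heis_ode I \<epsilon> \<Lambda> k a b \<longleftrightarrow> (\<forall>t\<in>I.
     (deriv b t \<noteq> 0 \<longrightarrow>
        deriv a t = - (k\<^sup>2 * b t ^ 6 + (a t)\<^sup>2 * (\<epsilon> * \<Lambda> * (b t)\<^sup>2 + (deriv b t)\<^sup>2))
                      / (2 * a t * b t * deriv b t)) \<and>
     \<epsilon> * \<Lambda> = 3 * (k * b t ^ 3 - a t * deriv b t) ^ 3
              / ((a t)\<^sup>2 * (b t)\<^sup>2 * (- 3 * k * b t ^ 3 + a t * deriv b t)))"

definition coframe_at ::
    "(real \<Rightarrow> real) \<Rightarrow> (real \<Rightarrow> real) \<Rightarrow> (3 \<Rightarrow> real^3 \<Rightarrow> real^3) \<Rightarrow> 3 \<Rightarrow> real^4 \<Rightarrow> real^4" where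
  "coframe_at a b \<theta> i x = (1 / (if i = 1 then a (x $ 1) else b (x $ 1))) *\<^sub>R lift (\<theta> i) x"

definition sd_form ::
    "real \<Rightarrow> (real^4 \<Rightarrow> real^4^4) \<Rightarrow> (real \<Rightarrow> real) \<Rightarrow> (real \<Rightarrow> real) \<Rightarrow> (3 \<Rightarrow> real^3 \<Rightarrow> real^3)
       \<Rightarrow> 3 \<Rightarrow> real^4 \<Rightarrow> real^4^4" where
  "sd_form \<sigma> g a b \<theta> i x = (let \<alpha> = wedge dt (coframe_at a b \<theta> i x) in \<alpha> + hodge \<sigma> (g x) \<alpha>)"

text \<open>The exponent of \<open>a\<close> is 2. It is forced by invariance under a change of the base point
  \<open>t\<^sub>0\<close>, which rescales \<open>a\<close> and \<open>k\<close> by a common factor and leaves the eigenvalues unchanged.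
  With exponent 3 the formula would hold only where \<open>a = 1\<close>, in particular it would fail for
  the complex hyperbolic plane, where \<open>k = 1\<close>, \<open>a t = exp (- 2 * t)\<close>, \<open>b t = exp (- t)\<close>.\<close>

definition weyl_nu :: "real \<Rightarrow> real \<Rightarrow> (real \<Rightarrow> real) \<Rightarrow> (real \<Rightarrow> real) \<Rightarrow> real \<Rightarrow> real" where
  "weyl_nu \<epsilon> k a b t =
     16 * k ^ 3 * b t ^ 7 / (\<epsilon> * (a t)\<^sup>2 * (- 3 * k * b t ^ 3 + a t * deriv b t))"

end

theory Submission
  imports Defs
begin

text \<open>
  All curvature computations take place in the orthonormal coframe \<open>dt\<close>, \<open>\<theta>\<^sup>1/a\<close>,
  \<open>\<theta>\<^sup>2/b\<close>, \<open>\<theta>\<^sup>3/b\<close>, whose structure functions depend on \<open>t\<close> only: with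
  \<open>H1 = - a'/a\<close>, \<open>H2 = - b'/b\<close> and \<open>m = k b\<^sup>2/a\<close>, the exterior derivatives are
  \<open>H1 dt \<and> e\<^sup>1 + 2 m e\<^sup>2 \<and> e\<^sup>3\<close>, \<open>H2 dt \<and> e\<^sup>2\<close> and \<open>H2 dt \<and> e\<^sup>3\<close>. The Weyl tensor of an
  Einstein metric of this shape preserves each of the planes spanned by \<open>dt \<and> e\<^sup>i\<close> and
  \<open>\<star>(dt \<and> e\<^sup>i)\<close>, and self-duality determines it from its values on the forms \<open>dt \<and> e\<^sup>i\<close>.
  These are fixed by the \<open>dt\<close> and \<open>e\<^sup>1\<close> components of the Einstein equation; the two first order
  equations for \<open>a\<close> and \<open>b\<close> then yield \<open>\<nu>\<close>.

  The complex structures send \<open>\<partial>\<^sub>t\<close> to \<open>\<plusminus> e\<^sub>1\<close> and \<open>e\<^sub>2\<close> to \<open>e\<^sub>3\<close>. They are integrable for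
  arbitrary \<open>a\<close> and \<open>b\<close>, and multiplying the metric by \<open>f(t)\<close> makes the fundamental form closed
  exactly when \<open>(f/b\<^sup>2)' = \<plusminus> 2 \<epsilon> k f/a\<close>, a linear equation with a positive solution.
\<close>

section \<open>Smooth functions\<close>

text \<open>The definitions are in coordinates, whereas the calculation is manageable only in a
  frame; the passage between the two shapes the proof. The coframe is kept as a matrix
  \<open>\<Theta>\<close> whose rows are its elements. A bilinear form with frame components
  \<open>N\<close> is then \<open>transpose \<Theta> ** N ** \<Theta>\<close>, and the inverse
  metric, the Hodge star, the curvature and the Nijenhuis tensor are each carried across such
  products by one general lemma. The Levi-Civita connection is not derived but written down and
  recognised by its two characterising equations. The constant 16 in \<nu> is 2 times 8: the 8 = 24
  / 3 is what remains when two cubic polynomials in k b^3 and a b' nearly cancel, and the 2 reflects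
  that the Weyl operator sums over ordered pairs of indices. The two complex structures differ by a
  sign on the plane of \<open>\<partial>\<^sub>t\<close> and \<open>e\<^sub>1\<close> only, and such
  a change reverses the induced orientation.\<close>

lemma ck_on_Suc_imp: "ck_on (Suc n) S f \<Longrightarrow> ck_on n S f"
proof (induction n arbitrary: f)
  case 0
  then show ?case
    by (auto intro!: continuous_at_imp_continuous_on differentiable_imp_continuous_within)
next
  case (Suc n)
  then show ?case by (subst ck_on.simps(2)) (metis ck_on.simps(2))
qed

text \<open>\<open>frechet_derivative\<close> chooses among all derivatives, so functions with the
  same \<open>has_derivative\<close> predicate receive the same value, even at points where neither
  is differentiable.\<close>

lemma frechet_derivative_cong_open:
  assumes "open S" "x \<in> S" "\<And>y. y \<in> S \<Longrightarrow> f y = g y"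
  shows "frechet_derivative f (at x) = frechet_derivative g (at x)"
    and "f differentiable (at x) \<longleftrightarrow> g differentiable (at x)"
proof -
  have "(f has_derivative D) (at x) \<longleftrightarrow> (g has_derivative D) (at x)" for D
    using assms by (metis has_derivative_transform_within_open)
  then show "frechet_derivative f (at x) = frechet_derivative g (at x)"
    and "f differentiable (at x) \<longleftrightarrow> g differentiable (at x)"
    by (simp_all add: frechet_derivative_def differentiable_def)
qed

lemma ck_on_cong:
  assumes "open S" "\<And>y. y \<in> S \<Longrightarrow> f y = g y"
  shows "ck_on n S f \<longleftrightarrow> ck_on n S g"
  using assms(2)
proof (induction n arbitrary: f g)
  case 0
  then show ?case by (simp cong: continuous_on_cong)
next
  case (Suc n)
  have "frechet_derivative f (at x) = frechet_derivative g (at x)"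
    "f differentiable (at x) \<longleftrightarrow> g differentiable (at x)" if "x \<in> S" for x
    using frechet_derivative_cong_open[OF assms(1) that] Suc.prems by blast+
  then show ?case by (simp add: Suc.IH[of "\<lambda>x. frechet_derivative f (at x) _" "\<lambda>x. frechet_derivative g (at x) _"])
qed

text \<open>The recursion of \<open>ck_on\<close> runs through the chosen
  \<open>frechet_derivative\<close>; here a derivative known by a formula may take its
  place.\<close>

lemma ck_on_SucI:
  assumes "open S" "\<And>x. x \<in> S \<Longrightarrow> (f has_derivative f' x) (at x)"
    "\<And>v. v \<in> Basis \<Longrightarrow> ck_on n S (\<lambda>x. f' x v)"
  shows "ck_on (Suc n) S f"
proof -
  have "frechet_derivative f (at x) = f' x" if "x \<in> S" for x
    using frechet_derivative_at[OF assms(2)[OF that]] by simp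
  then have "ck_on n S (\<lambda>x. frechet_derivative f (at x) v)" if "v \<in> Basis" for v
    using ck_on_cong[OF assms(1), of "\<lambda>x. frechet_derivative f (at x) v" "\<lambda>x. f' x v"] assms(3) that
    by simp
  then show ?thesis
    using assms(2) by (auto simp: differentiable_def)
qed

lemma ck_on_const: "open S \<Longrightarrow> ck_on n S (\<lambda>x. c)"
proof (induction n arbitrary: c)
  case (Suc n)
  then show ?case by (intro ck_on_SucI[where f' = "\<lambda>x v. 0"]) auto
qed auto

lemma ck_on_bounded_linear:
  assumes "open S" "bounded_linear L"
  shows "ck_on n S L"
proof (cases n)
  case 0
  then show ?thesis using assms by (simp add: linear_continuous_on)
next
  case (Suc n)
  then show ?thesis
    using assms by (auto intro!: ck_on_SucI[where f' = "\<lambda>x. L"] ck_on_const bounded_linear_imp_has_derivative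
        simp del: ck_on.simps)
qed

lemma ck_on_add:
  assumes "open S" "ck_on n S f" "ck_on n S g"
  shows "ck_on n S (\<lambda>x. f x + g x)"
  using assms(2,3)
proof (induction n arbitrary: f g)
  case (Suc n)
  then show ?case
    by (intro ck_on_SucI[where f' = "\<lambda>x v. frechet_derivative f (at x) v + frechet_derivative g (at x) v"])
      (auto simp: assms frechet_derivative_works intro!: has_derivative_add)
qed (auto intro: continuous_on_add)

text \<open>The product rule expresses the derivative by the same \<open>h\<close>, so one induction
  covers products of reals, scalar multiples and matrix products.\<close>

lemma ck_on_bilinear:
  assumes "open S" "bounded_bilinear h" "ck_on n S f" "ck_on n S g"
  shows "ck_on n S (\<lambda>x. h (f x) (g x))"
  using assms(3,4)
proof (induction n arbitrary: f g)
  case 0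
  then show ?case by (simp add: bounded_bilinear.continuous_on[OF assms(2)])
next
  case (Suc n)
  show ?case
  proof (rule ck_on_SucI[where f' = "\<lambda>x v. h (f x) (frechet_derivative g (at x) v) + h (frechet_derivative f (at x) v) (g x)"])
    show "((\<lambda>x. h (f x) (g x)) has_derivative
        (\<lambda>v. h (f x) (frechet_derivative g (at x) v) + h (frechet_derivative f (at x) v) (g x))) (at x)" if "x \<in> S" for x
      using Suc.prems that by (intro bounded_bilinear.FDERIV[OF assms(2)]) (auto simp: frechet_derivative_works)
    show "ck_on n S (\<lambda>x. h (f x) (frechet_derivative g (at x) v) + h (frechet_derivative f (at x) v) (g x))"
      if "v \<in> Basis" for v
      using Suc.prems that ck_on_Suc_imp[of n S f] ck_on_Suc_imp[of n S g]
      by (intro ck_on_add assms(1) Suc.IH) auto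
  qed (rule assms(1))
qed

lemma ck_on_deriv:
  fixes f :: "real \<Rightarrow> real"
  assumes "open S" "ck_on (Suc n) S f"
  shows "\<And>x. x \<in> S \<Longrightarrow> (f has_real_derivative deriv f x) (at x)" and "ck_on n S (deriv f)"
proof -
  show D: "(f has_real_derivative deriv f x) (at x)" if "x \<in> S" for x
    using assms that by (simp add: DERIV_deriv_iff_real_differentiable)
  have "frechet_derivative f (at x) 1 = deriv f x" if "x \<in> S" for x
    using frechet_derivative_at[OF D[OF that, unfolded has_field_derivative_def]]
    by (metis mult.right_neutral)
  then show "ck_on n S (deriv f)"
    using assms ck_on_cong[OF assms(1), of "\<lambda>x. frechet_derivative f (at x) 1" "deriv f"] by simp
qed

lemma ck_on_Suc_real:
  fixes f :: "real \<Rightarrow> real"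
  assumes "open S" "\<And>x. x \<in> S \<Longrightarrow> (f has_real_derivative f' x) (at x)" "ck_on n S f'"
  shows "ck_on (Suc n) S f"
  using assms by (intro ck_on_SucI[where f' = "\<lambda>x v. f' x * v"]) (auto simp: has_field_derivative_def)

lemma ck_on_real_mult:
  fixes f g :: "'a::euclidean_space \<Rightarrow> real"
  shows "open S \<Longrightarrow> ck_on n S f \<Longrightarrow> ck_on n S g \<Longrightarrow> ck_on n S (\<lambda>x. f x * g x)"
  by (rule ck_on_bilinear[OF _ bounded_bilinear_mult])

text \<open>The chain rule produces \<open>deriv h\<close> composed with \<open>f\<close>, which is
  why the induction generalises over \<open>h\<close>.\<close>

lemma ck_on_compose_real:
  fixes h f :: "real \<Rightarrow> real"
  assumes "open S" "open T" "f ` S \<subseteq> T" "ck_on n T h" "ck_on n S f"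
  shows "ck_on n S (\<lambda>x. h (f x))"
  using assms(4,5)
proof (induction n arbitrary: h)
  case 0
  then show ?case using assms(3) by (auto intro: continuous_on_compose2)
next
  case (Suc n)
  note dh = ck_on_deriv[OF assms(2) Suc.prems(1)] and df = ck_on_deriv[OF assms(1) Suc.prems(2)]
  have "ck_on n S (\<lambda>x. deriv h (f x) * deriv f x)"
    using Suc.IH[OF dh(2)] ck_on_Suc_imp[OF Suc.prems(2)] df(2) assms(1) by (intro ck_on_real_mult) auto
  moreover have "((\<lambda>x. h (f x)) has_real_derivative deriv h (f x) * deriv f x) (at x)" if "x \<in> S" for x
    using DERIV_chain2[OF dh(1) df(1)[OF that]] assms(3) that by blast
  ultimately show ?case using assms(1) by (intro ck_on_Suc_real) auto
qed

lemma ck_on_exp: "ck_on n UNIV (exp :: real \<Rightarrow> real)"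
  by (induction n) (auto intro!: ck_on_Suc_real[where f' = exp] continuous_intros derivative_eq_intros simp del: ck_on.simps(2))

lemma ck_on_inverse: "ck_on n (- {0}) (inverse :: real \<Rightarrow> real)"
proof (induction n)
  case 0
  then show ?case by (auto intro!: continuous_intros)
next
  case (Suc n)
  have "ck_on n (- {0}) (\<lambda>x::real. - 1 * (inverse x * inverse x))"
    using Suc by (intro ck_on_real_mult ck_on_const) auto
  moreover have "(inverse has_real_derivative - 1 * (inverse x * inverse x)) (at x)" if "x \<in> - {0}" for x :: real
    using that by (auto intro!: derivative_eq_intros simp: power2_eq_square)
  ultimately show ?case by (intro ck_on_Suc_real) auto
qed

text \<open>This turns smoothness of \<open>a\<close> and \<open>b\<close> on the interval into
  smoothness on the four-manifold, which is the preimage of the interval under the first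
  coordinate.\<close>

lemma ck_on_compose_coord:
  fixes h :: "real \<Rightarrow> real" and i :: "'n::finite"
  assumes "open S" "ck_on n S h"
  shows "ck_on n {x :: real^'n. x $ i \<in> S} (\<lambda>x. h (x $ i))"
proof -
  have op: "open {x :: real^'n. x $ i \<in> S}"
    using open_vimage_vec_nth[OF assms(1), of i] by (simp add: vimage_def)
  show ?thesis
    using assms(2)
  proof (induction n arbitrary: h)
    case 0
    then show ?case by (auto intro!: continuous_on_compose2[of S h] continuous_intros)
  next
    case (Suc n)
    note dh = ck_on_deriv[OF assms(1) Suc.prems]
    show ?case
    proof (rule ck_on_SucI[OF op, where f' = "\<lambda>x v. deriv h (x $ i) * (v $ i)"])
      show "((\<lambda>x. h (x $ i)) has_derivative (\<lambda>v. deriv h (x $ i) * v $ i)) (at x)"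
        if "x \<in> {x. x $ i \<in> S}" for x
        using that dh(1)[of "x $ i"] has_derivative_compose[of "\<lambda>x. x $ i" "\<lambda>v. v $ i" x UNIV h]
        by (auto simp: has_field_derivative_def bounded_linear_imp_has_derivative bounded_linear_vec_nth)
      show "ck_on n {x. x $ i \<in> S} (\<lambda>x. deriv h (x $ i) * v $ i)" for v :: "real^'n"
        using Suc.IH[OF dh(2)] by (intro ck_on_real_mult op ck_on_const)
    qed
  qed
qed

lemma smooth_on_const: "open S \<Longrightarrow> smooth_on S (\<lambda>x. c)"
  by (simp add: smooth_on_def ck_on_const)

lemma smooth_on_bounded_linear: "open S \<Longrightarrow> bounded_linear L \<Longrightarrow> smooth_on S L"
  by (simp add: smooth_on_def ck_on_bounded_linear)

lemma smooth_on_add: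
  "open S \<Longrightarrow> smooth_on S f \<Longrightarrow> smooth_on S g \<Longrightarrow> smooth_on S (\<lambda>x. f x + g x)"
  by (simp add: smooth_on_def ck_on_add)

lemma smooth_on_bilinear:
  "open S \<Longrightarrow> bounded_bilinear h \<Longrightarrow> smooth_on S f \<Longrightarrow> smooth_on S g \<Longrightarrow> smooth_on S (\<lambda>x. h (f x) (g x))"
  by (simp add: smooth_on_def ck_on_bilinear)

lemmas smooth_on_mult = smooth_on_bilinear[OF _ bounded_bilinear_mult]
lemmas smooth_on_scaleR = smooth_on_bilinear[OF _ bounded_bilinear_scaleR]

lemma smooth_on_exp:
  fixes f :: "real \<Rightarrow> real"
  shows "open S \<Longrightarrow> smooth_on S f \<Longrightarrow> smooth_on S (\<lambda>x. exp (f x))"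
  unfolding smooth_on_def using ck_on_compose_real[OF _ open_UNIV _ ck_on_exp] by blast

lemma smooth_on_divide:
  fixes f g :: "real \<Rightarrow> real"
  assumes "open S" "smooth_on S f" "smooth_on S g" "\<And>x. x \<in> S \<Longrightarrow> g x \<noteq> 0"
  shows "smooth_on S (\<lambda>x. f x / g x)"
proof -
  have "g ` S \<subseteq> - {0}"
    using assms(4) by auto
  then have "smooth_on S (\<lambda>x. inverse (g x))"
    using assms ck_on_compose_real[OF assms(1) _ _ ck_on_inverse, of g]
    unfolding smooth_on_def by (metis open_Compl closed_singleton)
  then show ?thesis
    unfolding divide_inverse by (intro smooth_on_mult assms)
qed

lemma smooth_on_deriv:
  fixes f :: "real \<Rightarrow> real"
  assumes "open S" "smooth_on S f"
  shows "\<And>x. x \<in> S \<Longrightarrow> (f has_real_derivative deriv f x) (at x)" and "smooth_on S (deriv f)"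
  using assms ck_on_deriv[OF assms(1)] unfolding smooth_on_def by blast+

lemma smooth_on_antiderivative:
  fixes f :: "real \<Rightarrow> real"
  assumes "open S" "\<And>x. x \<in> S \<Longrightarrow> (f has_real_derivative f' x) (at x)" "smooth_on S f'"
  shows "smooth_on S f"
  unfolding smooth_on_def
proof
  show "ck_on n S f" for n
    using ck_on_Suc_imp[OF ck_on_Suc_real[OF assms(1,2)]] assms(3) unfolding smooth_on_def by blast
qed

lemma smooth_on_compose_coord:
  fixes h :: "real \<Rightarrow> real" and i :: "'n::finite"
  shows "open S \<Longrightarrow> smooth_on S h \<Longrightarrow> smooth_on {x :: real^'n. x $ i \<in> S} (\<lambda>x. h (x $ i))"
  by (simp add: smooth_on_def ck_on_compose_coord)

section \<open>Antiderivatives and signs on an interval\<close>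

lemma antiderivative_on_open_interval:
  fixes f :: "real \<Rightarrow> real"
  assumes "open I" "is_interval I" "continuous_on I f"
  obtains F where "\<And>x. x \<in> I \<Longrightarrow> (F has_real_derivative f x) (at x)"
proof (cases "I = {}")
  case False
  \<comment> \<open>Extended real endpoints let \<open>einterval_antiderivative\<close> cover
    bounded and unbounded intervals alike.\<close>
  define l u where "l = Inf (ereal ` I)" and "u = Sup (ereal ` I)"
  have in_I: "x \<in> I" if x: "l < ereal x" "ereal x < u" for x
  proof -
    obtain y z where "y \<in> I" "ereal y < ereal x" "z \<in> I" "ereal x < ereal z"
      using x unfolding l_def u_def Inf_less_iff less_Sup_iff by blast
    then show ?thesis
      using mem_is_interval_1_I[OF assms(2) \<open>y \<in> I\<close> \<open>z \<in> I\<close>] by simp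
  qed
  have bounds: "l < ereal x \<and> ereal x < u" if "x \<in> I" for x
  proof -
    \<comment> \<open>Openness supplies points of \<open>I\<close> on both sides of
      \<open>x\<close>, which makes the inequalities strict.\<close>
    obtain d where d: "d > 0" "ball x d \<subseteq> I"
      using assms(1) \<open>x \<in> I\<close> openE by blast
    have "x - d / 2 \<in> ball x d" "x + d / 2 \<in> ball x d"
      using d by (auto simp: dist_real_def)
    then have "x - d / 2 \<in> I" "x + d / 2 \<in> I"
      using d by auto
    then have "l \<le> ereal (x - d / 2)" "ereal (x + d / 2) \<le> u"
      unfolding l_def u_def by (auto intro: Inf_lower Sup_upper)
    moreover have "ereal (x - d / 2) < ereal x" "ereal x < ereal (x + d / 2)"
      using d(1) by auto
    ultimately show ?thesis
      using le_less_trans less_le_trans by blast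
  qed
  have "l < u"
    using False bounds by (meson ex_in_conv less_trans)
  moreover have "isCont f x" if "l < ereal x" "ereal x < u" for x
    using in_I[OF that] assms by (simp add: continuous_on_eq_continuous_at)
  ultimately obtain F where "\<And>x. l < ereal x \<Longrightarrow> ereal x < u \<Longrightarrow> (F has_vector_derivative f x) (at x)"
    using einterval_antiderivative[of l u f] by blast
  then show ?thesis
    using that bounds by (auto simp: has_real_derivative_iff_has_vector_derivative)
qed auto

lemma positive_on_interval:
  fixes f :: "real \<Rightarrow> real"
  assumes "is_interval I" "continuous_on I f" "\<And>t. t \<in> I \<Longrightarrow> f t \<noteq> 0" "t0 \<in> I" "f t0 > 0" "t \<in> I"
  shows "f t > 0"
proof (rule ccontr)
  assume "\<not> f t > 0"
  moreover have "is_interval (f ` I)"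
    using connected_continuous_image[OF assms(2)] assms(1) is_interval_connected_1 by blast
  ultimately have "0 \<in> f ` I"
    using mem_is_interval_1_I[of "f ` I" "f t" "f t0" 0] assms by auto
  then show False
    using assms(3) by auto
qed

lemma smooth_on_sum:
  "finite A \<Longrightarrow> open S \<Longrightarrow> (\<And>i. i \<in> A \<Longrightarrow> smooth_on S (f i)) \<Longrightarrow> smooth_on S (\<lambda>x. \<Sum>i\<in>A. f i x)"
  by (induction A rule: finite_induct) (auto simp: smooth_on_const smooth_on_add)

text \<open>\<open>smooth_on\<close> speaks of the derivative of the whole map, so the matrix is
  written as a finite sum of its entries times the matrix units
  \<open>axis i (axis j 1)\<close>.\<close>

lemma smooth_on_matrix:
  fixes A :: "'a::euclidean_space \<Rightarrow> real^'n^'m"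
  assumes "open S" "\<And>i j. smooth_on S (\<lambda>x. A x $ i $ j)"
  shows "smooth_on S A"
proof -
  have if_sum: "(\<Sum>x\<in>UNIV. if P then h x else 0) = (if P then \<Sum>x\<in>UNIV. h x else 0)" for P and h :: "'n \<Rightarrow> real"
    by simp
  have "(\<lambda>x. \<Sum>i\<in>UNIV. \<Sum>j\<in>UNIV. A x $ i $ j *\<^sub>R axis i (axis j 1)) = A"
    using if_sum
    by (simp add: fun_eq_iff vec_eq_iff axis_def if_distrib[where f = "\<lambda>v. v $ _"] if_distrib[where f = "\<lambda>v. _ * v"] cong: if_cong)
  moreover have "smooth_on S (\<lambda>x. \<Sum>i\<in>UNIV. \<Sum>j\<in>UNIV. A x $ i $ j *\<^sub>R axis i (axis j (1::real)))"
    by (intro smooth_on_sum smooth_on_scaleR smooth_on_const assms finite)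
  ultimately show ?thesis by simp
qed

section \<open>Partial derivatives and matrices\<close>

lemma bounded_bilinear_matrix_mult:
  "bounded_bilinear ((**) :: real^'n^'m \<Rightarrow> real^'k^'n \<Rightarrow> real^'k^'m)"
  unfolding bilinear_conv_bounded_bilinear[symmetric] bilinear_def
  by (auto intro!: linearI simp: matrix_add_ldistrib matrix_matrix_mult_def vec_eq_iff
      algebra_simps sum.distrib sum_distrib_left)

lemmas matrix_ring_simps =
  bounded_bilinear.add_left[OF bounded_bilinear_matrix_mult]
  bounded_bilinear.add_right[OF bounded_bilinear_matrix_mult]
  bounded_bilinear.diff_left[OF bounded_bilinear_matrix_mult]
  bounded_bilinear.diff_right[OF bounded_bilinear_matrix_mult]
  bounded_bilinear.minus_left[OF bounded_bilinear_matrix_mult]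
  bounded_bilinear.minus_right[OF bounded_bilinear_matrix_mult]
  matrix_mul_assoc

lemma matrix_inv_unique:
  fixes A B :: "real^'n^'n"
  assumes "A ** B = mat 1"
  shows "matrix_inv A = B"
proof -
  have "invertible A"
    using assms invertible_right_inverse by blast
  then have "matrix_inv A ** A = mat 1"
    unfolding matrix_inv_def invertible_def by (metis (mono_tags, lifting) someI_ex)
  then show ?thesis
    using assms by (metis matrix_mul_assoc matrix_mul_lid matrix_mul_rid)
qed

text \<open>To be read with \<open>T\<close> a coframe and \<open>E\<close> its dual frame:
  covariant components transform by \<open>T\<close>, contravariant ones by
  \<open>E\<close>.\<close>

lemma matrix_inv_congruence:
  fixes T E G :: "real^'n^'n"
  assumes "T ** E = mat 1" "invertible G"
  shows "matrix_inv (transpose T ** G ** T) = E ** matrix_inv G ** transpose E"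
proof (rule matrix_inv_unique)
  have "G ** matrix_inv G = mat 1"
    using assms(2) unfolding matrix_inv_def invertible_def by (metis (mono_tags, lifting) someI_ex)
  moreover have "transpose T ** transpose E = mat 1"
    using assms(1) by (metis matrix_left_right_inverse matrix_transpose_mul transpose_mat)
  ultimately show "transpose T ** G ** T ** (E ** matrix_inv G ** transpose E) = mat 1"
    by (metis assms(1) matrix_mul_assoc matrix_mul_rid)
qed

lemma raise_indices_congruence:
  assumes "T ** E = mat 1" "invertible G"
  shows "raise_indices (transpose T ** G ** T) (transpose T ** w ** T) = E ** raise_indices G w ** transpose E"
proof -
  have "transpose E ** transpose T = mat 1"
    using assms(1) by (metis matrix_transpose_mul transpose_mat)
  then have "A ** transpose E ** transpose T = A" "A ** T ** E = A" for A :: "real^4^4"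
    using assms(1) by (metis matrix_mul_assoc matrix_mul_rid)+
  then show ?thesis
    unfolding raise_indices_def matrix_inv_congruence[OF assms]
    by (simp add: matrix_transpose_mul matrix_mul_assoc)
qed

lemma pd_eqI: "(f has_derivative f') (at x) \<Longrightarrow> pd i f x = f' (axis i 1)"
  unfolding pd_def using frechet_derivative_at by metis

lemma pd_cong_open:
  assumes "open S" "x \<in> S" "\<And>y. y \<in> S \<Longrightarrow> f y = g y"
  shows "pd i f x = pd i g x"
  using frechet_derivative_cong_open(1)[OF assms] by (simp add: pd_def)

lemma pd_const [simp]: "pd i (\<lambda>y. c) x = 0"
  by (rule pd_eqI) simp

lemma pd_add:
  assumes "f differentiable (at x)" "g differentiable (at x)"
  shows "pd i (\<lambda>y. f y + g y) x = pd i f x + pd i g x"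
  using assms unfolding frechet_derivative_works pd_def[of i f] pd_def[of i g]
  by (intro pd_eqI) (rule has_derivative_add)

lemma pd_mult:
  assumes "f differentiable (at x)" "g differentiable (at x)"
  shows "pd i (\<lambda>y. f y * g y) x = pd i f x * g x + f x * pd i g x"
  using pd_eqI[OF has_derivative_mult[of f "frechet_derivative f (at x)" x UNIV g "frechet_derivative g (at x)"], of i]
    assms[unfolded frechet_derivative_works] by (simp add: pd_def)

lemma pd_sum:
  assumes "\<And>a. a \<in> A \<Longrightarrow> f a differentiable (at x)"
  shows "pd i (\<lambda>y. \<Sum>a\<in>A. f a y) x = (\<Sum>a\<in>A. pd i (f a) x)"
  using pd_eqI[OF has_derivative_sum[of A f "\<lambda>a. frechet_derivative (f a) (at x)" "at x"], of i]
    assms[unfolded frechet_derivative_works] by (simp add: pd_def)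

section \<open>Entrywise partial derivatives of matrix-valued maps\<close>

definition pdm :: "'n \<Rightarrow> (real^'n \<Rightarrow> real^'k^'m) \<Rightarrow> real^'n \<Rightarrow> real^'k^'m" where
  "pdm i F x = (\<chi> r c. pd i (\<lambda>y. F y $ r $ c) x)"

definition diffm :: "(real^'n \<Rightarrow> real^'k^'m) \<Rightarrow> real^'n \<Rightarrow> bool" where
  "diffm F x \<longleftrightarrow> (\<forall>r c. (\<lambda>y. F y $ r $ c) differentiable (at x))"

lemma diffm_nth: "diffm F x \<Longrightarrow> (\<lambda>y. F y $ r $ c) differentiable (at x)"
  by (simp add: diffm_def)

lemma diffm_mult: "diffm F x \<Longrightarrow> diffm G x \<Longrightarrow> diffm (\<lambda>y. F y ** G y) x"
  by (auto simp: diffm_def matrix_matrix_mult_def intro!: derivative_intros)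

lemma diffm_add: "diffm F x \<Longrightarrow> diffm G x \<Longrightarrow> diffm (\<lambda>y. F y + G y) x"
  by (auto simp: diffm_def intro!: derivative_intros)

lemma pdm_mult:
  assumes "diffm F x" "diffm G x"
  shows "pdm i (\<lambda>y. F y ** G y) x = pdm i F x ** G x + F x ** pdm i G x"
  using assms unfolding pdm_def matrix_matrix_mult_def
  by (auto simp: vec_eq_iff diffm_def pd_sum pd_mult sum.distrib)

lemma pdm_add:
  assumes "diffm F x" "diffm G x"
  shows "pdm i (\<lambda>y. F y + G y) x = pdm i F x + pdm i G x"
  using assms unfolding pdm_def by (auto simp: vec_eq_iff diffm_def pd_add)

lemma pdm_cong_open:
  assumes "open S" "x \<in> S" "\<And>y. y \<in> S \<Longrightarrow> F y = G y"
  shows "pdm i F x = pdm i G x"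
  using assms(3) by (auto simp: pdm_def vec_eq_iff intro!: pd_cong_open[OF assms(1,2)])

lemma diffm_cong_open:
  assumes "open S" "x \<in> S" "\<And>y. y \<in> S \<Longrightarrow> F y = G y"
  shows "diffm F x \<longleftrightarrow> diffm G x"
proof -
  have "(\<lambda>y. F y $ r $ c) differentiable (at x) \<longleftrightarrow> (\<lambda>y. G y $ r $ c) differentiable (at x)" for r c
    using assms(3) by (intro frechet_derivative_cong_open(2)[OF assms(1,2)]) simp
  then show ?thesis
    by (simp add: diffm_def)
qed

lemma pd_compose_coord:
  assumes "(h has_real_derivative h') (at (x $ j))"
  shows "pd i (\<lambda>y. h (y $ j)) x = h' * axis i 1 $ j" and "(\<lambda>y. h (y $ j)) differentiable (at x)"
proof -
  have "((\<lambda>y. h (y $ j)) has_derivative (\<lambda>v. h' * v $ j)) (at x)"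
    using has_derivative_compose[of "\<lambda>y. y $ j" "\<lambda>v. v $ j" x UNIV h "(*) h'"] assms
    by (simp add: has_field_derivative_def bounded_linear_imp_has_derivative bounded_linear_vec_nth)
  then show "pd i (\<lambda>y. h (y $ j)) x = h' * axis i 1 $ j" "(\<lambda>y. h (y $ j)) differentiable (at x)"
    by (auto simp: pd_eqI differentiable_def)
qed

lemma pd_const_mult: "f differentiable (at x) \<Longrightarrow> pd i (\<lambda>y. z * f y) x = z * pd i f x"
  by (simp add: pd_mult)

lemma pd_coord: "pd i (\<lambda>y. y $ j) x = axis i 1 $ j"
  by (rule pd_eqI) (simp add: bounded_linear_imp_has_derivative bounded_linear_vec_nth)

lemma coord_differentiable [simp]: "(\<lambda>y. y $ j) differentiable (at x)"
  by (simp add: bounded_linear_imp_differentiable bounded_linear_vec_nth)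

lemma congruence_nth:
  fixes A B :: "real^'n^'m" and N :: "real^'m^'m"
  shows "(transpose A ** N ** B) $ i $ j = (\<Sum>\<alpha>\<in>UNIV. \<Sum>\<beta>\<in>UNIV. A $ \<alpha> $ i * B $ \<beta> $ j * N $ \<alpha> $ \<beta>)"
  by (subst sum.swap) (simp add: matrix_matrix_mult_def transpose_def sum_distrib_left mult_ac)

text \<open>Contracting the Nijenhuis tensor with the coframe leaves only the exterior derivatives
  \<open>f\<close> of the coframe; no derivative of the frame enters.\<close>

lemma nijenhuis_coframe:
  fixes \<Theta> J :: "real^'n \<Rightarrow> real^'n^'n" and J0 :: "real^'n^'n" and f :: "'n \<Rightarrow> real^'n^'n"
  assumes "open M" and x: "x \<in> M" and inv: "invertible (\<Theta> x)"
    and diff: "diffm \<Theta> x" "diffm J x"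
    and J: "\<And>y. y \<in> M \<Longrightarrow> \<Theta> y ** J y = J0 ** \<Theta> y" and J0: "J0 ** J0 = - mat 1"
    and f: "\<And>\<gamma> i j. pdm i \<Theta> x $ \<gamma> $ j - pdm j \<Theta> x $ \<gamma> $ i = (transpose (\<Theta> x) ** f \<gamma> ** \<Theta> x) $ i $ j"
    and integrable: "\<And>\<gamma>. (\<Sum>\<mu>\<in>UNIV. J0 $ \<gamma> $ \<mu> *\<^sub>R (transpose J0 ** f \<mu> + f \<mu> ** J0)) - transpose J0 ** f \<gamma> ** J0 + f \<gamma> = 0"
  shows "(\<Sum>l\<in>UNIV. J x $ l $ i * pd l (\<lambda>y. J y $ k $ j) x - J x $ l $ j * pd l (\<lambda>y. J y $ k $ i) x
        - J x $ k $ l * (pd i (\<lambda>y. J y $ l $ j) x - pd j (\<lambda>y. J y $ l $ i) x)) = 0"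
proof -
  let ?J = "J x" and ?\<Theta> = "\<Theta> x"
  define N where "N k i j = (\<Sum>l\<in>UNIV. ?J $ l $ i * pdm l J x $ k $ j - ?J $ l $ j * pdm l J x $ k $ i
        - ?J $ k $ l * (pdm i J x $ l $ j - pdm j J x $ l $ i))" for k i j
  \<comment> \<open>\<open>T \<gamma>\<close> holds the partial derivatives of row
    \<open>\<gamma>\<close> of the coframe, and \<open>S \<gamma>\<close> is the contracted tensor
    before antisymmetrisation in \<open>i\<close> and \<open>j\<close>. Of \<open>T\<close> only the
    skew part, the exterior derivative, will survive.\<close>
  define T where "T \<gamma> = (\<chi> i j. pdm i \<Theta> x $ \<gamma> $ j)" for \<gamma>
  define S where "S \<gamma> = (\<Sum>\<mu>\<in>UNIV. J0 $ \<gamma> $ \<mu> *\<^sub>R (transpose ?J ** T \<mu> + T \<mu> ** ?J)) - transpose ?J ** T \<gamma> ** ?J + T \<gamma>" for \<gamma>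
  \<comment> \<open>Obtained by differentiating \<open>\<Theta> J = J0 \<Theta>\<close>, where
    \<open>J0\<close> is constant.\<close>
  have dJ: "?\<Theta> ** pdm l J x = J0 ** pdm l \<Theta> x - pdm l \<Theta> x ** ?J" for l
  proof -
    have "pdm l (\<lambda>y. \<Theta> y ** J y) x = pdm l (\<lambda>y. J0 ** \<Theta> y) x"
      by (rule pdm_cong_open[OF assms(1) x J])
    moreover have "diffm (\<lambda>y. J0) x" "pdm l (\<lambda>y. J0) x = 0"
      by (auto simp: diffm_def pdm_def vec_eq_iff)
    ultimately show ?thesis
      using diff by (simp add: pdm_mult matrix_ring_simps algebra_simps bounded_bilinear.zero_left[OF bounded_bilinear_matrix_mult])
  qed
  have S: "(\<Sum>l\<in>UNIV. ?J $ l $ i * (?\<Theta> ** pdm l J x) $ \<gamma> $ j) - (J0 ** (?\<Theta> ** pdm i J x)) $ \<gamma> $ j = S \<gamma> $ i $ j" for \<gamma> i j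
  proof -
    have 1: "(\<Sum>l\<in>UNIV. ?J $ l $ i * (J0 ** pdm l \<Theta> x) $ \<gamma> $ j) = (\<Sum>\<mu>\<in>UNIV. J0 $ \<gamma> $ \<mu> * (transpose ?J ** T \<mu>) $ i $ j)"
      unfolding matrix_matrix_mult_def T_def transpose_def
      by (simp add: sum_distrib_left) (subst sum.swap, simp add: mult_ac)
    have 2: "(\<Sum>l\<in>UNIV. ?J $ l $ i * (pdm l \<Theta> x ** ?J) $ \<gamma> $ j) = (transpose ?J ** T \<gamma> ** ?J) $ i $ j"
      unfolding congruence_nth T_def by (simp add: matrix_matrix_mult_def sum_distrib_left mult_ac)
    \<comment> \<open>Since \<open>J0\<close> squares to -1, this term is the source of the isolated
      \<open>T \<gamma>\<close> in \<open>S \<gamma>\<close>.\<close>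
    have "J0 ** (J0 ** pdm i \<Theta> x - pdm i \<Theta> x ** ?J) = - pdm i \<Theta> x - J0 ** (pdm i \<Theta> x ** ?J)"
      by (simp add: matrix_ring_simps J0)
    then have 3: "(J0 ** (J0 ** pdm i \<Theta> x - pdm i \<Theta> x ** ?J)) $ \<gamma> $ j = - T \<gamma> $ i $ j - (\<Sum>\<mu>\<in>UNIV. J0 $ \<gamma> $ \<mu> * (T \<mu> ** ?J) $ i $ j)"
      by (simp add: T_def matrix_matrix_mult_def)
    show ?thesis
      unfolding dJ 3 by (simp add: 1 2 S_def algebra_simps sum_subtractf sum.distrib)
  qed
  have TT: "T \<mu> - transpose (T \<mu>) = transpose ?\<Theta> ** f \<mu> ** ?\<Theta>" for \<mu>
    unfolding vec_eq_iff using f by (simp add: T_def transpose_def)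
  have "(\<Sum>k\<in>UNIV. ?\<Theta> $ \<gamma> $ k * N k i j) = 0" for \<gamma> i j
  proof -
    have JJ: "(J0 ** (?\<Theta> ** A)) = ?\<Theta> ** (?J ** A)" for A :: "real^'n^'n"
      using J[OF x] by (simp add: matrix_mul_assoc)
    have "(\<Sum>k\<in>UNIV. ?\<Theta> $ \<gamma> $ k * N k i j)
      = ((\<Sum>l\<in>UNIV. ?J $ l $ i * (?\<Theta> ** pdm l J x) $ \<gamma> $ j) - (?\<Theta> ** (?J ** pdm i J x)) $ \<gamma> $ j)
      - ((\<Sum>l\<in>UNIV. ?J $ l $ j * (?\<Theta> ** pdm l J x) $ \<gamma> $ i) - (?\<Theta> ** (?J ** pdm j J x)) $ \<gamma> $ i)"
    proof -
      have "(\<Sum>l\<in>UNIV. ?J $ l $ i * (?\<Theta> ** pdm l J x) $ \<gamma> $ j) = (\<Sum>k\<in>UNIV. ?\<Theta> $ \<gamma> $ k * (\<Sum>l\<in>UNIV. ?J $ l $ i * pdm l J x $ k $ j))" for i j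
        unfolding matrix_matrix_mult_def by (simp add: sum_distrib_left) (subst sum.swap, simp add: mult_ac)
      moreover have "(?\<Theta> ** (?J ** pdm i J x)) $ \<gamma> $ j = (\<Sum>k\<in>UNIV. ?\<Theta> $ \<gamma> $ k * (\<Sum>l\<in>UNIV. ?J $ k $ l * pdm i J x $ l $ j))" for i j
        unfolding matrix_matrix_mult_def by simp
      ultimately show ?thesis
        by (simp add: N_def sum_subtractf sum.distrib right_diff_distrib)
    qed
    also have "\<dots> = (S \<gamma> - transpose (S \<gamma>)) $ i $ j"
      unfolding JJ[symmetric] S by (simp add: transpose_def)
    \<comment> \<open>Transposition acts on \<open>S \<gamma>\<close> by transposing each
      \<open>T\<close> alone: the two summands in the bracket trade places, and the congruence by
      \<open>J x\<close> keeps its shape.\<close>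
    also have "S \<gamma> - transpose (S \<gamma>) = (\<Sum>\<mu>\<in>UNIV. J0 $ \<gamma> $ \<mu> *\<^sub>R (transpose ?J ** (T \<mu> - transpose (T \<mu>)) + (T \<mu> - transpose (T \<mu>)) ** ?J))
       - transpose ?J ** (T \<gamma> - transpose (T \<gamma>)) ** ?J + (T \<gamma> - transpose (T \<gamma>))"
    proof -
      have tr: "transpose (A + B) = transpose A + transpose B" "transpose (A - B) = transpose A - transpose B"
        "transpose (z *\<^sub>R A) = z *\<^sub>R transpose A" "transpose (\<Sum>\<mu>\<in>UNIV. h \<mu>) = (\<Sum>\<mu>\<in>UNIV. transpose (h \<mu>))"
        for A B :: "real^'n^'n" and z :: real and h :: "'n \<Rightarrow> real^'n^'n"
        by (simp_all add: transpose_def vec_eq_iff)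
      show ?thesis
        unfolding S_def tr matrix_transpose_mul transpose_transpose
        by (simp add: matrix_ring_simps scaleR_add_right scaleR_diff_right sum.distrib sum_subtractf)
    qed
    also have "\<dots> = (\<Sum>\<mu>\<in>UNIV. J0 $ \<gamma> $ \<mu> *\<^sub>R (transpose ?J ** (transpose ?\<Theta> ** f \<mu> ** ?\<Theta>) + transpose ?\<Theta> ** f \<mu> ** ?\<Theta> ** ?J))
       - transpose ?J ** (transpose ?\<Theta> ** f \<gamma> ** ?\<Theta>) ** ?J + transpose ?\<Theta> ** f \<gamma> ** ?\<Theta>"
      unfolding TT ..
    also have "(\<Sum>\<mu>\<in>UNIV. J0 $ \<gamma> $ \<mu> *\<^sub>R (transpose ?J ** (transpose ?\<Theta> ** f \<mu> ** ?\<Theta>) + transpose ?\<Theta> ** f \<mu> ** ?\<Theta> ** ?J))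
       - transpose ?J ** (transpose ?\<Theta> ** f \<gamma> ** ?\<Theta>) ** ?J + transpose ?\<Theta> ** f \<gamma> ** ?\<Theta>
      = transpose ?\<Theta> ** ((\<Sum>\<mu>\<in>UNIV. J0 $ \<gamma> $ \<mu> *\<^sub>R (transpose J0 ** f \<mu> + f \<mu> ** J0)) - transpose J0 ** f \<gamma> ** J0 + f \<gamma>) ** ?\<Theta>"
    proof -
      \<comment> \<open>Carried across \<open>\<Theta> x\<close>, the structure \<open>J x\<close>
        becomes the constant \<open>J0\<close>; what remains is a congruence of the matrix that
        \<open>integrable\<close> declares to be 0.\<close>
      have tJ: "transpose ?J ** transpose ?\<Theta> = transpose ?\<Theta> ** transpose J0"
        using J[OF x] by (metis matrix_transpose_mul)
      have J1: "A ** ?\<Theta> ** ?J = A ** J0 ** ?\<Theta>" for A :: "real^'n^'n"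
        using J[OF x] by (metis matrix_mul_assoc)
      have sum: "transpose ?\<Theta> ** (\<Sum>\<mu>\<in>UNIV. h \<mu>) ** ?\<Theta> = (\<Sum>\<mu>\<in>UNIV. transpose ?\<Theta> ** h \<mu> ** ?\<Theta>)" for h :: "'n \<Rightarrow> real^'n^'n"
        by (simp add: bounded_bilinear.sum_left[OF bounded_bilinear_matrix_mult] bounded_bilinear.sum_right[OF bounded_bilinear_matrix_mult])
      have sc: "transpose ?\<Theta> ** (z *\<^sub>R A) ** ?\<Theta> = z *\<^sub>R (transpose ?\<Theta> ** A ** ?\<Theta>)" for z and A :: "real^'n^'n"
        by (simp add: bounded_bilinear.scaleR_left[OF bounded_bilinear_matrix_mult] bounded_bilinear.scaleR_right[OF bounded_bilinear_matrix_mult])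
      show ?thesis
        by (simp add: matrix_ring_simps(1-6) sum sc) (simp add: matrix_mul_assoc tJ J1)
    qed
    also have "\<dots> = 0"
      unfolding integrable by (simp add: matrix_matrix_mult_def vec_eq_iff)
    finally show ?thesis by simp
  qed
  then have "?\<Theta> *v (\<chi> k. N k i j) = 0" for i j
    by (simp add: vec_eq_iff matrix_vector_mult_def)
  then have "(\<chi> k. N k i j) = 0" for i j
    using inv by (metis invertible_left_inverse matrix_left_invertible_ker)
  then have "N k i j = 0"
    by (metis vec_lambda_beta zero_index)
  then show ?thesis
    by (simp add: N_def pdm_def)
qed

definition diag :: "('n \<Rightarrow> real) \<Rightarrow> real^'n^'n" where
  "diag \<eta> = (\<chi> i j. if i = j then \<eta> i else 0)"

lemma diag_mult_left: "(diag \<eta> ** A) $ i $ j = \<eta> i * A $ i $ j"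
  by (simp add: diag_def matrix_matrix_mult_def if_distrib[where f = "\<lambda>x. x * _"] cong: if_cong)

lemma diag_mult_right: "(A ** diag \<eta>) $ i $ j = A $ i $ j * \<eta> j"
  by (simp add: diag_def matrix_matrix_mult_def if_distrib[where f = "\<lambda>x. _ * x"] cong: if_cong)

lemma transpose_diag [simp]: "transpose (diag \<eta>) = diag \<eta>"
  by (auto simp: diag_def transpose_def vec_eq_iff)

lemma matrix_inv_diag:
  fixes \<eta> :: "'n::finite \<Rightarrow> real"
  assumes "\<And>i. \<eta> i \<noteq> 0"
  shows "matrix_inv (diag \<eta>) = diag (\<lambda>i. 1 / \<eta> i)" "invertible (diag \<eta>)"
proof -
  have *: "diag \<eta> ** diag (\<lambda>i. 1 / \<eta> i) = mat 1"
    using assms by (simp add: vec_eq_iff diag_mult_left) (auto simp: diag_def mat_def)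
  show "matrix_inv (diag \<eta>) = diag (\<lambda>i. 1 / \<eta> i)"
    by (rule matrix_inv_unique[OF *])
  show "invertible (diag \<eta>)"
    using * invertible_right_inverse by blast
qed

section \<open>Orthonormal coframes\<close>

text \<open>Cartan's method in coordinates. Rows of \<open>\<Theta>\<close> are the coframe, columns
  of \<open>E\<close> the dual frame, and \<open>\<Omega> i\<close> is the value of the matrix of
  connection forms on the \<open>i\<close>-th coordinate field. \<open>skew\<close> says that the
  connection is metric and \<open>torsion_free\<close> is the first structure equation; together
  they characterise the Levi-Civita connection.\<close>

locale orthonormal_coframe =
  fixes M :: "(real^'n) set" and g \<Theta> E :: "real^'n \<Rightarrow> real^'n^'n"
    and \<eta> :: "'n \<Rightarrow> real" and \<Omega> :: "'n \<Rightarrow> real^'n \<Rightarrow> real^'n^'n"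
  assumes open_M: "open M"
    and \<eta>_nonzero: "\<eta> \<alpha> \<noteq> 0"
    and inverse: "x \<in> M \<Longrightarrow> \<Theta> x ** E x = mat 1"
    and metric: "x \<in> M \<Longrightarrow> g x = transpose (\<Theta> x) ** diag \<eta> ** \<Theta> x"
    and diff_\<Theta>: "x \<in> M \<Longrightarrow> diffm \<Theta> x"
    and diff_E: "x \<in> M \<Longrightarrow> diffm E x"
    and diff_\<Omega>: "x \<in> M \<Longrightarrow> diffm (\<Omega> i) x"
    and diff_d\<Theta>: "x \<in> M \<Longrightarrow> diffm (pdm i \<Theta>) x"
    and d\<Theta>_commute: "x \<in> M \<Longrightarrow> pdm i (pdm j \<Theta>) x = pdm j (pdm i \<Theta>) x"
    and skew: "x \<in> M \<Longrightarrow> \<eta> \<alpha> * \<Omega> i x $ \<alpha> $ \<beta> + \<eta> \<beta> * \<Omega> i x $ \<beta> $ \<alpha> = 0"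
    and torsion_free: "x \<in> M \<Longrightarrow> (pdm i \<Theta> x + \<Omega> i x ** \<Theta> x) $ \<alpha> $ j = (pdm j \<Theta> x + \<Omega> j x ** \<Theta> x) $ \<alpha> $ i"
begin

lemma inverse': "x \<in> M \<Longrightarrow> E x ** \<Theta> x = mat 1"
  using inverse matrix_left_right_inverse by blast

lemma metric_nth: "x \<in> M \<Longrightarrow> g x $ i $ j = (\<Sum>\<alpha>\<in>UNIV. \<eta> \<alpha> * \<Theta> x $ \<alpha> $ i * \<Theta> x $ \<alpha> $ j)"
  unfolding metric by (subst matrix_matrix_mult_def) (simp add: diag_mult_right transpose_def mult_ac)

text \<open>Skewness lets the \<open>\<Omega>\<close> terms be added at no cost, so that the
  combination \<open>pdm i \<Theta> x + \<Omega> i x ** \<Theta> x\<close> of the torsion condition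
  replaces the bare derivative.\<close>

lemma pd_metric:
  assumes "x \<in> M"
  shows "pd i (\<lambda>y. g y $ j $ m) x =
    (\<Sum>\<alpha>\<in>UNIV. \<eta> \<alpha> * ((pdm i \<Theta> x + \<Omega> i x ** \<Theta> x) $ \<alpha> $ j * \<Theta> x $ \<alpha> $ m
                       + (pdm i \<Theta> x + \<Omega> i x ** \<Theta> x) $ \<alpha> $ m * \<Theta> x $ \<alpha> $ j))"
proof -
  note [simp] = diffm_nth[OF diff_\<Theta>[OF assms]]
  have "pd i (\<lambda>y. g y $ j $ m) x = pd i (\<lambda>y. \<Sum>\<alpha>\<in>UNIV. \<eta> \<alpha> * (\<Theta> y $ \<alpha> $ j * \<Theta> y $ \<alpha> $ m)) x"
    by (rule pd_cong_open[OF open_M assms]) (simp add: metric_nth mult_ac)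
  also have "\<dots> = (\<Sum>\<alpha>\<in>UNIV. \<eta> \<alpha> * (pdm i \<Theta> x $ \<alpha> $ j * \<Theta> x $ \<alpha> $ m + pdm i \<Theta> x $ \<alpha> $ m * \<Theta> x $ \<alpha> $ j))"
    by (subst pd_sum) (auto simp: pd_mult pdm_def algebra_simps intro!: derivative_intros)
  finally have 1: "pd i (\<lambda>y. g y $ j $ m) x = \<dots>" .
  have "(\<Sum>\<alpha>\<in>UNIV. \<eta> \<alpha> * ((\<Omega> i x ** \<Theta> x) $ \<alpha> $ j * \<Theta> x $ \<alpha> $ m + (\<Omega> i x ** \<Theta> x) $ \<alpha> $ m * \<Theta> x $ \<alpha> $ j))
      = (\<Sum>\<alpha>\<in>UNIV. \<Sum>\<beta>\<in>UNIV. \<eta> \<alpha> * \<Omega> i x $ \<alpha> $ \<beta> * \<Theta> x $ \<beta> $ j * \<Theta> x $ \<alpha> $ m)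
      + (\<Sum>\<alpha>\<in>UNIV. \<Sum>\<beta>\<in>UNIV. \<eta> \<alpha> * \<Omega> i x $ \<alpha> $ \<beta> * \<Theta> x $ \<beta> $ m * \<Theta> x $ \<alpha> $ j)"
    by (simp add: matrix_matrix_mult_def sum_distrib_left sum_distrib_right sum.distrib algebra_simps)
  also have "(\<Sum>\<alpha>\<in>UNIV. \<Sum>\<beta>\<in>UNIV. \<eta> \<alpha> * \<Omega> i x $ \<alpha> $ \<beta> * \<Theta> x $ \<beta> $ m * \<Theta> x $ \<alpha> $ j)
      = (\<Sum>\<alpha>\<in>UNIV. \<Sum>\<beta>\<in>UNIV. \<eta> \<beta> * \<Omega> i x $ \<beta> $ \<alpha> * \<Theta> x $ \<alpha> $ m * \<Theta> x $ \<beta> $ j)"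
    by (rule sum.swap)
  also have "(\<Sum>\<alpha>\<in>UNIV. \<Sum>\<beta>\<in>UNIV. \<eta> \<alpha> * \<Omega> i x $ \<alpha> $ \<beta> * \<Theta> x $ \<beta> $ j * \<Theta> x $ \<alpha> $ m) + \<dots>
      = (\<Sum>\<alpha>\<in>UNIV. \<Sum>\<beta>\<in>UNIV. (\<eta> \<alpha> * \<Omega> i x $ \<alpha> $ \<beta> + \<eta> \<beta> * \<Omega> i x $ \<beta> $ \<alpha>) * (\<Theta> x $ \<beta> $ j * \<Theta> x $ \<alpha> $ m))"
    by (simp add: sum.distrib[symmetric] algebra_simps)
  also have "\<dots> = 0"
    by (simp add: skew[OF assms])
  finally show ?thesis
    unfolding 1 by (simp add: sum.distrib algebra_simps)
qed

definition christoffel_matrix :: "'n \<Rightarrow> real^'n \<Rightarrow> real^'n^'n" where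
  "christoffel_matrix i x = (\<chi> l j. christoffel g x l i j)"

text \<open>This is the Koszul formula: by the symmetry in \<open>torsion_free\<close>, four of the
  six terms in the sum of metric derivatives cancel and the other two agree.\<close>

lemma christoffel_matrix:
  assumes "x \<in> M"
  shows "christoffel_matrix i x = E x ** (pdm i \<Theta> x + \<Omega> i x ** \<Theta> x)"
proof -
  let ?P = "\<lambda>i. pdm i \<Theta> x + \<Omega> i x ** \<Theta> x"
  have inv: "matrix_inv (g x) = E x ** diag (\<lambda>i. 1 / \<eta> i) ** transpose (E x)"
    unfolding metric[OF assms] using matrix_inv_congruence[OF inverse[OF assms]] matrix_inv_diag[of \<eta>] \<eta>_nonzero
    by metis
  have lower: "(pd i (\<lambda>y. g y $ j $ m) x + pd j (\<lambda>y. g y $ i $ m) x - pd m (\<lambda>y. g y $ i $ j) x) / 2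
      = (transpose (\<Theta> x) ** diag \<eta> ** ?P i) $ m $ j" for m j
  proof -
    have "pd i (\<lambda>y. g y $ j $ m) x + pd j (\<lambda>y. g y $ i $ m) x - pd m (\<lambda>y. g y $ i $ j) x
       = (\<Sum>\<alpha>\<in>UNIV. 2 * (\<eta> \<alpha> * \<Theta> x $ \<alpha> $ m * ?P i $ \<alpha> $ j))"
      unfolding pd_metric[OF assms] torsion_free[OF assms, of j _ i] torsion_free[OF assms, of m]
      by (simp add: sum.distrib[symmetric] sum_subtractf[symmetric] algebra_simps del: vector_add_component)
    also have "\<dots> = 2 * (transpose (\<Theta> x) ** diag \<eta> ** ?P i) $ m $ j"
      by (subst matrix_matrix_mult_def)
        (simp add: diag_mult_right transpose_def sum_distrib_left mult_ac del: vector_add_component)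
    finally show ?thesis by simp
  qed
  have "christoffel_matrix i x = matrix_inv (g x) ** (transpose (\<Theta> x) ** diag \<eta> ** ?P i)"
    unfolding matrix_matrix_mult_def[of "matrix_inv (g x)"] lower[symmetric]
    by (simp add: christoffel_matrix_def christoffel_def sum_divide_distrib vec_eq_iff)
  also have "transpose (E x) ** transpose (\<Theta> x) = mat 1"
    using inverse[OF assms] by (metis matrix_transpose_mul transpose_mat)
  then have "A ** transpose (E x) ** transpose (\<Theta> x) = A" for A :: "real^'n^'n"
    by (metis matrix_mul_assoc matrix_mul_rid)
  then have "matrix_inv (g x) ** (transpose (\<Theta> x) ** diag \<eta> ** ?P i)
      = E x ** (diag (\<lambda>i. 1 / \<eta> i) ** diag \<eta>) ** ?P i"
    unfolding inv by (simp add: matrix_mul_assoc)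
  also have "diag (\<lambda>i. 1 / \<eta> i) ** diag \<eta> = mat 1"
    using \<eta>_nonzero by (simp add: vec_eq_iff diag_mult_left) (auto simp: diag_def mat_def)
  finally show ?thesis by simp
qed

text \<open>The second structure equation: d\<Omega> + \<Omega> \<and> \<Omega> evaluated on a pair
  of coordinate fields.\<close>

definition curvature_form :: "'n \<Rightarrow> 'n \<Rightarrow> real^'n \<Rightarrow> real^'n^'n" where
  "curvature_form i j x = pdm i (\<Omega> j) x - pdm j (\<Omega> i) x + \<Omega> i x ** \<Omega> j x - \<Omega> j x ** \<Omega> i x"

text \<open>The Christoffel matrices are the gauge transform of \<open>\<Omega>\<close> by the
  coframe, so the curvature is merely conjugated. The derivatives of \<open>\<Theta>\<close> drop
  out, the second ones because they commute.\<close>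

lemma riemann_frame:
  assumes "x \<in> M"
  shows "(\<chi> l k. riemann g x l i j k) = E x ** curvature_form i j x ** \<Theta> x"
proof -
  let ?\<Gamma> = "christoffel_matrix"
  have \<Theta>\<Gamma>: "\<Theta> y ** ?\<Gamma> i y = pdm i \<Theta> y + \<Omega> i y ** \<Theta> y" if "y \<in> M" for i y
    unfolding christoffel_matrix[OF that] using inverse[OF that] by (metis matrix_mul_assoc matrix_mul_lid)
  have diff_\<Gamma>: "diffm (?\<Gamma> i) x" for i
    using assms diffm_cong_open[OF open_M assms, of "christoffel_matrix i", OF christoffel_matrix]
    by (auto intro!: diffm_mult diffm_add diff_E diff_d\<Theta> diff_\<Theta> diff_\<Omega>)
  have d\<Gamma>: "\<Theta> x ** pdm i (?\<Gamma> j) x = pdm i (pdm j \<Theta>) x + pdm i (\<Omega> j) x ** \<Theta> x + \<Omega> j x ** pdm i \<Theta> x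
      - pdm i \<Theta> x ** ?\<Gamma> j x" for i j
  proof -
    have "pdm i \<Theta> x ** ?\<Gamma> j x + \<Theta> x ** pdm i (?\<Gamma> j) x = pdm i (\<lambda>y. \<Theta> y ** ?\<Gamma> j y) x"
      using assms diff_\<Gamma> by (simp add: pdm_mult diff_\<Theta>)
    also have "\<dots> = pdm i (\<lambda>y. pdm j \<Theta> y + \<Omega> j y ** \<Theta> y) x"
      by (rule pdm_cong_open[OF open_M assms \<Theta>\<Gamma>])
    also have "\<dots> = pdm i (pdm j \<Theta>) x + (pdm i (\<Omega> j) x ** \<Theta> x + \<Omega> j x ** pdm i \<Theta> x)"
      using assms by (simp add: pdm_add pdm_mult diff_\<Theta> diff_\<Omega> diff_d\<Theta> diffm_mult)
    finally show ?thesis by (simp add: algebra_simps)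
  qed
  have "(\<chi> l k. riemann g x l i j k) = pdm i (?\<Gamma> j) x - pdm j (?\<Gamma> i) x + ?\<Gamma> i x ** ?\<Gamma> j x - ?\<Gamma> j x ** ?\<Gamma> i x"
    by (simp add: vec_eq_iff riemann_def pdm_def christoffel_matrix_def matrix_matrix_mult_def sum_subtractf)
  then have "\<Theta> x ** (\<chi> l k. riemann g x l i j k) = \<Theta> x ** pdm i (?\<Gamma> j) x - \<Theta> x ** pdm j (?\<Gamma> i) x
      + (\<Theta> x ** ?\<Gamma> i x) ** ?\<Gamma> j x - (\<Theta> x ** ?\<Gamma> j x) ** ?\<Gamma> i x"
    by (simp add: matrix_ring_simps)
  also have "\<dots> = pdm i (\<Omega> j) x ** \<Theta> x - pdm j (\<Omega> i) x ** \<Theta> x + \<Omega> j x ** pdm i \<Theta> x - \<Omega> i x ** pdm j \<Theta> x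
      + \<Omega> i x ** (\<Theta> x ** ?\<Gamma> j x) - \<Omega> j x ** (\<Theta> x ** ?\<Gamma> i x)"
    unfolding d\<Gamma> by (simp add: \<Theta>\<Gamma>[OF assms] d\<Theta>_commute[OF assms, of i j] matrix_ring_simps) (simp add: \<Theta>\<Gamma>[OF assms] matrix_ring_simps flip: matrix_mul_assoc)
  also have "\<dots> = curvature_form i j x ** \<Theta> x"
    unfolding \<Theta>\<Gamma>[OF assms] curvature_form_def by (simp add: matrix_ring_simps)
  finally show ?thesis
    using inverse'[OF assms] by (metis matrix_mul_assoc matrix_mul_lid)
qed

end

section \<open>Two-forms in dimension four\<close>

lemma vector_4 [simp]:
  "(vector [w, x, y, z] :: 'a::zero^4) $ 1 = w"
  "(vector [w, x, y, z] :: 'a::zero^4) $ 2 = x"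
  "(vector [w, x, y, z] :: 'a::zero^4) $ 3 = y"
  "(vector [w, x, y, z] :: 'a::zero^4) $ 4 = z"
  by (simp_all add: vector_def)

lemma det_4:
  "det (A::'a::comm_ring_1^4^4) =
    A$1$1 * (A$2$2 * (A$3$3 * A$4$4 - A$3$4 * A$4$3) - A$2$3 * (A$3$2 * A$4$4 - A$3$4 * A$4$2) + A$2$4 * (A$3$2 * A$4$3 - A$3$3 * A$4$2))
  - A$1$2 * (A$2$1 * (A$3$3 * A$4$4 - A$3$4 * A$4$3) - A$2$3 * (A$3$1 * A$4$4 - A$3$4 * A$4$1) + A$2$4 * (A$3$1 * A$4$3 - A$3$3 * A$4$1))
  + A$1$3 * (A$2$1 * (A$3$2 * A$4$4 - A$3$4 * A$4$2) - A$2$2 * (A$3$1 * A$4$4 - A$3$4 * A$4$1) + A$2$4 * (A$3$1 * A$4$2 - A$3$2 * A$4$1))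
  - A$1$4 * (A$2$1 * (A$3$2 * A$4$3 - A$3$3 * A$4$2) - A$2$2 * (A$3$1 * A$4$3 - A$3$3 * A$4$1) + A$2$3 * (A$3$1 * A$4$2 - A$3$2 * A$4$1))"
proof -
  have f1234: "finite {2::4, 3, 4}" "1 \<notin> {2::4, 3, 4}"
    by auto
  have f234: "finite {3::4, 4}" "2 \<notin> {3::4, 4}"
    by auto
  have f34: "finite {4::4}" "3 \<notin> {4::4}"
    by auto
  show ?thesis
    unfolding det_def UNIV_4
    unfolding sum_over_permutations_insert[OF f1234]
    unfolding sum_over_permutations_insert[OF f234]
    unfolding sum_over_permutations_insert[OF f34]
    unfolding permutes_sing
    by (simp add: sign_swap_id permutation_swap_id permutation_compose sign_compose sign_id swap_id_eq algebra_simps)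
qed

lemma det_expand_first_rows:
  fixes u v w z :: "real^4"
  shows "det (vector [u, v, w, z] :: real^4^4)
    = (\<Sum>k\<in>UNIV. \<Sum>l\<in>UNIV. u $ k * v $ l * det (vector [axis k 1, axis l 1, w, z] :: real^4^4))"
  by (simp add: det_4 sum_4 axis_def algebra_simps)

lemma det_expand_last_rows:
  fixes u v w z :: "real^4"
  shows "det (vector [u, v, w, z] :: real^4^4)
    = (\<Sum>k\<in>UNIV. \<Sum>l\<in>UNIV. w $ k * z $ l * det (vector [u, v, axis k 1, axis l 1] :: real^4^4))"
  by (simp add: det_4 sum_4 axis_def algebra_simps)

lemma matrix_vector_nth: "(A *v x) $ i = (\<Sum>j\<in>UNIV. A $ i $ j * x $ j)"
  by (simp add: matrix_vector_mult_def)

lemma matrix_vector_axis: "(A :: real^'n^'m) *v axis j 1 = column j A"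
  by (simp add: matrix_vector_mult_basis)

lemma det_vector_mult:
  fixes A :: "real^4^4"
  shows "det (vector [A *v u, A *v v, A *v w, A *v z] :: real^4^4) = det A * det (vector [u, v, w, z] :: real^4^4)"
proof -
  have "(vector [A *v u, A *v v, A *v w, A *v z] :: real^4^4) = vector [u, v, w, z] ** transpose A"
    by (simp add: vec_eq_iff forall_4 matrix_vector_nth matrix_matrix_mult_def transpose_def mult.commute)
  then show ?thesis
    by (simp add: det_mul det_transpose)
qed

text \<open>The rows \<open>axis i 1\<close> and \<open>axis j 1\<close> are written as
  \<open>E\<close> applied to columns of \<open>T\<close>; then all four rows carry
  \<open>E\<close>, the factor \<open>det E\<close> comes out, and multilinearity expands the
  rest.\<close>

lemma levi_civita_congruence:
  fixes T E :: "real^4^4"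
  assumes "T ** E = mat 1"
  shows "(\<Sum>k\<in>UNIV. \<Sum>l\<in>UNIV. E $ k $ \<alpha> * E $ l $ \<beta> * levi_civita k l i j)
    = det E * (\<Sum>\<gamma>\<in>UNIV. \<Sum>\<delta>\<in>UNIV. T $ \<gamma> $ i * T $ \<delta> $ j * levi_civita \<alpha> \<beta> \<gamma> \<delta>)"
proof -
  have "E ** T = mat 1"
    using assms matrix_left_right_inverse by blast
  then have ET: "E *v column i T = axis i 1" for i
    by (metis matrix_vector_axis matrix_vector_mul_assoc matrix_vector_mul_lid)
  have "(\<Sum>k\<in>UNIV. \<Sum>l\<in>UNIV. E $ k $ \<alpha> * E $ l $ \<beta> * levi_civita k l i j)
      = det (vector [column \<alpha> E, column \<beta> E, axis i 1, axis j 1] :: real^4^4)"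
    unfolding levi_civita_def by (subst det_expand_first_rows) (simp add: column_def)
  also have "\<dots> = det E * det (vector [axis \<alpha> 1, axis \<beta> 1, column i T, column j T] :: real^4^4)"
    by (simp add: ET matrix_vector_axis flip: det_vector_mult)
  also have "det (vector [axis \<alpha> 1, axis \<beta> 1, column i T, column j T] :: real^4^4)
      = (\<Sum>\<gamma>\<in>UNIV. \<Sum>\<delta>\<in>UNIV. T $ \<gamma> $ i * T $ \<delta> $ j * levi_civita \<alpha> \<beta> \<gamma> \<delta>)"
    unfolding levi_civita_def by (subst det_expand_last_rows) (simp add: column_def)
  finally show ?thesis .
qed

lemma sum_swap_pairs:
  "(\<Sum>a\<in>A. \<Sum>b\<in>B. \<Sum>c\<in>C. \<Sum>d\<in>D. f a b c d) = (\<Sum>c\<in>C. \<Sum>d\<in>D. \<Sum>a\<in>A. \<Sum>b\<in>B. f a b c d)"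
proof -
  have "(\<Sum>a\<in>A. \<Sum>b\<in>B. \<Sum>c\<in>C. \<Sum>d\<in>D. f a b c d) = (\<Sum>a\<in>A. \<Sum>c\<in>C. \<Sum>b\<in>B. \<Sum>d\<in>D. f a b c d)"
    by (intro sum.cong refl sum.swap)
  also have "\<dots> = (\<Sum>c\<in>C. \<Sum>a\<in>A. \<Sum>d\<in>D. \<Sum>b\<in>B. f a b c d)"
    by (subst sum.swap) (intro sum.cong refl sum.swap)
  also have "\<dots> = (\<Sum>c\<in>C. \<Sum>d\<in>D. \<Sum>a\<in>A. \<Sum>b\<in>B. f a b c d)"
    by (intro sum.cong refl sum.swap)
  finally show ?thesis .
qed

text \<open>The volume factor contributes the absolute value of \<open>det T\<close> and the
  permutation symbol contributes \<open>det E\<close>, the inverse of \<open>det T\<close>. Only a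
  sign remains: the dependence of the star on the orientation.\<close>

lemma hodge_congruence:
  fixes T E G w :: "real^4^4"
  assumes "T ** E = mat 1" "invertible G"
  shows "hodge \<sigma> (transpose T ** G ** T) (transpose T ** w ** T)
    = sgn (det T) *\<^sub>R (transpose T ** hodge \<sigma> G w ** T)"
proof -
  let ?N = "raise_indices G w"
  have "det T * det E = 1"
    using assms(1) by (metis det_I det_mul)
  then have detE: "\<bar>det T\<bar> * det E = sgn (det T)"
    by (metis abs_sgn mult.commute mult.left_commute mult.right_neutral)
  have det: "sqrt \<bar>det (transpose T ** G ** T)\<bar> = \<bar>det T\<bar> * sqrt \<bar>det G\<bar>"
    by (simp add: det_mul det_transpose abs_mult real_sqrt_mult)
  have "(\<Sum>k\<in>UNIV. \<Sum>l\<in>UNIV. levi_civita k l i j * (E ** ?N ** transpose E) $ k $ l)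
      = det E * (\<Sum>\<gamma>\<in>UNIV. \<Sum>\<delta>\<in>UNIV. T $ \<gamma> $ i * T $ \<delta> $ j * (\<Sum>\<alpha>\<in>UNIV. \<Sum>\<beta>\<in>UNIV. levi_civita \<alpha> \<beta> \<gamma> \<delta> * ?N $ \<alpha> $ \<beta>))"
    (is "?L = ?R") for i j
  proof -
    have "?L = (\<Sum>k\<in>UNIV. \<Sum>l\<in>UNIV. \<Sum>\<alpha>\<in>UNIV. \<Sum>\<beta>\<in>UNIV. ?N $ \<alpha> $ \<beta> * (E $ k $ \<alpha> * E $ l $ \<beta> * levi_civita k l i j))"
      using congruence_nth[of "transpose E" ?N "transpose E"]
      by (simp add: sum_distrib_left mult_ac) (simp add: transpose_def)
    also have "\<dots> = (\<Sum>\<alpha>\<in>UNIV. \<Sum>\<beta>\<in>UNIV. \<Sum>k\<in>UNIV. \<Sum>l\<in>UNIV. ?N $ \<alpha> $ \<beta> * (E $ k $ \<alpha> * E $ l $ \<beta> * levi_civita k l i j))"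
      by (rule sum_swap_pairs)
    also have "\<dots> = (\<Sum>\<alpha>\<in>UNIV. \<Sum>\<beta>\<in>UNIV. ?N $ \<alpha> $ \<beta> * (det E * (\<Sum>\<gamma>\<in>UNIV. \<Sum>\<delta>\<in>UNIV. T $ \<gamma> $ i * T $ \<delta> $ j * levi_civita \<alpha> \<beta> \<gamma> \<delta>)))"
      by (simp only: sum_distrib_left[symmetric] levi_civita_congruence[OF assms(1)])
    also have "\<dots> = (\<Sum>\<alpha>\<in>UNIV. \<Sum>\<beta>\<in>UNIV. \<Sum>\<gamma>\<in>UNIV. \<Sum>\<delta>\<in>UNIV. det E * (T $ \<gamma> $ i * T $ \<delta> $ j * (levi_civita \<alpha> \<beta> \<gamma> \<delta> * ?N $ \<alpha> $ \<beta>)))"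
      by (simp add: sum_distrib_left mult_ac)
    also have "\<dots> = (\<Sum>\<gamma>\<in>UNIV. \<Sum>\<delta>\<in>UNIV. \<Sum>\<alpha>\<in>UNIV. \<Sum>\<beta>\<in>UNIV. det E * (T $ \<gamma> $ i * T $ \<delta> $ j * (levi_civita \<alpha> \<beta> \<gamma> \<delta> * ?N $ \<alpha> $ \<beta>)))"
      by (rule sum_swap_pairs)
    also have "\<dots> = ?R"
      by (simp only: sum_distrib_left)
    finally show ?thesis .
  qed
  then show ?thesis
    unfolding hodge_def[of \<sigma> "transpose T ** G ** T"] raise_indices_congruence[OF assms] det
    by (simp add: vec_eq_iff congruence_nth hodge_def detE[symmetric] sum_distrib_left mult_ac)
qed

section \<open>Two-forms in the model frame\<close>

definition skew4 :: "real \<Rightarrow> real \<Rightarrow> real \<Rightarrow> real \<Rightarrow> real \<Rightarrow> real \<Rightarrow> real^4^4" where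
  "skew4 p q r s t u = vector [vector [0, p, q, r], vector [- p, 0, s, t], vector [- q, - s, 0, u], vector [- r, - t, - u, 0]]"

lemma skew4_nth [simp]:
  "skew4 p q r s t u $ 1 = vector [0, p, q, r]"
  "skew4 p q r s t u $ 2 = vector [- p, 0, s, t]"
  "skew4 p q r s t u $ 3 = vector [- q, - s, 0, u]"
  "skew4 p q r s t u $ 4 = vector [- r, - t, - u, 0]"
  by (simp_all add: skew4_def)

lemma two_form_iff: "two_form \<omega> \<longleftrightarrow> (\<forall>i j. \<omega> $ j $ i = - \<omega> $ i $ j)"
  by (auto simp: two_form_def transpose_def vec_eq_iff)

lemma two_form_skew4:
  assumes "two_form \<omega>"
  shows "\<omega> = skew4 (\<omega>$1$2) (\<omega>$1$3) (\<omega>$1$4) (\<omega>$2$3) (\<omega>$2$4) (\<omega>$3$4)"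
proof -
  have *: "\<omega> $ j $ i = - \<omega> $ i $ j" for i j
    using assms unfolding two_form_iff by blast
  have "\<omega> $ i $ i = 0" for i
    using *[of i i] by simp
  then show ?thesis
    by (simp add: vec_eq_iff forall_4) (simp add: *[of 2 1] *[of 3 1] *[of 4 1] *[of 3 2] *[of 4 2] *[of 4 3])
qed

lemma two_form_skew4' [simp]: "two_form (skew4 p q r s t u)"
  by (simp add: two_form_iff forall_4)

text \<open>Squared lengths of the frame vectors in the order \<open>\<partial>\<^sub>t\<close>,
  \<open>e\<^sub>1\<close>, \<open>e\<^sub>2\<close>, \<open>e\<^sub>3\<close>: positive for
  \<epsilon> = 1, neutral for \<epsilon> = -1.\<close>

definition eta :: "real \<Rightarrow> 4 \<Rightarrow> real" where
  "eta \<epsilon> i = vector [\<epsilon>, \<epsilon>, 1, 1] $ i"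

lemma eta_nth [simp]: "eta \<epsilon> 1 = \<epsilon>" "eta \<epsilon> 2 = \<epsilon>" "eta \<epsilon> 3 = 1" "eta \<epsilon> 4 = 1"
  by (simp_all add: eta_def)

lemma eta_nonzero: "\<epsilon> * \<epsilon> = 1 \<Longrightarrow> eta \<epsilon> i \<noteq> 0"
  using exhaust_4[of i] by auto

lemma raise_indices_eta:
  assumes "\<epsilon> * \<epsilon> = 1"
  shows "raise_indices (diag (eta \<epsilon>)) w = diag (eta \<epsilon>) ** w ** diag (eta \<epsilon>)"
proof -
  have "1 / eta \<epsilon> i = eta \<epsilon> i" for i
    using exhaust_4[of i] assms by (auto simp: divide_simps)
  then show ?thesis
    using assms by (simp add: raise_indices_def matrix_inv_diag eta_nonzero)
qed

lemma hodge_eta: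
  assumes "\<epsilon> * \<epsilon> = 1"
  shows "hodge \<sigma> (diag (eta \<epsilon>)) (skew4 p q r s t u)
    = skew4 (\<sigma> * u) (- \<sigma> * \<epsilon> * t) (\<sigma> * \<epsilon> * s) (\<sigma> * \<epsilon> * r) (- \<sigma> * \<epsilon> * q) (\<sigma> * p)"
proof -
  have [simp]: "\<epsilon> * (\<epsilon> * x) = x" for x
    using assms by (metis mult.assoc mult_1)
  have "det (diag (eta \<epsilon>)) = 1"
    using assms by (simp add: det_4 diag_def)
  then show ?thesis
    by (simp add: vec_eq_iff forall_4 hodge_def raise_indices_eta[OF assms] diag_mult_left diag_mult_right
        sum_4 levi_civita_def det_4 axis_def assms)
qed

lemma skew4_eq_iff: "skew4 p q r s t w = skew4 p' q' r' s' t' w' \<longleftrightarrow> p = p' \<and> q = q' \<and> r = r' \<and> s = s' \<and> t = t' \<and> w = w'"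
  by (auto simp: vec_eq_iff forall_4)

lemma skew4_scaleR: "z *\<^sub>R skew4 p q r s t w = skew4 (z * p) (z * q) (z * r) (z * s) (z * t) (z * w)"
  by (simp add: vec_eq_iff forall_4)

lemma skew4_add: "skew4 p q r s t w + skew4 p' q' r' s' t' w' = skew4 (p + p') (q + q') (r + r') (s + s') (t + t') (w + w')"
  by (simp add: vec_eq_iff forall_4)

section \<open>Left-invariant frames of the Heisenberg group\<close>

lemma vec3_eqI: "x $ 1 = y $ 1 \<Longrightarrow> x $ 2 = y $ 2 \<Longrightarrow> x $ 3 = y $ 3 \<Longrightarrow> x = (y :: 'a^3)"
  by (simp add: vec_eq_iff forall_3)

text \<open>Left translation by \<open>p\<close> is affine with linear part \<open>L\<close>, and it
  carries the identity 0 to \<open>p\<close>; invariance at 0 therefore determines the whole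
  field.\<close>

lemma left_invariant_expand:
  assumes "left_invariant X"
  shows "X = (\<lambda>p. X 0 + (p $ 1 * X 0 $ 2) *\<^sub>R axis 3 1)"
proof
  fix p :: "real^3"
  define L :: "real^3 \<Rightarrow> real^3" where "L v = v + (p $ 1 * v $ 2) *\<^sub>R axis 3 1" for v
  have "linear L"
    by (auto intro!: linearI simp: L_def algebra_simps)
  then have "(L has_derivative L) (at 0)"
    by (simp add: linear_conv_bounded_linear bounded_linear_imp_has_derivative)
  then have "((\<lambda>q. p + L q) has_derivative L) (at 0)"
    by (auto intro!: derivative_eq_intros)
  moreover have "heis_mult p = (\<lambda>q. p + L q)"
    by (rule ext, rule vec3_eqI) (simp_all add: heis_mult_def L_def axis_def)
  ultimately have "frechet_derivative (heis_mult p) (at 0) = L"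
    using frechet_derivative_at by metis
  moreover have "heis_mult p 0 = p"
    by (rule vec3_eqI) (simp_all add: heis_mult_def)
  ultimately show "X p = X 0 + (p $ 1 * X 0 $ 2) *\<^sub>R axis 3 1"
    using assms by (metis L_def left_invariant_def)
qed

lemma lie_bracket_left_invariant:
  assumes "left_invariant X" "left_invariant Y"
  shows "lie_bracket X Y p = (X 0 $ 1 * Y 0 $ 2 - Y 0 $ 1 * X 0 $ 2) *\<^sub>R axis 3 1"
proof -
  have deriv: "frechet_derivative X (at p) v = (v $ 1 * X 0 $ 2) *\<^sub>R axis 3 1" if "left_invariant X" for X v
  proof -
    have "((\<lambda>p. X 0 + (p $ 1 * X 0 $ 2) *\<^sub>R axis 3 1) has_derivative (\<lambda>v. (v $ 1 * X 0 $ 2) *\<^sub>R axis 3 1)) (at p)"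
      by (auto intro!: derivative_eq_intros bounded_linear_imp_has_derivative bounded_linear_vec_nth)
    then show ?thesis
      using left_invariant_expand[OF that] frechet_derivative_at by metis
  qed
  have "X p $ 1 = X 0 $ 1" if "left_invariant X" for X
    by (subst left_invariant_expand[OF that]) (simp add: axis_def)
  then show ?thesis
    using assms unfolding lie_bracket_def deriv[OF assms(1)] deriv[OF assms(2)] by (simp add: algebra_simps)
qed

lemma lift_nth [simp]: "lift X x $ 1 = 0" "lift X x $ 2 = X (hpart x) $ 1"
  "lift X x $ 3 = X (hpart x) $ 2" "lift X x $ 4 = X (hpart x) $ 3"
  by (simp_all add: lift_def Let_def)

section \<open>Frame and coframe of a Heisenberg metric in explicit coordinates\<close>

locale heisenberg_metric =
  fixes I :: "real set" and \<epsilon> k :: real and a b :: "real \<Rightarrow> real"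
    and e \<theta> :: "3 \<Rightarrow> real^3 \<Rightarrow> real^3"
  assumes open_I: "open I" and \<epsilon>: "\<epsilon> * \<epsilon> = 1" and k_pos: "k > 0"
    and frame: "heis_frame k e" and dual: "dual_coframe e \<theta>"
    and smooth_a: "smooth_on I a" and smooth_b: "smooth_on I b"
    and nonzero: "t \<in> I \<Longrightarrow> a t \<noteq> 0" "t \<in> I \<Longrightarrow> b t \<noteq> 0"
begin

abbreviation "M \<equiv> heis_manifold I"
abbreviation "g \<equiv> heis_metric \<epsilon> a b \<theta>"

definition "c = e 1 0 $ 3"
definition "u = e 2 0"
definition "v = e 3 0"

lemma left_inv: "left_invariant (e i)"
  using frame by (simp add: heis_frame_def)

lemma frame_2: "e 2 p = vector [u $ 1, u $ 2, u $ 3 + p $ 1 * u $ 2]"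
  by (subst left_invariant_expand[OF left_inv], rule vec3_eqI) (simp_all add: u_def axis_def)

lemma frame_3: "e 3 p = vector [v $ 1, v $ 2, v $ 3 + p $ 1 * v $ 2]"
  by (subst left_invariant_expand[OF left_inv], rule vec3_eqI) (simp_all add: v_def axis_def)

text \<open>A bracket of left-invariant fields points along the third coordinate, so the relation
  for \<open>e 2\<close> and \<open>e 3\<close> forces \<open>e 1\<close> to do the same. Its length
  fixes the signed area spanned by the first two components of \<open>e 2\<close> and
  \<open>e 3\<close>.\<close>

lemma frame_1: "e 1 p = vector [0, 0, c]" and area: "u $ 1 * v $ 2 - v $ 1 * u $ 2 = - 2 * k * c"
proof -
  have bracket: "(u $ 1 * v $ 2 - v $ 1 * u $ 2) *\<^sub>R axis 3 1 = (- 2 * k) *\<^sub>R e 1 p" for p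
    using lie_bracket_left_invariant[OF left_inv left_inv, of 2 3 p] frame
    by (simp add: heis_frame_def u_def v_def)
  show area: "u $ 1 * v $ 2 - v $ 1 * u $ 2 = - 2 * k * c"
    using arg_cong[OF bracket[of 0], of "\<lambda>w. w $ 3"] by (simp add: c_def)
  have "(- 2 * k) *\<^sub>R e 1 p = (- 2 * k) *\<^sub>R vector [0, 0, c]"
    unfolding bracket[symmetric] area by (rule vec3_eqI) (simp_all add: axis_def)
  then show "e 1 p = vector [0, 0, c]"
    using k_pos by simp
qed

lemma c_nonzero: "c \<noteq> 0"
proof
  assume "c = 0"
  then have "e 1 0 = 0"
    unfolding frame_1 by (intro vec3_eqI) simp_all
  moreover have "independent (range (\<lambda>i. e i 0))"
    using frame by (simp add: heis_frame_def)
  ultimately show False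
    using dependent_zero by (metis rangeI)
qed

lemma dual_nth: "\<theta> i p $ 1 * e j p $ 1 + \<theta> i p $ 2 * e j p $ 2 + \<theta> i p $ 3 * e j p $ 3 = (if i = j then 1 else 0)"
  using dual by (simp add: dual_coframe_def inner_vec_def sum_3)

text \<open>In the coordinates \<open>(t, x, y, z)\<close> the coframe \<open>dt\<close>, \<open>\<theta>\<^sup>1\<close>, \<open>\<theta>\<^sup>2\<close>, \<open>\<theta>\<^sup>3\<close> has the component matrix
  \<open>coframe_const + x * coframe_slope\<close>.\<close>

definition coframe_const :: "real^4^4" where
  "coframe_const = vector [axis 1 1,
     vector [0, (u $ 3 * v $ 2 - v $ 3 * u $ 2) / (2 * k * c * c), (u $ 1 * v $ 3 - v $ 1 * u $ 3) / (2 * k * c * c), 1 / c],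
     vector [0, - v $ 2 / (2 * k * c), v $ 1 / (2 * k * c), 0],
     vector [0, u $ 2 / (2 * k * c), - u $ 1 / (2 * k * c), 0]]"

definition coframe_slope :: "real^4^4" where
  "coframe_slope = vector [0, vector [0, 0, - 1 / c, 0], 0, 0]"

lemma lift_coframe:
  shows "lift (\<theta> 2) x = vector [0, - v $ 2 / (2 * k * c), v $ 1 / (2 * k * c), 0]"
    and "lift (\<theta> 3) x = vector [0, u $ 2 / (2 * k * c), - u $ 1 / (2 * k * c), 0]"
    and "lift (\<theta> 1) x = vector [0, (u $ 3 * v $ 2 - v $ 3 * u $ 2) / (2 * k * c * c),
      (u $ 1 * v $ 3 - v $ 1 * u $ 3) / (2 * k * c * c) - x $ 2 / c, 1 / c]"
proof -
  \<comment> \<open>Duality with \<open>e 1\<close> gives the third component of each form; the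
    first two then solve a linear system with determinant \<open>- 2 * k * c\<close>.\<close>
  have cramer: "X = - (\<alpha> * v $ 2 - \<beta> * u $ 2) / (2 * k * c) \<and> Y = - (\<beta> * u $ 1 - \<alpha> * v $ 1) / (2 * k * c)"
    if "X * u $ 1 + Y * u $ 2 = \<alpha>" "X * v $ 1 + Y * v $ 2 = \<beta>" for X Y \<alpha> \<beta>
  proof -
    have "X * (u $ 1 * v $ 2 - v $ 1 * u $ 2) = \<alpha> * v $ 2 - \<beta> * u $ 2"
      "Y * (u $ 1 * v $ 2 - v $ 1 * u $ 2) = \<beta> * u $ 1 - \<alpha> * v $ 1"
      unfolding that[symmetric] by (simp_all add: algebra_simps)
    then show ?thesis
      unfolding area using k_pos c_nonzero by (simp add: divide_simps)
  qed
  define p where "p = hpart x"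
  have p: "p $ 1 = x $ 2"
    by (simp add: p_def hpart_def)
  have z: "\<theta> i p $ 3 = (if i = 1 then 1 / c else 0)" for i
    using dual_nth[of i p 1] c_nonzero by (auto simp: frame_1 field_simps)
  have xy: "\<theta> i p $ 1 * u $ 1 + \<theta> i p $ 2 * u $ 2 = (if i = 2 then 1 else 0) - \<theta> i p $ 3 * (u $ 3 + x $ 2 * u $ 2)"
    "\<theta> i p $ 1 * v $ 1 + \<theta> i p $ 2 * v $ 2 = (if i = 3 then 1 else 0) - \<theta> i p $ 3 * (v $ 3 + x $ 2 * v $ 2)" for i
    using dual_nth[of i p 2] dual_nth[of i p 3] by (auto simp: frame_2 frame_3 p)
  note sol = cramer[OF xy, unfolded z]
  show "lift (\<theta> 2) x = vector [0, - v $ 2 / (2 * k * c), v $ 1 / (2 * k * c), 0]"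
    and "lift (\<theta> 3) x = vector [0, u $ 2 / (2 * k * c), - u $ 1 / (2 * k * c), 0]"
    using sol[of 2] sol[of 3] z by (simp_all add: lift_def p_def[symmetric])
  have "\<theta> 1 p $ 1 = (u $ 3 * v $ 2 - v $ 3 * u $ 2) / (2 * k * c * c)"
    "\<theta> 1 p $ 2 = (u $ 1 * v $ 3 - v $ 1 * u $ 3 + x $ 2 * (u $ 1 * v $ 2 - v $ 1 * u $ 2)) / (2 * k * c * c)"
    using sol[of 1] k_pos c_nonzero by (simp_all add: divide_simps) (simp_all add: algebra_simps)
  then show "lift (\<theta> 1) x = vector [0, (u $ 3 * v $ 2 - v $ 3 * u $ 2) / (2 * k * c * c),
      (u $ 1 * v $ 3 - v $ 1 * u $ 3) / (2 * k * c * c) - x $ 2 / c, 1 / c]"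
    unfolding area using z[of 1] k_pos c_nonzero
    by (simp add: lift_def p_def[symmetric] diff_divide_distrib)
qed

definition H1 :: "real \<Rightarrow> real" where "H1 t = - deriv a t / a t"
definition H2 :: "real \<Rightarrow> real" where "H2 t = - deriv b t / b t"
definition m :: "real \<Rightarrow> real" where "m t = k * (b t)\<^sup>2 / a t"

lemma deriv_a: "t \<in> I \<Longrightarrow> (a has_real_derivative deriv a t) (at t)"
  and deriv_b: "t \<in> I \<Longrightarrow> (b has_real_derivative deriv b t) (at t)"
  using smooth_on_deriv(1)[OF open_I] smooth_a smooth_b by auto

lemma deriv_H1: "t \<in> I \<Longrightarrow> (H1 has_real_derivative deriv H1 t) (at t)"
  and deriv_H2: "t \<in> I \<Longrightarrow> (H2 has_real_derivative deriv H2 t) (at t)"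
proof -
  have "smooth_on I (\<lambda>t. - 1 * deriv a t / a t)" "smooth_on I (\<lambda>t. - 1 * deriv b t / b t)"
    by (intro smooth_on_divide smooth_on_mult smooth_on_const smooth_on_deriv(2) open_I smooth_a smooth_b nonzero; assumption)+
  then show "t \<in> I \<Longrightarrow> (H1 has_real_derivative deriv H1 t) (at t)"
    "t \<in> I \<Longrightarrow> (H2 has_real_derivative deriv H2 t) (at t)"
    using smooth_on_deriv(1)[OF open_I, of "\<lambda>t. - 1 * deriv a t / a t"]
      smooth_on_deriv(1)[OF open_I, of "\<lambda>t. - 1 * deriv b t / b t"]
    unfolding H1_def[abs_def] H2_def[abs_def] by simp_all
qed

lemma deriv_m: "t \<in> I \<Longrightarrow> (m has_real_derivative m t * (H1 t - 2 * H2 t)) (at t)"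
  unfolding m_def[abs_def] H1_def H2_def using nonzero
  by (auto intro!: derivative_eq_intros deriv_a deriv_b simp: field_simps power2_eq_square)

section \<open>The orthonormal coframe of a Heisenberg four-manifold\<close>

text \<open>Row \<open>i + 1\<close> of \<open>\<Theta>\<close> is \<open>e\<^sup>i\<close>; row \<open>1\<close> is \<open>dt\<close>.\<close>

definition \<Theta> :: "real^4 \<Rightarrow> real^4^4" where
  "\<Theta> x = vector [dt, coframe_at a b \<theta> 1 x, coframe_at a b \<theta> 2 x, coframe_at a b \<theta> 3 x]"

definition E :: "real^4 \<Rightarrow> real^4^4" where
  "E x = transpose (vector [axis 1 1, a (x $ 1) *\<^sub>R lift (e 1) x, b (x $ 1) *\<^sub>R lift (e 2) x, b (x $ 1) *\<^sub>R lift (e 3) x])"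

lemma open_M: "open M"
  using open_vimage_vec_nth[OF open_I, of "1::4"] by (simp add: heis_manifold_def vimage_def)

lemma \<Theta>_E:
  assumes "x \<in> M"
  shows "\<Theta> x ** E x = mat 1"
proof -
  have "\<theta> i p $ 1 * (z * e j p $ 1) + \<theta> i p $ 2 * (z * e j p $ 2) + \<theta> i p $ 3 * (z * e j p $ 3) = z * (if i = j then 1 else 0)" for i j p z
    using arg_cong[OF dual_nth[of i p j], of "\<lambda>y. z * y"] by (simp only: distrib_left mult.left_commute)
  then show ?thesis
    using nonzero[OF assms[unfolded heis_manifold_def mem_Collect_eq]]
    by (simp add: vec_eq_iff forall_4 matrix_matrix_mult_def sum_4 \<Theta>_def E_def transpose_def dt_def
        axis_def coframe_at_def mat_def dual_nth add_divide_distrib[symmetric])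
qed

lemma metric_\<Theta>: "x \<in> M \<Longrightarrow> g x = transpose (\<Theta> x) ** diag (eta \<epsilon>) ** \<Theta> x"
  by (simp add: vec_eq_iff congruence_nth)
    (simp add: sum_4 diag_def heis_metric_def tensor_def \<Theta>_def coframe_at_def power2_eq_square algebra_simps)

definition scale :: "4 \<Rightarrow> real \<Rightarrow> real" where
  "scale \<alpha> t = vector [1, 1 / a t, 1 / b t, 1 / b t] $ \<alpha>"

definition rate :: "4 \<Rightarrow> real \<Rightarrow> real" where
  "rate \<alpha> t = vector [0, H1 t, H2 t, H2 t] $ \<alpha>"

text \<open>Each entry factors into a function of \<open>t\<close> and a function affine in the
  coordinate x, so first and second derivatives are explicit and the symmetry of the latter can be
  read off.\<close>

lemma \<Theta>_nth: "\<Theta> x $ \<alpha> $ j = scale \<alpha> (x $ 1) * (coframe_const $ \<alpha> $ j + x $ 2 * coframe_slope $ \<alpha> $ j)"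
proof -
  have "\<forall>\<alpha> j. \<Theta> x $ \<alpha> $ j = scale \<alpha> (x $ 1) * (coframe_const $ \<alpha> $ j + x $ 2 * coframe_slope $ \<alpha> $ j)"
    by (simp add: forall_4 \<Theta>_def scale_def coframe_const_def coframe_slope_def dt_def coframe_at_def lift_coframe)
  then show ?thesis by blast
qed

lemma deriv_scale: "t \<in> I \<Longrightarrow> (scale \<alpha> has_real_derivative rate \<alpha> t * scale \<alpha> t) (at t)"
  using exhaust_4[of \<alpha>] nonzero[of t] unfolding scale_def[abs_def] rate_def H1_def H2_def
  by (auto intro!: derivative_eq_intros deriv_a deriv_b simp: field_simps power2_eq_square)

lemma deriv_rate: "t \<in> I \<Longrightarrow> (rate \<alpha> has_real_derivative deriv (rate \<alpha>) t) (at t)"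
  using exhaust_4[of \<alpha>] deriv_H1[of t] deriv_H2[of t] unfolding rate_def[abs_def] by auto

lemma coord_in_I: "x \<in> M \<Longrightarrow> x $ 1 \<in> I"
  by (simp add: heis_manifold_def)

lemma scale_differentiable: "x \<in> M \<Longrightarrow> (\<lambda>y. scale \<alpha> (y $ 1)) differentiable (at x)"
  by (metis pd_compose_coord(2) deriv_scale coord_in_I)

lemma pdm_\<Theta>_nth: "x \<in> M \<Longrightarrow> pdm i \<Theta> x $ \<alpha> $ j
    = axis i 1 $ 1 * rate \<alpha> (x $ 1) * \<Theta> x $ \<alpha> $ j + axis i 1 $ 2 * scale \<alpha> (x $ 1) * coframe_slope $ \<alpha> $ j"
  unfolding pdm_def \<Theta>_nth
  by (simp add: pd_mult pd_add pd_coord scale_differentiable pd_compose_coord(1)[OF deriv_scale[OF coord_in_I]] algebra_simps)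

lemma diff_\<Theta>: "x \<in> M \<Longrightarrow> diffm \<Theta> x"
  unfolding diffm_def \<Theta>_nth by (auto intro!: derivative_intros scale_differentiable)

lemma pdm_pdm_\<Theta>:
  assumes "x \<in> M"
  shows "diffm (pdm i \<Theta>) x" and "pdm j (pdm i \<Theta>) x $ \<alpha> $ l
    = axis i 1 $ 1 * axis j 1 $ 1 * deriv (rate \<alpha>) (x $ 1) * \<Theta> x $ \<alpha> $ l
    + axis i 1 $ 1 * rate \<alpha> (x $ 1) * pdm j \<Theta> x $ \<alpha> $ l
    + axis i 1 $ 2 * axis j 1 $ 1 * rate \<alpha> (x $ 1) * scale \<alpha> (x $ 1) * coframe_slope $ \<alpha> $ l"
proof -
  let ?f = "\<lambda>\<alpha> l y. axis i 1 $ 1 * rate \<alpha> (y $ 1) * \<Theta> y $ \<alpha> $ l + axis i 1 $ 2 * scale \<alpha> (y $ 1) * coframe_slope $ \<alpha> $ l"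
  have r: "(\<lambda>y. rate \<alpha> (y $ 1)) differentiable (at x)" for \<alpha>
    by (metis pd_compose_coord(2) deriv_rate coord_in_I assms)
  note [simp] = diffm_nth[OF diff_\<Theta>[OF assms]] scale_differentiable[OF assms] r
  have "?f \<alpha> l differentiable (at x)" for \<alpha> l
    by (auto intro!: derivative_intros)
  then show "diffm (pdm i \<Theta>) x"
    unfolding diffm_def
    using frechet_derivative_cong_open(2)[OF open_M assms, of "\<lambda>y. pdm i \<Theta> y $ _ $ _" "?f _ _", OF pdm_\<Theta>_nth]
    by blast
  have "pdm j (pdm i \<Theta>) x $ \<alpha> $ l = pd j (?f \<alpha> l) x"
    unfolding pdm_def[of j] by simp (rule pd_cong_open[OF open_M assms pdm_\<Theta>_nth])
  then show "pdm j (pdm i \<Theta>) x $ \<alpha> $ l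
    = axis i 1 $ 1 * axis j 1 $ 1 * deriv (rate \<alpha>) (x $ 1) * \<Theta> x $ \<alpha> $ l
    + axis i 1 $ 1 * rate \<alpha> (x $ 1) * pdm j \<Theta> x $ \<alpha> $ l
    + axis i 1 $ 2 * axis j 1 $ 1 * rate \<alpha> (x $ 1) * scale \<alpha> (x $ 1) * coframe_slope $ \<alpha> $ l"
    using pd_compose_coord(1)[OF deriv_scale[OF coord_in_I[OF assms]]]
      pd_compose_coord(1)[OF deriv_rate[OF coord_in_I[OF assms]]]
    by (simp add: pd_add pd_mult pdm_def[of j \<Theta>] algebra_simps)
qed

lemma diff_E: "x \<in> M \<Longrightarrow> diffm E x"
proof -
  assume x: "x \<in> M"
  have ab: "(\<lambda>y. a (y $ 1)) differentiable (at x)" "(\<lambda>y. b (y $ 1)) differentiable (at x)"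
    by (metis pd_compose_coord(2) deriv_a deriv_b coord_in_I x)+
  show ?thesis
    unfolding diffm_def forall_4
    by (auto simp: E_def transpose_def lift_def frame_1 frame_2 frame_3 ab hpart_def intro!: derivative_intros)
qed

section \<open>The connection forms\<close>

definition conn_coeff :: "real \<Rightarrow> real^4^4" where
  "conn_coeff t = vector [vector [0, - H1 t, - \<epsilon> * H2 t, - \<epsilon> * H2 t], vector [H1 t, 0, m t, - m t],
     vector [H2 t, - \<epsilon> * m t, 0, - \<epsilon> * m t], vector [H2 t, \<epsilon> * m t, \<epsilon> * m t, 0]]"

definition conn_deriv :: "real \<Rightarrow> real^4^4" where
  "conn_deriv t = (let m' = m t * (H1 t - 2 * H2 t) in
     vector [vector [0, - deriv H1 t, - \<epsilon> * deriv H2 t, - \<epsilon> * deriv H2 t], vector [deriv H1 t, 0, m', - m'],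
     vector [deriv H2 t, - \<epsilon> * m', 0, - \<epsilon> * m'], vector [deriv H2 t, \<epsilon> * m', \<epsilon> * m', 0]])"

text \<open>Each connection form is a multiple of a single coframe element. The table says of which
  one; it is the multiplication table of the Klein four-group. Its diagonal entries meet the
  coefficient 0.\<close>

definition conn_index :: "4^4^4" where
  "conn_index = vector [vector [1, 2, 3, 4], vector [2, 1, 4, 3], vector [3, 4, 1, 2], vector [4, 3, 2, 1]]"

definition \<Omega> :: "4 \<Rightarrow> real^4 \<Rightarrow> real^4^4" where
  "\<Omega> i x = (\<chi> \<alpha> \<beta>. conn_coeff (x $ 1) $ \<alpha> $ \<beta> * \<Theta> x $ (conn_index $ \<alpha> $ \<beta>) $ i)"

lemma deriv_conn:
  assumes "t \<in> I"
  shows "((\<lambda>t. conn_coeff t $ \<alpha> $ \<beta>) has_real_derivative conn_deriv t $ \<alpha> $ \<beta>) (at t)"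
proof -
  have "\<forall>\<alpha> \<beta>. ((\<lambda>t. conn_coeff t $ \<alpha> $ \<beta>) has_real_derivative conn_deriv t $ \<alpha> $ \<beta>) (at t)"
    unfolding forall_4 using assms deriv_m[of t] deriv_H1[of t] deriv_H2[of t]
    by (auto simp: conn_coeff_def conn_deriv_def Let_def intro!: derivative_eq_intros)
  then show ?thesis by blast
qed

lemma pdm_\<Omega>:
  assumes "x \<in> M"
  shows "diffm (\<Omega> i) x" and "pdm j (\<Omega> i) x $ \<alpha> $ \<beta>
    = axis j 1 $ 1 * conn_deriv (x $ 1) $ \<alpha> $ \<beta> * \<Theta> x $ (conn_index $ \<alpha> $ \<beta>) $ i
    + conn_coeff (x $ 1) $ \<alpha> $ \<beta> * pdm j \<Theta> x $ (conn_index $ \<alpha> $ \<beta>) $ i"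
  using diffm_nth[OF diff_\<Theta>[OF assms]] pd_compose_coord[OF deriv_conn[OF coord_in_I[OF assms]]]
  by (auto simp: diffm_def \<Omega>_def pdm_def pd_mult algebra_simps intro!: derivative_intros)

lemma \<Theta>_1: "\<Theta> x $ 1 $ j = axis j 1 $ 1"
  by (simp add: \<Theta>_def dt_def axis_def)

text \<open>Both sides have only an xy component. There \<open>area\<close> gives
  \<open>e\<^sup>2 \<and> e\<^sup>3\<close> the value - 1 / (2 k c b^2), and this is how the bracket
  constant turns into \<open>2 * m\<close>.\<close>

lemma \<Theta>_area: "x \<in> M \<Longrightarrow> axis i 1 $ 2 * scale 2 (x $ 1) * coframe_slope $ 2 $ j - axis j 1 $ 2 * scale 2 (x $ 1) * coframe_slope $ 2 $ i
    = 2 * m (x $ 1) * (\<Theta> x $ 3 $ i * \<Theta> x $ 4 $ j - \<Theta> x $ 3 $ j * \<Theta> x $ 4 $ i)"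
proof -
  assume x: "x \<in> M"
  have slope: "coframe_slope $ 2 $ j = (if j = 3 then - 1 / c else 0)" for j
    using exhaust_4[of j] by (auto simp: coframe_slope_def)
  have nz: "a (x $ 1) \<noteq> 0" "b (x $ 1) \<noteq> 0"
    using nonzero coord_in_I[OF x] by auto
  have "\<Theta> x $ 3 $ 2 * \<Theta> x $ 4 $ 3 - \<Theta> x $ 3 $ 3 * \<Theta> x $ 4 $ 2
      = (u $ 1 * v $ 2 - v $ 1 * u $ 2) / ((2 * k * c) * (2 * k * c) * (b (x $ 1))\<^sup>2)"
    using nz c_nonzero k_pos
    by (simp add: \<Theta>_nth scale_def coframe_const_def coframe_slope_def divide_simps power2_eq_square)
  also have "\<dots> = - 1 / (2 * k * c * (b (x $ 1))\<^sup>2)"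
    unfolding area using c_nonzero k_pos by (simp add: divide_simps)
  finally have *: "2 * m (x $ 1) * (\<Theta> x $ 3 $ 2 * \<Theta> x $ 4 $ 3 - \<Theta> x $ 3 $ 3 * \<Theta> x $ 4 $ 2) = scale 2 (x $ 1) * (- 1 / c)"
    using nz c_nonzero k_pos by (simp add: m_def scale_def)
  then have **: "2 * m (x $ 1) * (\<Theta> x $ 3 $ 3 * \<Theta> x $ 4 $ 2 - \<Theta> x $ 3 $ 2 * \<Theta> x $ 4 $ 3) = scale 2 (x $ 1) * (1 / c)"
    by (simp add: algebra_simps)
  have zero: "\<Theta> x $ \<alpha> $ j = 0" if "\<alpha> = 3 \<or> \<alpha> = 4" "j = 1 \<or> j = 4" for \<alpha> j
    using that by (auto simp: \<Theta>_nth coframe_const_def coframe_slope_def)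
  have "\<forall>i j. axis i 1 $ 2 * scale 2 (x $ 1) * coframe_slope $ 2 $ j - axis j 1 $ 2 * scale 2 (x $ 1) * coframe_slope $ 2 $ i
    = 2 * m (x $ 1) * (\<Theta> x $ 3 $ i * \<Theta> x $ 4 $ j - \<Theta> x $ 3 $ j * \<Theta> x $ 4 $ i)"
    unfolding forall_4 * ** by (simp add: slope axis_def zero)
  then show ?thesis by blast
qed

text \<open>Row 2 is given only antisymmetrised: its slope term is a multiple of dx \<otimes> dy,
  whose skew part is a multiple of \<open>e\<^sup>2 \<and> e\<^sup>3\<close>.\<close>

lemma d\<Theta>:
  assumes "x \<in> M"
  shows "pdm i \<Theta> x $ 1 $ j = 0"
    and "pdm i \<Theta> x $ 2 $ j - pdm j \<Theta> x $ 2 $ i = H1 (x $ 1) * (\<Theta> x $ 1 $ i * \<Theta> x $ 2 $ j - \<Theta> x $ 1 $ j * \<Theta> x $ 2 $ i)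
      + 2 * m (x $ 1) * (\<Theta> x $ 3 $ i * \<Theta> x $ 4 $ j - \<Theta> x $ 3 $ j * \<Theta> x $ 4 $ i)"
    and "pdm i \<Theta> x $ 3 $ j = H2 (x $ 1) * (\<Theta> x $ 1 $ i * \<Theta> x $ 3 $ j)"
    and "pdm i \<Theta> x $ 4 $ j = H2 (x $ 1) * (\<Theta> x $ 1 $ i * \<Theta> x $ 4 $ j)"
  using \<Theta>_area[OF assms, of i j] unfolding pdm_\<Theta>_nth[OF assms]
  by (simp_all add: rate_def coframe_slope_def \<Theta>_1 algebra_simps)

sublocale orthonormal_coframe M g \<Theta> E "eta \<epsilon>" \<Omega>
proof
  show "open M" by (rule open_M)
  show "eta \<epsilon> \<alpha> \<noteq> 0" for \<alpha> by (rule eta_nonzero[OF \<epsilon>])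
  fix x i j \<alpha> \<beta> assume x: "x \<in> M"
  show "\<Theta> x ** E x = mat 1" "g x = transpose (\<Theta> x) ** diag (eta \<epsilon>) ** \<Theta> x" "diffm \<Theta> x" "diffm E x"
    "diffm (\<Omega> i) x" "diffm (pdm i \<Theta>) x"
    using x \<Theta>_E metric_\<Theta> diff_\<Theta> diff_E pdm_\<Omega> pdm_pdm_\<Theta> by blast+
  show "pdm i (pdm j \<Theta>) x = pdm j (pdm i \<Theta>) x"
    by (simp add: vec_eq_iff pdm_pdm_\<Theta>[OF x] pdm_\<Theta>_nth[OF x] algebra_simps)
  have "\<forall>\<alpha> \<beta>. eta \<epsilon> \<alpha> * \<Omega> i x $ \<alpha> $ \<beta> + eta \<epsilon> \<beta> * \<Omega> i x $ \<beta> $ \<alpha> = 0"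
    using \<epsilon> by (simp add: forall_4 \<Omega>_def conn_coeff_def conn_index_def mult.assoc[symmetric])
  then show "eta \<epsilon> \<alpha> * \<Omega> i x $ \<alpha> $ \<beta> + eta \<epsilon> \<beta> * \<Omega> i x $ \<beta> $ \<alpha> = 0"
    by blast
  have "\<forall>\<alpha>. (pdm i \<Theta> x + \<Omega> i x ** \<Theta> x) $ \<alpha> $ j = (pdm j \<Theta> x + \<Omega> j x ** \<Theta> x) $ \<alpha> $ i"
    using d\<Theta>(2)[OF x, of i j]
    by (simp add: forall_4 matrix_matrix_mult_def sum_4 \<Omega>_def conn_coeff_def conn_index_def d\<Theta>(1,3,4)[OF x])
      (simp add: algebra_simps)
  then show "(pdm i \<Theta> x + \<Omega> i x ** \<Theta> x) $ \<alpha> $ j = (pdm j \<Theta> x + \<Omega> j x ** \<Theta> x) $ \<alpha> $ i"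
    by blast
qed

section \<open>Curvature\<close>

lemma \<epsilon>_cancel [simp]: "\<epsilon> * (\<epsilon> * y) = y"
  using \<epsilon> by (metis mult.assoc mult_1)

definition pair :: "real^4 \<Rightarrow> 4 \<Rightarrow> 4 \<Rightarrow> 4 \<Rightarrow> 4 \<Rightarrow> real" where
  "pair x \<alpha> \<beta> i j = \<Theta> x $ \<alpha> $ i * \<Theta> x $ \<beta> $ j - \<Theta> x $ \<beta> $ i * \<Theta> x $ \<alpha> $ j"

text \<open>Up to constant factors, \<open>K1\<close> to \<open>K5\<close> are the frame components
  of the curvature. \<open>K1\<close> and \<open>K2\<close> are the quotients f''/f for f = 1/a and
  f = 1/b, and only they contain second derivatives.\<close>

definition K1 :: "real \<Rightarrow> real" where "K1 t = deriv H1 t + (H1 t)\<^sup>2"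
definition K2 :: "real \<Rightarrow> real" where "K2 t = deriv H2 t + (H2 t)\<^sup>2"
definition K3 :: "real \<Rightarrow> real" where "K3 t = m t * (H1 t - H2 t)"
definition K4 :: "real \<Rightarrow> real" where "K4 t = (m t)\<^sup>2 - H1 t * H2 t"
definition K5 :: "real \<Rightarrow> real" where "K5 t = 3 * (m t)\<^sup>2 + (H2 t)\<^sup>2"

text \<open>The digits name row and column in the matrix of curvature forms; the entries not listed
  follow by skewness.\<close>

definition F21 :: "real^4 \<Rightarrow> 4 \<Rightarrow> 4 \<Rightarrow> real" where
  "F21 x i j = K1 (x $ 1) * pair x 1 2 i j + 2 * K3 (x $ 1) * pair x 3 4 i j"
definition F31 :: "real^4 \<Rightarrow> 4 \<Rightarrow> 4 \<Rightarrow> real" where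
  "F31 x i j = K2 (x $ 1) * pair x 1 3 i j + \<epsilon> * K3 (x $ 1) * pair x 2 4 i j"
definition F41 :: "real^4 \<Rightarrow> 4 \<Rightarrow> 4 \<Rightarrow> real" where
  "F41 x i j = K2 (x $ 1) * pair x 1 4 i j - \<epsilon> * K3 (x $ 1) * pair x 2 3 i j"
definition F23 :: "real^4 \<Rightarrow> 4 \<Rightarrow> 4 \<Rightarrow> real" where
  "F23 x i j = K3 (x $ 1) * pair x 1 4 i j + \<epsilon> * K4 (x $ 1) * pair x 2 3 i j"
definition F24 :: "real^4 \<Rightarrow> 4 \<Rightarrow> 4 \<Rightarrow> real" where
  "F24 x i j = - K3 (x $ 1) * pair x 1 3 i j + \<epsilon> * K4 (x $ 1) * pair x 2 4 i j"
definition F34 :: "real^4 \<Rightarrow> 4 \<Rightarrow> 4 \<Rightarrow> real" where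
  "F34 x i j = - 2 * \<epsilon> * K3 (x $ 1) * pair x 1 2 i j - \<epsilon> * K5 (x $ 1) * pair x 3 4 i j"

lemma curvature_form_explicit:
  assumes x: "x \<in> M"
  shows "curvature_form i j x = vector [
    vector [0, - F21 x i j, - \<epsilon> * F31 x i j, - \<epsilon> * F41 x i j],
    vector [F21 x i j, 0, F23 x i j, F24 x i j],
    vector [F31 x i j, - \<epsilon> * F23 x i j, 0, F34 x i j],
    vector [F41 x i j, - \<epsilon> * F24 x i j, - F34 x i j, 0]]"
proof -
  \<comment> \<open>As a rewrite rule this trades one index order for the other, so that the
    remaining derivatives of row 2 cancel.\<close>
  have d2: "pdm i \<Theta> x $ 2 $ j = pdm j \<Theta> x $ 2 $ i + H1 (x $ 1) * (\<Theta> x $ 1 $ i * \<Theta> x $ 2 $ j - \<Theta> x $ 1 $ j * \<Theta> x $ 2 $ i)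
      + 2 * m (x $ 1) * (\<Theta> x $ 3 $ i * \<Theta> x $ 4 $ j - \<Theta> x $ 3 $ j * \<Theta> x $ 4 $ i)"
    using d\<Theta>(2)[OF x, of i j] by simp
  show ?thesis
    unfolding vec_eq_iff forall_4
    by (simp add: curvature_form_def pdm_\<Omega>[OF x] matrix_matrix_mult_def sum_4 \<Omega>_def conn_coeff_def conn_deriv_def
        conn_index_def Let_def d2 d\<Theta>(1,3,4)[OF x] \<Theta>_1[where x = x, symmetric])
      (simp add: F21_def F31_def F41_def F23_def F24_def F34_def K1_def K2_def K3_def K4_def K5_def
        pair_def \<epsilon> power2_eq_square algebra_simps)
qed

lemma riemann_lower_frame:
  assumes x: "x \<in> M"
  shows "riemann_lower g x i j k' l =
    \<epsilon> * F21 x i j * pair x 1 2 k' l + F31 x i j * pair x 1 3 k' l + F41 x i j * pair x 1 4 k' l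
    - \<epsilon> * F23 x i j * pair x 2 3 k' l - \<epsilon> * F24 x i j * pair x 2 4 k' l - F34 x i j * pair x 3 4 k' l"
proof -
  let ?\<Phi> = "curvature_form i j x"
  have "transpose (E x) ** transpose (\<Theta> x) = mat 1"
    using \<Theta>_E[OF x] by (metis matrix_transpose_mul transpose_mat)
  then have "A ** transpose (E x) ** transpose (\<Theta> x) = A" for A :: "real^4^4"
    by (metis matrix_mul_assoc matrix_mul_rid)
  then have "transpose (\<chi> l k. riemann g x l i j k) ** g x = transpose (\<Theta> x) ** (transpose ?\<Phi> ** diag (eta \<epsilon>)) ** \<Theta> x"
    unfolding riemann_frame[OF x] metric_\<Theta>[OF x] by (simp add: matrix_transpose_mul matrix_mul_assoc)
  moreover have "riemann_lower g x i j k' l = (transpose (\<chi> l k. riemann g x l i j k) ** g x) $ k' $ l"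
    by (simp add: riemann_lower_def matrix_matrix_mult_def transpose_def)
  ultimately show ?thesis
    by (simp add: congruence_nth diag_mult_right)
      (simp add: transpose_def curvature_form_explicit[OF x] sum_4 pair_def algebra_simps)
qed

lemma ricci_frame:
  assumes x: "x \<in> M"
  shows "(\<chi> j k'. ricci g x j k') = transpose (\<Theta> x) ** diag (\<lambda>\<alpha>. vector [- K1 (x $ 1) - 2 * K2 (x $ 1),
      - K1 (x $ 1) + 2 * K4 (x $ 1), \<epsilon> * (- K2 (x $ 1) + K4 (x $ 1) - K5 (x $ 1)), \<epsilon> * (- K2 (x $ 1) + K4 (x $ 1) - K5 (x $ 1))] $ \<alpha>) ** \<Theta> x"
proof -
  \<comment> \<open>\<open>C \<alpha>\<close> contracts the form index with the frame vector
    \<open>\<alpha>\<close>. On coframe elements it is a Kronecker delta, which makes the trace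
    purely algebraic.\<close>
  define C where "C \<alpha> f = (\<Sum>i\<in>UNIV. E x $ i $ \<alpha> * f i)" for \<alpha> :: 4 and f :: "4 \<Rightarrow> real"
  have lin: "C \<alpha> (\<lambda>i. f i + h i) = C \<alpha> f + C \<alpha> h" "C \<alpha> (\<lambda>i. f i - h i) = C \<alpha> f - C \<alpha> h"
    "C \<alpha> (\<lambda>i. r * f i) = r * C \<alpha> f" "C \<alpha> (\<lambda>i. f i * r) = C \<alpha> f * r" "C \<alpha> (\<lambda>i. - f i) = - C \<alpha> f" "C \<alpha> (\<lambda>i. 0) = 0" for \<alpha> f h r
    by (simp_all add: C_def sum.distrib sum_subtractf sum_distrib_left sum_distrib_right sum_negf algebra_simps)
  have C\<Theta>: "C \<alpha> (\<lambda>i. \<Theta> x $ \<beta> $ i) = (if \<beta> = \<alpha> then 1 else 0)" for \<alpha> \<beta>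
    using arg_cong[OF \<Theta>_E[OF x], of "\<lambda>A. A $ \<beta> $ \<alpha>"]
    by (simp add: C_def matrix_matrix_mult_def mat_def mult.commute)
  have "ricci g x j k' = (\<Sum>\<alpha>\<in>UNIV. \<Sum>\<beta>\<in>UNIV. C \<alpha> (\<lambda>i. curvature_form i j x $ \<alpha> $ \<beta>) * \<Theta> x $ \<beta> $ k')" for j k'
  proof -
    have "ricci g x j k' = (\<Sum>i\<in>UNIV. (E x ** curvature_form i j x ** \<Theta> x) $ i $ k')"
      unfolding ricci_def riemann_frame[OF x, symmetric] by simp
    also have "\<dots> = (\<Sum>i\<in>UNIV. \<Sum>\<alpha>\<in>UNIV. \<Sum>\<beta>\<in>UNIV. E x $ i $ \<alpha> * curvature_form i j x $ \<alpha> $ \<beta> * \<Theta> x $ \<beta> $ k')"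
      using congruence_nth[of "transpose (E x)" _ "\<Theta> x"] by (simp add: transpose_def[of "E x"]) (simp add: transpose_def mult_ac)
    also have "\<dots> = (\<Sum>\<alpha>\<in>UNIV. \<Sum>\<beta>\<in>UNIV. \<Sum>i\<in>UNIV. E x $ i $ \<alpha> * curvature_form i j x $ \<alpha> $ \<beta> * \<Theta> x $ \<beta> $ k')"
      by (subst sum.swap) (intro sum.cong refl sum.swap)
    finally show ?thesis
      by (simp add: C_def sum_distrib_right)
  qed
  then show ?thesis
    by (simp add: vec_eq_iff congruence_nth)
      (simp add: diag_def sum_4 curvature_form_explicit[OF x] F21_def F31_def F41_def F23_def F24_def F34_def
        pair_def lin C\<Theta> algebra_simps)
qed

lemma scalar_curvature_einstein:
  assumes x: "x \<in> M" and ein: "\<And>i j. ricci g x i j = \<Lambda> * g x $ i $ j"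
  shows "scalar_curvature g x = 4 * \<Lambda>"
proof -
  have sym: "g x $ i $ j = g x $ j $ i" for i j
    by (simp add: metric_nth[OF x] mult_ac)
  have "g x ** (E x ** matrix_inv (diag (eta \<epsilon>)) ** transpose (E x)) = mat 1"
  proof -
    have "transpose (\<Theta> x) ** transpose (E x) = mat 1"
      using inverse'[OF x] by (metis matrix_transpose_mul transpose_mat)
    moreover have "diag (eta \<epsilon>) ** matrix_inv (diag (eta \<epsilon>)) = mat 1"
      unfolding matrix_inv_diag[OF eta_nonzero[OF \<epsilon>]] vec_eq_iff diag_mult_left
      using eta_nonzero[OF \<epsilon>] by (auto simp: diag_def mat_def)
    ultimately show ?thesis
      unfolding metric_\<Theta>[OF x] using \<Theta>_E[OF x] by (metis matrix_mul_assoc matrix_mul_rid)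
  qed
  then have "matrix_inv (g x) ** g x = mat 1"
    using matrix_inv_unique matrix_left_right_inverse by metis
  then have "(\<Sum>i\<in>UNIV. (matrix_inv (g x) ** g x) $ i $ i) = 4"
    by (simp add: mat_def)
  moreover have "scalar_curvature g x = \<Lambda> * (\<Sum>i\<in>UNIV. (matrix_inv (g x) ** g x) $ i $ i)"
    unfolding scalar_curvature_def ein matrix_matrix_mult_def
    by (simp add: sum_distrib_left mult_ac sym[of _ "_ :: 4"])
  ultimately show ?thesis by simp
qed

lemma congruence_cancel:
  assumes x: "x \<in> M" and "transpose (\<Theta> x) ** A ** \<Theta> x = transpose (\<Theta> x) ** B ** \<Theta> x"
  shows "A = B"
proof -
  have "transpose (E x) ** transpose (\<Theta> x) = mat 1"
    using \<Theta>_E[OF x] by (metis matrix_transpose_mul transpose_mat)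
  then have "transpose (E x) ** (transpose (\<Theta> x) ** A ** \<Theta> x) ** E x = A" for A
    using \<Theta>_E[OF x] by (metis matrix_mul_assoc matrix_mul_lid matrix_mul_rid)
  then show ?thesis
    using assms(2) by metis
qed

text \<open>The first relation will become the vanishing trace that ties the two eigenvalues
  together; the second expresses \<open>K1\<close>, and with it the second derivative of
  \<open>a\<close>, by first derivatives.\<close>

lemma einstein_ode:
  assumes x: "x \<in> M" and ein: "\<And>i j. ricci g x i j = \<Lambda> * g x $ i $ j"
  shows "- K1 (x $ 1) - 2 * K2 (x $ 1) = \<epsilon> * \<Lambda>" "- K1 (x $ 1) + 2 * K4 (x $ 1) = \<epsilon> * \<Lambda>"
proof -
  let ?R = "diag (\<lambda>\<alpha>. vector [- K1 (x $ 1) - 2 * K2 (x $ 1),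
      - K1 (x $ 1) + 2 * K4 (x $ 1), \<epsilon> * (- K2 (x $ 1) + K4 (x $ 1) - K5 (x $ 1)), \<epsilon> * (- K2 (x $ 1) + K4 (x $ 1) - K5 (x $ 1))] $ \<alpha>)"
  have "transpose (\<Theta> x) ** ?R ** \<Theta> x = \<Lambda> *\<^sub>R (transpose (\<Theta> x) ** diag (eta \<epsilon>) ** \<Theta> x)"
    unfolding ricci_frame[OF x, symmetric] metric_\<Theta>[OF x, symmetric] by (simp add: ein vec_eq_iff)
  also have "\<dots> = transpose (\<Theta> x) ** (\<Lambda> *\<^sub>R diag (eta \<epsilon>)) ** \<Theta> x"
    by (simp add: scalar_matrix_assoc[symmetric] matrix_scalar_ac)
  finally have "?R = \<Lambda> *\<^sub>R diag (eta \<epsilon>)"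
    by (rule congruence_cancel[OF x])
  then have "?R $ i $ j = (\<Lambda> *\<^sub>R diag (eta \<epsilon>)) $ i $ j" for i j
    by (simp only:)
  from this[of 1 1] this[of 2 2]
  show "- K1 (x $ 1) - 2 * K2 (x $ 1) = \<epsilon> * \<Lambda>" "- K1 (x $ 1) + 2 * K4 (x $ 1) = \<epsilon> * \<Lambda>"
    by (simp_all add: diag_def mult.commute)
qed

section \<open>The Weyl tensor and the Hodge star in the frame\<close>

lemma weyl_frame:
  assumes x: "x \<in> M" and ein: "\<And>i j. ricci g x i j = \<Lambda> * g x $ i $ j"
  shows "weyl g x i j k' l =
      (\<epsilon> * F21 x i j + \<Lambda> / 3 * pair x 1 2 i j) * pair x 1 2 k' l + (F31 x i j + \<epsilon> * \<Lambda> / 3 * pair x 1 3 i j) * pair x 1 3 k' l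
    + (F41 x i j + \<epsilon> * \<Lambda> / 3 * pair x 1 4 i j) * pair x 1 4 k' l - (\<epsilon> * F23 x i j - \<epsilon> * \<Lambda> / 3 * pair x 2 3 i j) * pair x 2 3 k' l
    - (\<epsilon> * F24 x i j - \<epsilon> * \<Lambda> / 3 * pair x 2 4 i j) * pair x 2 4 k' l - (F34 x i j - \<Lambda> / 3 * pair x 3 4 i j) * pair x 3 4 k' l"
proof -
  let ?G = "g x $ j $ k' * g x $ i $ l - g x $ i $ k' * g x $ j $ l"
  have G: "?G = - (pair x 1 2 i j * pair x 1 2 k' l + \<epsilon> * (pair x 1 3 i j * pair x 1 3 k' l + pair x 1 4 i j * pair x 1 4 k' l
      + pair x 2 3 i j * pair x 2 3 k' l + pair x 2 4 i j * pair x 2 4 k' l) + pair x 3 4 i j * pair x 3 4 k' l)"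
    by (simp add: metric_nth[OF x] sum_4 pair_def algebra_simps)
  \<comment> \<open>Ricci and scalar corrections contribute - \<Lambda> + 2 \<Lambda> / 3 = -
    \<Lambda> / 3 times the constant curvature tensor \<open>?G\<close>.\<close>
  have "weyl g x i j k' l = riemann_lower g x i j k' l - \<Lambda> / 3 * ?G"
    unfolding weyl_def scalar_curvature_einstein[OF assms] ein by (simp add: field_simps)
  then show ?thesis
    unfolding G riemann_lower_frame[OF x] by (simp add: algebra_simps)
qed

lemma raise_indices_frame:
  assumes x: "x \<in> M"
  shows "\<Theta> x ** raise_indices (g x) (transpose (\<Theta> x) ** w ** \<Theta> x) ** transpose (\<Theta> x)
    = diag (eta \<epsilon>) ** w ** diag (eta \<epsilon>)"
proof -
  have "transpose (E x) ** transpose (\<Theta> x) = mat 1"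
    using \<Theta>_E[OF x] by (metis matrix_transpose_mul transpose_mat)
  then have "\<Theta> x ** (E x ** N ** transpose (E x)) ** transpose (\<Theta> x) = N" for N
    using \<Theta>_E[OF x] by (metis matrix_mul_assoc matrix_mul_lid matrix_mul_rid)
  then show ?thesis
    unfolding metric_\<Theta>[OF x] raise_indices_congruence[OF \<Theta>_E[OF x] matrix_inv_diag(2)[OF eta_nonzero[OF \<epsilon>]]]
      raise_indices_eta[OF \<epsilon>] .
qed

lemma skew4_pair: "(transpose (\<Theta> x) ** skew4 p q r s t w ** \<Theta> x) $ i $ j
    = p * pair x 1 2 i j + q * pair x 1 3 i j + r * pair x 1 4 i j + s * pair x 2 3 i j + t * pair x 2 4 i j + w * pair x 3 4 i j"
  by (simp add: congruence_nth sum_4 pair_def algebra_simps)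

text \<open>The outer factor 2 comes from summing over all \<open>k\<close> and \<open>l\<close>.
  The coefficients couple \<open>p\<close> only to \<open>w\<close>, \<open>q\<close> only to
  \<open>t\<close> and \<open>r\<close> only to \<open>s\<close>.\<close>

lemma weyl_op_frame:
  assumes x: "x \<in> M" and ein: "\<And>i j. ricci g x i j = \<Lambda> * g x $ i $ j"
  shows "weyl_op g x (transpose (\<Theta> x) ** skew4 p q r s t w ** \<Theta> x) = transpose (\<Theta> x) ** skew4
      (2 * ((\<epsilon> * K1 (x $ 1) + \<Lambda> / 3) * p + 2 * \<epsilon> * K3 (x $ 1) * w))
      (2 * \<epsilon> * ((K2 (x $ 1) + \<epsilon> * \<Lambda> / 3) * q + \<epsilon> * K3 (x $ 1) * t))
      (2 * \<epsilon> * ((K2 (x $ 1) + \<epsilon> * \<Lambda> / 3) * r - \<epsilon> * K3 (x $ 1) * s))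
      (2 * \<epsilon> * ((\<epsilon> * \<Lambda> / 3 - K4 (x $ 1)) * s - \<epsilon> * K3 (x $ 1) * r))
      (2 * \<epsilon> * ((\<epsilon> * \<Lambda> / 3 - K4 (x $ 1)) * t + \<epsilon> * K3 (x $ 1) * q))
      (2 * ((\<epsilon> * K5 (x $ 1) + \<Lambda> / 3) * w + 2 * \<epsilon> * K3 (x $ 1) * p)) ** \<Theta> x"
proof -
  define R where "R = raise_indices (g x) (transpose (\<Theta> x) ** skew4 p q r s t w ** \<Theta> x)"
  define D where "D f = (\<Sum>k\<in>UNIV. \<Sum>l\<in>UNIV. f k l * R $ k $ l)" for f :: "4 \<Rightarrow> 4 \<Rightarrow> real"
  have lin: "D (\<lambda>k l. f k l + h k l) = D f + D h" "D (\<lambda>k l. f k l - h k l) = D f - D h"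
    "D (\<lambda>k l. z * f k l) = z * D f" for f h z
    by (simp_all add: D_def sum.distrib sum_subtractf sum_distrib_left algebra_simps)
  have "D (\<lambda>k l. \<Theta> x $ \<alpha> $ k * \<Theta> x $ \<beta> $ l) = (\<Theta> x ** R ** transpose (\<Theta> x)) $ \<alpha> $ \<beta>" for \<alpha> \<beta>
    using congruence_nth[of "transpose (\<Theta> x)" R "transpose (\<Theta> x)"] by (simp add: D_def) (simp add: transpose_def)
  then have D\<Theta>: "D (\<lambda>k l. \<Theta> x $ \<alpha> $ k * \<Theta> x $ \<beta> $ l) = eta \<epsilon> \<alpha> * skew4 p q r s t w $ \<alpha> $ \<beta> * eta \<epsilon> \<beta>" for \<alpha> \<beta>
    by (simp add: R_def raise_indices_frame[OF x] diag_mult_left diag_mult_right)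
  have Dp: "D (\<lambda>k l. pair x \<alpha> \<beta> k l) = eta \<epsilon> \<alpha> * eta \<epsilon> \<beta> * (skew4 p q r s t w $ \<alpha> $ \<beta> - skew4 p q r s t w $ \<beta> $ \<alpha>)" for \<alpha> \<beta>
    unfolding pair_def lin D\<Theta> by (simp add: algebra_simps)
  have "weyl_op g x (transpose (\<Theta> x) ** skew4 p q r s t w ** \<Theta> x) $ i $ j = D (\<lambda>k l. weyl g x i j k l)" for i j
    by (simp add: weyl_op_def D_def R_def)
  then show ?thesis
    unfolding vec_eq_iff weyl_frame[OF assms] lin Dp skew4_pair
    by (simp add: F21_def F31_def F41_def F23_def F24_def F34_def \<epsilon> algebra_simps)
qed

text \<open>\<open>\<sigma>\<close> is an orientation relative to the coordinates; multiplied by the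
  sign of \<open>det (\<Theta> x)\<close> it becomes one relative to the frame.\<close>

lemma hodge_frame:
  assumes x: "x \<in> M"
  shows "hodge \<sigma> (g x) (transpose (\<Theta> x) ** w ** \<Theta> x)
    = transpose (\<Theta> x) ** hodge (\<sigma> * sgn (det (\<Theta> x))) (diag (eta \<epsilon>)) w ** \<Theta> x"
proof -
  have sgn: "sgn (det (\<Theta> x)) *\<^sub>R hodge \<sigma> (diag (eta \<epsilon>)) w = hodge (\<sigma> * sgn (det (\<Theta> x))) (diag (eta \<epsilon>)) w"
    by (simp add: hodge_def vec_eq_iff)
  show ?thesis
    unfolding sgn[symmetric] metric_\<Theta>[OF x] hodge_congruence[OF \<Theta>_E[OF x] matrix_inv_diag(2)[OF eta_nonzero[OF \<epsilon>]]]
    by (simp add: scalar_matrix_assoc matrix_scalar_ac)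
qed

lemma two_form_congruence: "two_form w \<Longrightarrow> two_form (transpose (\<Theta> x) ** w ** \<Theta> x)"
  by (simp add: two_form_def matrix_transpose_mul matrix_ring_simps)

section \<open>Eigenforms of the Weyl tensor\<close>

text \<open>Put X = k b^3 and Y = a b'. The Einstein relation and the equation for a' give 3 a^2 b^2
  (K1 + \<epsilon> \<Lambda> / 3) = 9 X^2 + 3 Y^2 + \<epsilon> \<Lambda> a^2 b^2. Multiplying by Y -
  3 X and inserting the equation for \<epsilon> \<Lambda> leaves (9 X^2 + 3 Y^2) (Y - 3 X) + 3 (X -
  Y)^3, in which everything cancels except - 24 X^3.\<close>

lemma weyl_nu_eq:
  assumes t: "t \<in> I" and "\<Lambda> \<noteq> 0" and ode: "heis_ode I \<epsilon> \<Lambda> k a b"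
    and K: "- K1 t + 2 * K4 t = \<epsilon> * \<Lambda>"
  shows "4 * (\<epsilon> * K1 t + \<Lambda> / 3) = - 2 * weyl_nu \<epsilon> k a b t"
proof -
  define A B A' B' L where "A = a t" and "B = b t" and "A' = deriv a t" and "B' = deriv b t" and "L = \<epsilon> * \<Lambda>"
  define d where "d = - 3 * k * B ^ 3 + A * B'"
  have nz: "A \<noteq> 0" "B \<noteq> 0"
    using nonzero[OF t] by (auto simp: A_def B_def)
  have "\<epsilon> \<noteq> 0" using \<epsilon> by auto
  then have L0: "L \<noteq> 0" using \<open>\<Lambda> \<noteq> 0\<close> by (simp add: L_def)
  have L: "L = 3 * (k * B ^ 3 - A * B') ^ 3 / (A\<^sup>2 * B\<^sup>2 * d)"
    using ode t unfolding heis_ode_def A_def B_def B'_def L_def d_def by blast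
  \<comment> \<open>Division by 0 yields 0, so a vanishing \<open>d\<close> would force
    \<open>L = 0\<close>.\<close>
  have d: "d \<noteq> 0" using L L0 by auto
  have Ld: "L * (A\<^sup>2 * B\<^sup>2) * d = 3 * (k * B ^ 3 - A * B') ^ 3"
    unfolding L using nz d by (simp add: field_simps)
  \<comment> \<open>Cleared of its denominator, the equation for a' also holds at zeros of b',
    because there the second equation reduces to L A^2 B^2 = - k^2 B^6.\<close>
  have A': "2 * A * B * A' * B' = - (k\<^sup>2 * B ^ 6 + A\<^sup>2 * (L * B\<^sup>2 + B'\<^sup>2))"
  proof (cases "B' = 0")
    case True
    have "- (3 * k * B ^ 3) * (L * (A\<^sup>2 * B\<^sup>2) + k\<^sup>2 * B ^ 6) = 0"
      using Ld unfolding d_def True by (simp add: algebra_simps power_mult_distrib power2_eq_square power3_eq_cube) (simp add: eval_nat_numeral algebra_simps)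
    then have "L * (A\<^sup>2 * B\<^sup>2) + k\<^sup>2 * B ^ 6 = 0"
      using nz k_pos by simp
    then show ?thesis using True by (simp add: algebra_simps)
  next
    case False
    have "A' = - (k\<^sup>2 * B ^ 6 + A\<^sup>2 * (L * B\<^sup>2 + B'\<^sup>2)) / (2 * A * B * B')"
      using ode t False unfolding heis_ode_def A_def B_def A'_def B'_def L_def by blast
    then show ?thesis using False nz by simp
  qed
  have K1: "K1 t + L / 3 = 2 * (k * B\<^sup>2 / A)\<^sup>2 - 2 * (A' * B' / (A * B)) - 2 * L / 3"
    using K unfolding K4_def m_def H1_def H2_def L_def A_def B_def A'_def B'_def by simp
  have "3 * A\<^sup>2 * B\<^sup>2 * (K1 t + L / 3) = 6 * k\<^sup>2 * B ^ 6 - 3 * (2 * A * B * A' * B') - 2 * L * (A\<^sup>2 * B\<^sup>2)"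
    unfolding K1 using nz by (simp add: field_simps power2_eq_square) (simp add: eval_nat_numeral algebra_simps)
  also have "\<dots> = 9 * k\<^sup>2 * B ^ 6 + 3 * A\<^sup>2 * B'\<^sup>2 + L * (A\<^sup>2 * B\<^sup>2)"
    unfolding A' by (simp add: algebra_simps)
  finally have "3 * A\<^sup>2 * B\<^sup>2 * (K1 t + L / 3) * d = (9 * k\<^sup>2 * B ^ 6 + 3 * A\<^sup>2 * B'\<^sup>2) * d + L * (A\<^sup>2 * B\<^sup>2) * d"
    by (simp add: algebra_simps)
  also have "\<dots> = - 24 * k ^ 3 * B ^ 9"
    unfolding Ld unfolding d_def by (simp add: eval_nat_numeral algebra_simps)
  finally have "3 * B\<^sup>2 * (A\<^sup>2 * d * (K1 t + L / 3)) = 3 * B\<^sup>2 * (- 8 * k ^ 3 * B ^ 7)"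
    by (simp add: eval_nat_numeral mult_ac)
  then have cleared: "A\<^sup>2 * d * (K1 t + L / 3) = - 8 * k ^ 3 * B ^ 7"
    using nz by (subst (asm) mult_left_cancel) auto
  have "K1 t + L / 3 = A\<^sup>2 * d * (K1 t + L / 3) / (A\<^sup>2 * d)"
    using nz d by simp
  then have *: "K1 t + L / 3 = - 8 * k ^ 3 * B ^ 7 / (A\<^sup>2 * d)"
    unfolding cleared .
  have "4 * (\<epsilon> * K1 t + \<Lambda> / 3) = 4 * \<epsilon> * (K1 t + L / 3)"
    by (simp add: L_def algebra_simps)
  also have "\<dots> = - 2 * (16 * k ^ 3 * B ^ 7 / (\<epsilon> * A\<^sup>2 * d))"
    unfolding * using nz d \<open>\<epsilon> \<noteq> 0\<close> \<epsilon> by (simp add: divide_simps) 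
  finally show ?thesis
    by (simp add: weyl_nu_def A_def B_def B'_def d_def mult.assoc)
qed

text \<open>The frame components of \<open>sd_form\<close>, with \<open>s\<close> the orientation
  relative to the frame.\<close>

definition sd_basis :: "real \<Rightarrow> 3 \<Rightarrow> real^4^4" where
  "sd_basis s i = (if i = 1 then skew4 1 0 0 0 0 s else if i = 2 then skew4 0 1 0 0 (- s * \<epsilon>) 0 else skew4 0 0 1 (s * \<epsilon>) 0 0)"

lemma wedge_coframe:
  "wedge dt (coframe_at a b \<theta> 1 x) = transpose (\<Theta> x) ** skew4 1 0 0 0 0 0 ** \<Theta> x"
  "wedge dt (coframe_at a b \<theta> 2 x) = transpose (\<Theta> x) ** skew4 0 1 0 0 0 0 ** \<Theta> x"
  "wedge dt (coframe_at a b \<theta> 3 x) = transpose (\<Theta> x) ** skew4 0 0 1 0 0 0 ** \<Theta> x"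
  unfolding vec_eq_iff skew4_pair by (simp_all add: pair_def wedge_def tensor_def) (simp_all add: \<Theta>_def)

lemma sd_form_frame:
  assumes x: "x \<in> M"
  shows "sd_form \<sigma> g a b \<theta> i x = transpose (\<Theta> x) ** sd_basis (\<sigma> * sgn (det (\<Theta> x))) i ** \<Theta> x"
proof -
  have sum: "transpose (\<Theta> x) ** A ** \<Theta> x + transpose (\<Theta> x) ** B ** \<Theta> x = transpose (\<Theta> x) ** (A + B) ** \<Theta> x" for A B
    by (simp add: matrix_ring_simps)
  consider "i = 1" | "i = 2" | "i = 3"
    using exhaust_3 by blast
  then show ?thesis
    by cases (simp_all add: sd_form_def wedge_coframe hodge_frame[OF x] hodge_eta[OF \<epsilon>] sum skew4_add sd_basis_def)
qed

lemma sd_basis_independent: "inj (sd_basis s)" "independent (range (sd_basis s))"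
proof -
  show "inj (sd_basis s)"
    unfolding inj_on_def
  proof (intro ballI impI)
    fix i j :: 3 assume "sd_basis s i = sd_basis s j"
    then show "i = j"
      using exhaust_3[of i] exhaust_3[of j] by (auto simp: sd_basis_def skew4_eq_iff)
  qed
  have "skew4 p q r z t w = 0 \<longleftrightarrow> p = 0 \<and> q = 0 \<and> r = 0 \<and> z = 0 \<and> t = 0 \<and> w = 0" for p q r z t w
    by (auto simp: vec_eq_iff forall_4)
  then have "sd_basis s i \<noteq> 0" for i
    by (simp add: sd_basis_def)
  then have "0 \<notin> range (sd_basis s)"
    by (metis imageE)
  \<comment> \<open>Orthogonality refers to the Euclidean inner product of matrices, not to the
    metric, so it serves both signs of \<epsilon>.\<close>
  moreover have "pairwise orthogonal (range (sd_basis s))"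
    by (auto simp: pairwise_def orthogonal_def sd_basis_def inner_vec_def sum_4)
  ultimately show "independent (range (sd_basis s))"
    using pairwise_orthogonal_independent by blast
qed

text \<open>In a form fixed by the star, the three entries without dt are determined by the three
  with dt, and the latter are its coefficients in \<open>sd_basis s\<close>.\<close>

lemma span_sd_basis:
  assumes "s * s = 1"
  shows "span (range (sd_basis s)) = {w. two_form w \<and> hodge s (diag (eta \<epsilon>)) w = w}" (is "_ = ?S")
proof
  have [simp]: "s * (s * y) = y" for y
    using assms by (metis mult.assoc mult_1)
  have mem: "skew4 p q r z t w \<in> ?S \<longleftrightarrow> w = s * p \<and> t = - s * \<epsilon> * q \<and> z = s * \<epsilon> * r" for p q r z t w
    by (auto simp: hodge_eta[OF \<epsilon>] skew4_eq_iff assms algebra_simps)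
  have eq: "\<exists>p q r. w = skew4 p q r (s * \<epsilon> * r) (- s * \<epsilon> * q) (s * p)" if "w \<in> ?S" for w
    using that two_form_skew4[of w] mem by (metis (no_types, lifting) mem_Collect_eq)
  have expand: "skew4 p q r (s * \<epsilon> * r) (- s * \<epsilon> * q) (s * p) = p *\<^sub>R sd_basis s 1 + q *\<^sub>R sd_basis s 2 + r *\<^sub>R sd_basis s 3" for p q r
    by (simp add: sd_basis_def skew4_scaleR skew4_add mult_ac)
  show "?S \<subseteq> span (range (sd_basis s))"
  proof
    fix w assume "w \<in> ?S"
    then obtain p q r where w: "w = skew4 p q r (s * \<epsilon> * r) (- s * \<epsilon> * q) (s * p)"
      using eq by blast
    show "w \<in> span (range (sd_basis s))"
      unfolding w expand by (intro span_add span_scale span_base) auto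
  qed
  show "span (range (sd_basis s)) \<subseteq> ?S"
  proof (rule span_minimal)
    have "sd_basis s i \<in> ?S" for i
      unfolding sd_basis_def by (simp only: mem split: if_split) auto
    then show "range (sd_basis s) \<subseteq> ?S"
      by blast
    show "subspace ?S"
      unfolding subspace_def
    proof (intro conjI ballI allI)
      have zero: "0 = skew4 0 0 0 0 0 0"
        by (simp add: vec_eq_iff forall_4)
      show "0 \<in> ?S"
        unfolding zero mem by simp
      fix w w' z assume "w \<in> ?S" "w' \<in> ?S"
      then obtain p q r p' q' r' where *: "w = skew4 p q r (s * \<epsilon> * r) (- s * \<epsilon> * q) (s * p)"
        "w' = skew4 p' q' r' (s * \<epsilon> * r') (- s * \<epsilon> * q') (s * p')"
        using eq[of w] eq[of w'] by blast
      show "w + w' \<in> ?S" "z *\<^sub>R w \<in> ?S"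
        unfolding * skew4_add skew4_scaleR mem by (auto simp: algebra_simps)
    qed
  qed
qed

lemma det_\<Theta>_nonzero: "x \<in> M \<Longrightarrow> det (\<Theta> x) \<noteq> 0"
  using \<Theta>_E[of x] by (metis det_I det_mul mult_zero_left zero_neq_one)

lemma weyl_eigenforms:
  assumes x: "x \<in> M" and \<sigma>: "\<sigma> * \<sigma> = 1" and ein: "einstein M \<Lambda> g" and sd: "weyl_self_dual M \<sigma> g"
    and \<Lambda>: "\<Lambda> \<noteq> 0" and ode: "heis_ode I \<epsilon> \<Lambda> k a b"
  defines "\<omega> \<equiv> \<lambda>i. sd_form \<sigma> g a b \<theta> i x" and "\<nu> \<equiv> weyl_nu \<epsilon> k a b (x $ 1)"
  shows "inj \<omega> \<and> independent (range \<omega>) \<and>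
            span (range \<omega>) = {\<eta>. two_form \<eta> \<and> hodge \<sigma> (g x) \<eta> = \<eta>} \<and>
            weyl_op g x (\<omega> 1) = (- 2 * \<nu>) *\<^sub>R \<omega> 1 \<and>
            weyl_op g x (\<omega> 2) = \<nu> *\<^sub>R \<omega> 2 \<and>
            weyl_op g x (\<omega> 3) = \<nu> *\<^sub>R \<omega> 3"
proof -
  define s where "s = \<sigma> * sgn (det (\<Theta> x))"
  have ss: "s * s = 1"
    using \<sigma> det_\<Theta>_nonzero[OF x] by (auto simp: s_def sgn_if)
  then have s_cancel [simp]: "s * (s * y) = y" for y
    by (auto simp flip: mult.assoc)
  define L where "L w = transpose (\<Theta> x) ** w ** \<Theta> x" for w
  have "linear L"
    by (auto intro!: linearI simp: L_def matrix_ring_simps scalar_matrix_assoc matrix_scalar_ac)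
  have "inj L"
    using congruence_cancel[OF x] by (auto simp: inj_def L_def)
  have \<omega>: "\<omega> = L \<circ> sd_basis s"
    by (auto simp: \<omega>_def L_def s_def sd_form_frame[OF x])
  have "inj \<omega>"
    unfolding \<omega> using sd_basis_independent(1) \<open>inj L\<close> by (metis inj_compose)
  moreover have "independent (range \<omega>)"
    unfolding \<omega> image_comp[symmetric]
    using linear_independent_injective_image[OF \<open>linear L\<close> sd_basis_independent(2)] \<open>inj L\<close>
    by (metis inj_on_subset subset_UNIV)
  moreover have "span (range \<omega>) = {\<eta>. two_form \<eta> \<and> hodge \<sigma> (g x) \<eta> = \<eta>}"
  proof -
    have hodge: "hodge \<sigma> (g x) (L w) = L (hodge s (diag (eta \<epsilon>)) w)" for w
      unfolding L_def s_def by (rule hodge_frame[OF x])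
    have surj: "L (transpose (E x) ** \<eta> ** E x) = \<eta>" for \<eta>
    proof -
      have "transpose (\<Theta> x) ** transpose (E x) = mat 1"
        using inverse'[OF x] by (metis matrix_transpose_mul transpose_mat)
      then have "transpose (\<Theta> x) ** transpose (E x) ** \<eta> ** E x ** \<Theta> x = \<eta>"
        using inverse'[OF x] by (metis matrix_mul_assoc matrix_mul_lid matrix_mul_rid)
      then show ?thesis
        by (simp add: L_def matrix_mul_assoc)
    qed
    have two: "two_form (L w) \<longleftrightarrow> two_form w" for w
    proof -
      have "L (transpose w) = transpose (L w)" "L (- w) = - L w"
        by (simp_all add: L_def matrix_transpose_mul matrix_ring_simps)
      then show ?thesis
        unfolding two_form_def using \<open>inj L\<close> by (metis injD)
    qed
    have "span (range \<omega>) = L ` {w. two_form w \<and> hodge s (diag (eta \<epsilon>)) w = w}"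
      unfolding \<omega> image_comp[symmetric] using linear_span_image[OF \<open>linear L\<close>] span_sd_basis[OF ss] by metis
    also have "\<dots> = {\<eta>. two_form \<eta> \<and> hodge \<sigma> (g x) \<eta> = \<eta>}"
    proof (intro subset_antisym subsetI)
      fix \<eta> assume "\<eta> \<in> L ` {w. two_form w \<and> hodge s (diag (eta \<epsilon>)) w = w}"
      then show "\<eta> \<in> {\<eta>. two_form \<eta> \<and> hodge \<sigma> (g x) \<eta> = \<eta>}"
        by (auto simp: hodge two)
    next
      fix \<eta> assume \<eta>: "\<eta> \<in> {\<eta>. two_form \<eta> \<and> hodge \<sigma> (g x) \<eta> = \<eta>}"
      obtain w where w: "\<eta> = L w"
        using surj by metis
      then show "\<eta> \<in> L ` {w. two_form w \<and> hodge s (diag (eta \<epsilon>)) w = w}"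
        using \<eta> \<open>inj L\<close> unfolding w by (auto simp: hodge two inj_eq)
    qed
    finally show ?thesis .
  qed
  moreover have "weyl_op g x (\<omega> 1) = (- 2 * \<nu>) *\<^sub>R \<omega> 1 \<and> weyl_op g x (\<omega> 2) = \<nu> *\<^sub>R \<omega> 2 \<and> weyl_op g x (\<omega> 3) = \<nu> *\<^sub>R \<omega> 3"
  proof -
    have ein': "ricci g x i j = \<Lambda> * g x $ i $ j" for i j
      using ein x by (simp add: einstein_def)
    define A1 A2 A3 A4 C where "A1 = \<epsilon> * K1 (x $ 1) + \<Lambda> / 3" and "A2 = K2 (x $ 1) + \<epsilon> * \<Lambda> / 3"
      and "A3 = \<epsilon> * \<Lambda> / 3 - K4 (x $ 1)" and "A4 = \<epsilon> * K5 (x $ 1) + \<Lambda> / 3" and "C = \<epsilon> * K3 (x $ 1)"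
    have weyl: "weyl_op g x (L (skew4 p q r z t w)) = L (skew4 (2 * (A1 * p + 2 * C * w)) (2 * \<epsilon> * (A2 * q + C * t))
        (2 * \<epsilon> * (A2 * r - C * z)) (2 * \<epsilon> * (A3 * z - C * r)) (2 * \<epsilon> * (A3 * t + C * q)) (2 * (A4 * w + 2 * C * p)))" for p q r z t w
      unfolding L_def weyl_op_frame[OF x ein'] by (simp add: A1_def A2_def A3_def A4_def C_def mult.assoc)
    have "hodge s (diag (eta \<epsilon>)) (skew4 (2 * (A1 * p + 2 * C * w)) (2 * \<epsilon> * (A2 * q + C * t))
        (2 * \<epsilon> * (A2 * r - C * z)) (2 * \<epsilon> * (A3 * z - C * r)) (2 * \<epsilon> * (A3 * t + C * q)) (2 * (A4 * w + 2 * C * p)))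
      = skew4 (2 * (A1 * p + 2 * C * w)) (2 * \<epsilon> * (A2 * q + C * t))
        (2 * \<epsilon> * (A2 * r - C * z)) (2 * \<epsilon> * (A3 * z - C * r)) (2 * \<epsilon> * (A3 * t + C * q)) (2 * (A4 * w + 2 * C * p))" for p q r z t w
    proof -
      have "hodge \<sigma> (g x) (weyl_op g x (L (skew4 p q r z t w))) = weyl_op g x (L (skew4 p q r z t w))"
        using sd x two_form_congruence[OF two_form_skew4', of x] unfolding weyl_self_dual_def L_def by blast
      then show ?thesis
        unfolding weyl unfolding L_def hodge_frame[OF x] s_def[symmetric] by (rule congruence_cancel[OF x])
    qed
    \<comment> \<open>Unit values of (\<open>p\<close>, \<open>w\<close>) and (\<open>q\<close>,
      \<open>t\<close>) yield the relations among \<open>A1\<close> to \<open>A4\<close> and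
      \<open>C\<close>. The plane of \<open>r\<close> and \<open>z\<close> has the same coefficients
      as that of \<open>q\<close> and \<open>t\<close> up to signs and follows from them.\<close>
    then have sd': "s * (2 * (A1 * p + 2 * C * w)) = 2 * (A4 * w + 2 * C * p)"
      "- s * \<epsilon> * (2 * \<epsilon> * (A2 * q + C * t)) = 2 * \<epsilon> * (A3 * t + C * q)" for p q t w
      unfolding hodge_eta[OF \<epsilon>] skew4_eq_iff by blast+
    have C: "2 * C = s * A1"
      using sd'(1)[of 1 0] by (simp add: mult_ac)
    have "A4 = s * (2 * C)"
      using sd'(1)[of 0 1] by (simp add: mult_ac)
    then have A4: "A4 = A1"
      unfolding C by simp
    have C': "C = - s * \<epsilon> * A2" and A3: "A3 = A2"
    proof -
      have 1: "\<epsilon> * C = - s * A2" and 2: "\<epsilon> * A3 = - s * C"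
        using sd'(2)[of 1 0] sd'(2)[of 0 1] by (simp_all add: mult_ac)
      have "\<epsilon> * (\<epsilon> * C) = - s * \<epsilon> * A2"
        unfolding 1 by simp
      then show C': "C = - s * \<epsilon> * A2"
        by simp
      have "\<epsilon> * (\<epsilon> * A3) = A2"
        unfolding 2 C' by (simp add: mult.left_commute \<epsilon>)
      then show "A3 = A2"
        by simp
    qed
    have \<nu>1: "4 * A1 = - 2 * \<nu>"
      unfolding A1_def \<nu>_def using weyl_nu_eq[OF coord_in_I[OF x] \<Lambda> ode einstein_ode(2)[OF x ein']] .
    \<comment> \<open>Up to a factor this is the trace of the Weyl operator on self-dual forms; it
      fixes the ratio -2 : 1 of the eigenvalues.\<close>
    have "\<epsilon> * A1 + 2 * A2 = 0"
      using einstein_ode(1)[OF x ein'] by (simp add: A1_def A2_def algebra_simps)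
    then have "\<epsilon> * (\<epsilon> * A1 + 2 * A2) = 0"
      by simp
    then have \<nu>2: "4 * \<epsilon> * A2 = \<nu>"
      using \<nu>1 \<epsilon> by (simp add: algebra_simps)
    have scale: "z *\<^sub>R L w = L (z *\<^sub>R w)" for z w
      using \<open>linear L\<close> by (simp add: linear_cmul)
    have "weyl_op g x (\<omega> 1) = (4 * A1) *\<^sub>R \<omega> 1" "weyl_op g x (\<omega> 2) = (4 * \<epsilon> * A2) *\<^sub>R \<omega> 2" "weyl_op g x (\<omega> 3) = (4 * \<epsilon> * A2) *\<^sub>R \<omega> 3"
      unfolding \<omega> comp_def scale
      by (simp_all add: sd_basis_def weyl skew4_scaleR C A4) (simp_all add: C' A3 algebra_simps)
    then show ?thesis
      unfolding \<nu>1 \<nu>2 by blast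
  qed
  ultimately show ?thesis
    by blast
qed

section \<open>The two complex structures\<close>

definition J0 :: "real \<Rightarrow> real^4^4" where
  "J0 s = skew4 (- s) 0 0 0 0 (- 1)"

definition J :: "real \<Rightarrow> real^4 \<Rightarrow> real^4^4" where
  "J s x = E x ** J0 s ** \<Theta> x"

lemma J0_square: "s * s = 1 \<Longrightarrow> J0 s ** J0 s = - mat 1"
  by (simp add: J0_def vec_eq_iff forall_4 matrix_matrix_mult_def sum_4 mat_def)

lemma \<Theta>_J: "x \<in> M \<Longrightarrow> \<Theta> x ** J s x = J0 s ** \<Theta> x"
  unfolding J_def matrix_mul_assoc \<Theta>_E by simp

lemma smooth_coord: "smooth_on I (h :: real \<Rightarrow> real) \<Longrightarrow> smooth_on M (\<lambda>x. h (x $ 1))"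
  unfolding heis_manifold_def by (rule smooth_on_compose_coord[OF open_I])

lemma smooth_\<Theta>: "smooth_on M \<Theta>"
proof (rule smooth_on_matrix[OF open_M])
  fix \<alpha> j
  have "smooth_on I (scale \<alpha>)"
    using exhaust_4[of \<alpha>] nonzero unfolding scale_def[abs_def]
    by (auto intro!: smooth_on_divide smooth_on_const smooth_a smooth_b open_I)
  then show "smooth_on M (\<lambda>x. \<Theta> x $ \<alpha> $ j)"
    unfolding \<Theta>_nth
    by (intro smooth_on_mult smooth_on_add smooth_on_const smooth_coord open_M smooth_on_bounded_linear[OF open_M bounded_linear_vec_nth])
qed

lemma smooth_E: "smooth_on M E"
proof (rule smooth_on_matrix[OF open_M])
  have "\<forall>i j. smooth_on M (\<lambda>x. E x $ i $ j)"
    unfolding forall_4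
    by (simp add: E_def transpose_def axis_def frame_1 frame_2 frame_3 hpart_def)
      (intro conjI smooth_on_mult smooth_on_add smooth_on_const smooth_coord smooth_a smooth_b open_M smooth_on_bounded_linear[OF open_M bounded_linear_vec_nth])
  then show "smooth_on M (\<lambda>x. E x $ i $ j)" for i j
    by blast
qed

lemma smooth_J: "smooth_on M (J s)"
  unfolding J_def[abs_def]
  by (intro smooth_on_bilinear[OF open_M bounded_bilinear_matrix_mult] smooth_E smooth_\<Theta> smooth_on_const open_M)

lemma diffm_J:
  assumes "x \<in> M"
  shows "diffm (J s) x"
proof -
  have "diffm (\<lambda>y. J0 s) x"
    by (simp add: diffm_def)
  then show ?thesis
    unfolding J_def[abs_def] by (intro diffm_mult diff_E diff_\<Theta> assms)
qed

text \<open>Frame components of the exterior derivative of coframe row \<open>\<gamma>\<close>, the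
  \<open>f\<close> of \<open>nijenhuis_coframe\<close>.\<close>

definition coframe_diff :: "real \<Rightarrow> 4 \<Rightarrow> real^4^4" where
  "coframe_diff t \<gamma> = vector [0, skew4 (H1 t) 0 0 0 0 (2 * m t), skew4 0 (H2 t) 0 0 0 0, skew4 0 0 (H2 t) 0 0 0] $ \<gamma>"

lemma complex_structure_J:
  assumes s: "s * s = 1"
  shows "complex_structure M (J s)"
  unfolding complex_structure_def
proof (intro conjI ballI allI)
  show "smooth_on M (J s)" by (rule smooth_J)
  fix x assume x: "x \<in> M"
  have "J s x ** J s x = E x ** J0 s ** (\<Theta> x ** J s x)"
    by (simp add: J_def matrix_mul_assoc)
  also have "\<dots> = E x ** (J0 s ** J0 s) ** \<Theta> x"
    unfolding \<Theta>_J[OF x] by (simp add: matrix_mul_assoc)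
  finally show "J s x ** J s x = - mat 1"
    by (simp add: J0_square[OF s] inverse'[OF x] matrix_ring_simps)
  fix i j l
  have f: "pdm i \<Theta> x $ \<gamma> $ j - pdm j \<Theta> x $ \<gamma> $ i = (transpose (\<Theta> x) ** coframe_diff (x $ 1) \<gamma> ** \<Theta> x) $ i $ j" for \<gamma> i j
  proof -
    consider "\<gamma> = 1" | "\<gamma> = 2" | "\<gamma> = 3" | "\<gamma> = 4" using exhaust_4 by blast
    then show ?thesis
    proof cases
      case 1
      then show ?thesis by (simp add: d\<Theta>(1)[OF x] coframe_diff_def congruence_nth)
    next
      case 2
      then show ?thesis using d\<Theta>(2)[OF x, of i j]
        by (simp add: coframe_diff_def skew4_pair pair_def algebra_simps)
    next
      case 3
      then show ?thesis by (simp add: d\<Theta>(3)[OF x] coframe_diff_def skew4_pair pair_def algebra_simps)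
    next
      case 4
      then show ?thesis by (simp add: d\<Theta>(4)[OF x] coframe_diff_def skew4_pair pair_def algebra_simps)
    qed
  qed
  \<comment> \<open>By type: dt \<and> \<open>e\<^sup>1\<close> and
    \<open>e\<^sup>2 \<and> e\<^sup>3\<close> are of type (1,1), and the exterior derivative of the
    (1,0)-form \<open>e\<^sup>2 + i e\<^sup>3\<close> is \<open>H2\<close> times its product with
    dt, which has no (0,2) part.\<close>
  have integrable: "(\<Sum>\<mu>\<in>UNIV. J0 s $ \<gamma> $ \<mu> *\<^sub>R (transpose (J0 s) ** coframe_diff t \<mu> + coframe_diff t \<mu> ** J0 s))
      - transpose (J0 s) ** coframe_diff t \<gamma> ** J0 s + coframe_diff t \<gamma> = 0" for \<gamma> t
  proof -
    have [simp]: "s * (s * y) = y" for y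
      using s by (metis mult.assoc mult_1)
    have "\<forall>\<gamma>. (\<Sum>\<mu>\<in>UNIV. J0 s $ \<gamma> $ \<mu> *\<^sub>R (transpose (J0 s) ** coframe_diff t \<mu> + coframe_diff t \<mu> ** J0 s))
      - transpose (J0 s) ** coframe_diff t \<gamma> ** J0 s + coframe_diff t \<gamma> = 0"
      by (simp add: forall_4 vec_eq_iff sum_4 matrix_matrix_mult_def transpose_def J0_def coframe_diff_def s algebra_simps)
    then show ?thesis by blast
  qed
  have "invertible (\<Theta> x)"
    using \<Theta>_E[OF x] invertible_right_inverse by blast
  from nijenhuis_coframe[OF open_M x this diff_\<Theta>[OF x] diffm_J[OF x] \<Theta>_J J0_square[OF s] f integrable]
  show "(\<Sum>k'\<in>UNIV. J s x $ k' $ i * pd k' (\<lambda>y. J s y $ l $ j) x - J s x $ k' $ j * pd k' (\<lambda>y. J s y $ l $ i) x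
      - J s x $ l $ k' * (pd i (\<lambda>y. J s y $ k' $ j) x - pd j (\<lambda>y. J s y $ k' $ i) x)) = 0" .
qed

section \<open>Fundamental forms and conformal factors\<close>

lemma J_isometry:
  assumes s: "s * s = 1" and x: "x \<in> M"
  shows "transpose (J s x) ** g x = transpose (\<Theta> x) ** skew4 (s * \<epsilon>) 0 0 0 0 1 ** \<Theta> x"
    and "transpose (J s x) ** g x ** J s x = g x"
proof -
  have "transpose (J s x) ** transpose (\<Theta> x) = transpose (\<Theta> x) ** transpose (J0 s)"
    using \<Theta>_J[OF x] by (metis matrix_transpose_mul)
  then have "transpose (J s x) ** g x = transpose (\<Theta> x) ** (transpose (J0 s) ** diag (eta \<epsilon>)) ** \<Theta> x"
    unfolding metric_\<Theta>[OF x] by (simp add: matrix_mul_assoc)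
  also have "transpose (J0 s) ** diag (eta \<epsilon>) = skew4 (s * \<epsilon>) 0 0 0 0 1"
    by (simp add: vec_eq_iff forall_4 diag_mult_right transpose_def J0_def)
  finally show 1: "transpose (J s x) ** g x = transpose (\<Theta> x) ** skew4 (s * \<epsilon>) 0 0 0 0 1 ** \<Theta> x" .
  have "transpose (J s x) ** g x ** J s x = transpose (\<Theta> x) ** (skew4 (s * \<epsilon>) 0 0 0 0 1 ** J0 s) ** \<Theta> x"
    unfolding 1 using \<Theta>_J[OF x, of s] by (simp flip: matrix_mul_assoc)
  also have "skew4 (s * \<epsilon>) 0 0 0 0 1 ** J0 s = diag (eta \<epsilon>)"
    using s by (simp add: vec_eq_iff forall_4 matrix_matrix_mult_def sum_4 J0_def diag_def)
  finally show "transpose (J s x) ** g x ** J s x = g x"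
    unfolding metric_\<Theta>[OF x] .
qed

text \<open>In the exterior derivative of \<omega>, the summand with dt \<and>
  \<open>e\<^sup>1\<close> contributes - 2 s \<epsilon> m f and the one with
  \<open>e\<^sup>2 \<and> e\<^sup>3\<close> contributes f' + 2 H2 f, both as coefficients of dt
  \<and> \<open>e\<^sup>2 \<and> e\<^sup>3\<close>. The assumed equation for \<open>f\<close> makes
  their sum vanish.\<close>

lemma closed_fundamental_form:
  assumes x: "x \<in> M"
    and f: "(f has_real_derivative (2 * \<epsilon> * s * m (x $ 1) - 2 * H2 (x $ 1)) * f (x $ 1)) (at (x $ 1))"
  defines "\<omega> \<equiv> \<lambda>j l y. f (y $ 1) * (s * \<epsilon> * pair y 1 2 j l + pair y 3 4 j l)"
  shows "pd i (\<omega> j l) x + pd j (\<omega> l i) x + pd l (\<omega> i j) x = 0"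
proof -
  have d2: "pdm i \<Theta> x $ 2 $ j = pdm j \<Theta> x $ 2 $ i + H1 (x $ 1) * (\<Theta> x $ 1 $ i * \<Theta> x $ 2 $ j - \<Theta> x $ 1 $ j * \<Theta> x $ 2 $ i)
      + 2 * m (x $ 1) * (\<Theta> x $ 3 $ i * \<Theta> x $ 4 $ j - \<Theta> x $ 3 $ j * \<Theta> x $ 4 $ i)" for i j
    using d\<Theta>(2)[OF x, of i j] by simp
  note [simp] = diffm_nth[OF diff_\<Theta>[OF x]] pd_compose_coord(2)[OF f]
  have pd\<Theta>: "pd i (\<lambda>y. \<Theta> y $ \<alpha> $ j) x = pdm i \<Theta> x $ \<alpha> $ j" for i \<alpha> j
    by (simp add: pdm_def)
  have pd_pair: "(\<lambda>y. pair y \<alpha> \<beta> j l) differentiable (at x)"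
    "pd i (\<lambda>y. pair y \<alpha> \<beta> j l) x = pdm i \<Theta> x $ \<alpha> $ j * \<Theta> x $ \<beta> $ l + \<Theta> x $ \<alpha> $ j * pdm i \<Theta> x $ \<beta> $ l
      - pdm i \<Theta> x $ \<beta> $ j * \<Theta> x $ \<alpha> $ l - \<Theta> x $ \<beta> $ j * pdm i \<Theta> x $ \<alpha> $ l" for i j l \<alpha> \<beta>
  proof -
    have eq: "pair y \<alpha> \<beta> j l = \<Theta> y $ \<alpha> $ j * \<Theta> y $ \<beta> $ l + (- 1) * (\<Theta> y $ \<beta> $ j * \<Theta> y $ \<alpha> $ l)" for y
      by (simp add: pair_def)
    show "(\<lambda>y. pair y \<alpha> \<beta> j l) differentiable (at x)"
      unfolding pair_def by (auto intro!: derivative_intros)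
    show "pd i (\<lambda>y. pair y \<alpha> \<beta> j l) x = pdm i \<Theta> x $ \<alpha> $ j * \<Theta> x $ \<beta> $ l + \<Theta> x $ \<alpha> $ j * pdm i \<Theta> x $ \<beta> $ l
      - pdm i \<Theta> x $ \<beta> $ j * \<Theta> x $ \<alpha> $ l - \<Theta> x $ \<beta> $ j * pdm i \<Theta> x $ \<alpha> $ l"
      unfolding eq by (subst pd_add, simp, simp, subst pd_const_mult) (simp_all add: pd_mult pd\<Theta> algebra_simps)
  qed
  have pd\<omega>: "pd i (\<omega> j l) x = (2 * \<epsilon> * s * m (x $ 1) - 2 * H2 (x $ 1)) * f (x $ 1) * \<Theta> x $ 1 $ i * (s * \<epsilon> * pair x 1 2 j l + pair x 3 4 j l)
      + f (x $ 1) * (s * \<epsilon> * pd i (\<lambda>y. pair y 1 2 j l) x + pd i (\<lambda>y. pair y 3 4 j l) x)" for i j l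
    unfolding \<omega>_def
    by (subst pd_mult) (simp_all add: pd_pair(1) pd_add pd_const_mult pd_compose_coord(1)[OF f] \<Theta>_1)
  show ?thesis
    unfolding pd\<omega> pd_pair(2) unfolding d\<Theta>(1,3,4)[OF x] pair_def d2[of i j] d2[of j l] d2[of l i]
    by (simp add: algebra_simps)
qed

lemma conformally_kaehler_J:
  assumes "is_interval I" and s: "s * s = 1" and "smooth_on M g"
  shows "conformally_kaehler M g (J s)"
proof -
  have smooth_q: "smooth_on I (\<lambda>t. b t * b t / a t)"
    using nonzero by (intro smooth_on_divide smooth_on_mult smooth_a smooth_b open_I)
  then have "continuous_on I (\<lambda>t. b t * b t / a t)"
    unfolding smooth_on_def by (metis ck_on.simps(1))
  then obtain G where G: "(G has_real_derivative b t * b t / a t) (at t)" if "t \<in> I" for t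
    using antiderivative_on_open_interval[OF open_I \<open>is_interval I\<close>] by blast
  \<comment> \<open>The factor \<open>b t * b t\<close> has logarithmic derivative - 2 H2. Since
    \<open>k * G\<close> has derivative \<open>m\<close>, the exponential supplies the term
    \<open>2 * \<epsilon> * s * m\<close>.\<close>
  define f where "f t = b t * b t * exp (2 * \<epsilon> * s * k * G t)" for t
  have f: "(f has_real_derivative (2 * \<epsilon> * s * m t - 2 * H2 t) * f t) (at t)" if "t \<in> I" for t
    unfolding f_def[abs_def] m_def H2_def using that nonzero[OF that]
    by (auto intro!: derivative_eq_intros G deriv_b simp: field_simps power2_eq_square)
  have f_pos: "f t > 0" if "t \<in> I" for t
    using nonzero(2)[OF that] by (auto simp: f_def zero_less_mult_iff)
  have "smooth_on I G"
    by (rule smooth_on_antiderivative[OF open_I G smooth_q])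
  then have "smooth_on I f"
    unfolding f_def[abs_def] by (intro smooth_on_mult smooth_on_exp smooth_on_const smooth_b open_I)
  then have smooth_f: "smooth_on M (\<lambda>x. f (x $ 1))"
    by (rule smooth_coord)
  have "pseudo_kaehler M (\<lambda>x. f (x $ 1) *\<^sub>R g x) (J s)"
    unfolding pseudo_kaehler_def
  proof (intro conjI ballI)
    show "pseudo_riemannian M (\<lambda>x. f (x $ 1) *\<^sub>R g x)"
      unfolding pseudo_riemannian_def
    proof (intro conjI ballI)
      show "smooth_on M (\<lambda>x. f (x $ 1) *\<^sub>R g x)"
        using smooth_f assms(3) by (rule smooth_on_scaleR[OF open_M])
      fix x assume x: "x \<in> M"
      show "transpose (f (x $ 1) *\<^sub>R g x) = f (x $ 1) *\<^sub>R g x"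
        by (simp add: transpose_scalar metric_\<Theta>[OF x] matrix_transpose_mul matrix_mul_assoc)
      have "det (g x) \<noteq> 0"
        unfolding metric_\<Theta>[OF x] det_mul det_transpose
        using det_\<Theta>_nonzero[OF x] matrix_inv_diag(2)[of "eta \<epsilon>", OF eta_nonzero[OF \<epsilon>]]
        by (simp add: invertible_det_nz)
      then show "invertible (f (x $ 1) *\<^sub>R g x)"
        using f_pos[OF coord_in_I[OF x]] scalar_invertible[of "f (x $ 1)" "g x"] by (simp add: invertible_det_nz)
    qed
    show "complex_structure M (J s)"
      by (rule complex_structure_J[OF s])
    show "transpose (J s x) ** (f (x $ 1) *\<^sub>R g x) ** J s x = f (x $ 1) *\<^sub>R g x" if "x \<in> M" for x
      using J_isometry(2)[OF s that] by (metis matrix_scalar_ac scalar_matrix_assoc)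
    show "closed_two_form M (\<lambda>x. transpose (J s x) ** (f (x $ 1) *\<^sub>R g x))"
      unfolding closed_two_form_def
    proof (intro ballI allI)
      fix x i j l assume x: "x \<in> M"
      have form: "(transpose (J s y) ** (f (y $ 1) *\<^sub>R g y)) $ i $ j = f (y $ 1) * (s * \<epsilon> * pair y 1 2 i j + pair y 3 4 i j)"
        if "y \<in> M" for y i j
        using J_isometry(1)[OF s that] by (simp add: matrix_scalar_ac scalar_matrix_assoc[symmetric] skew4_pair)
      have pd_form: "pd i (\<lambda>y. (transpose (J s y) ** (f (y $ 1) *\<^sub>R g y)) $ j $ l) x
          = pd i (\<lambda>y. f (y $ 1) * (s * \<epsilon> * pair y 1 2 j l + pair y 3 4 j l)) x" for i j l
        by (rule pd_cong_open[OF open_M x form])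
      show "pd i (\<lambda>y. (transpose (J s y) ** (f (y $ 1) *\<^sub>R g y)) $ j $ l) x
        + pd j (\<lambda>y. (transpose (J s y) ** (f (y $ 1) *\<^sub>R g y)) $ l $ i) x
        + pd l (\<lambda>y. (transpose (J s y) ** (f (y $ 1) *\<^sub>R g y)) $ i $ j) x = 0"
        using closed_fundamental_form[OF x f[OF coord_in_I[OF x]], of i j l]
        unfolding pd_form .
    qed
  qed
  then show ?thesis
    unfolding conformally_kaehler_def using smooth_f f_pos coord_in_I by blast
qed

text \<open>\<open>area\<close> supplies a second factor \<open>c\<close>, so the sign does not
  depend on the direction of \<open>e 1\<close>: for positive \<open>a\<close> the frame is opposite
  to the coordinate orientation.\<close>

lemma det_E:
  assumes "x \<in> M"
  shows "det (E x) = - 2 * k * c\<^sup>2 * (a (x $ 1) * (b (x $ 1))\<^sup>2)"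
proof -
  have "det (E x) = a (x $ 1) * (b (x $ 1))\<^sup>2 * c * (u $ 1 * v $ 2 - v $ 1 * u $ 2)"
    unfolding E_def det_transpose by (simp add: det_4 frame_1 frame_2 frame_3 axis_def power2_eq_square algebra_simps)
  then show ?thesis
    unfolding area by (simp add: power2_eq_square)
qed

text \<open>In the frame, \<open>det (u, J u, v, J v)\<close> is \<open>s\<close> times the squared modulus of a complex
  two-by-two determinant.\<close>

lemma induces_orientation_J:
  assumes s: "s * s = 1" and a_pos: "\<And>t. t \<in> I \<Longrightarrow> a t > 0"
  shows "induces_orientation M (J s) (- s)"
  unfolding induces_orientation_def Let_def
proof (intro ballI allI impI)
  fix x and y z :: "real^4"
  assume x: "x \<in> M" and nz: "det (vector [y, J s x *v y, z, J s x *v z] :: real^4^4) \<noteq> 0"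
  define p q where "p = \<Theta> x *v y" and "q = \<Theta> x *v z"
  have E: "E x *v (\<Theta> x *v y) = y" for y
    using inverse'[OF x] by (simp add: matrix_vector_mul_assoc)
  have J: "J s x *v y = E x *v (J0 s *v (\<Theta> x *v y))" for y
    by (simp add: J_def matrix_vector_mul_assoc matrix_mul_assoc)
  \<comment> \<open>The complex coordinates in the frame are \<open>p $ 1 + i s p $ 2\<close> and
    \<open>p $ 3 + i p $ 4\<close>, and likewise for \<open>q\<close>; the two squares are the real
    and the imaginary part of the determinant.\<close>
  define Q where "Q = (p $ 1 * q $ 3 - s * p $ 2 * q $ 4 - p $ 3 * q $ 1 + s * p $ 4 * q $ 2)\<^sup>2
    + (p $ 1 * q $ 4 + s * p $ 2 * q $ 3 - p $ 4 * q $ 1 - s * p $ 3 * q $ 2)\<^sup>2"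
  have [simp]: "s * (s * r) = r" for r
    using s by (metis mult.assoc mult_1)
  have "det (vector [p, J0 s *v p, q, J0 s *v q] :: real^4^4) = s * Q"
    by (simp add: Q_def det_4 J0_def matrix_vector_nth sum_4 power2_eq_square algebra_simps)
  then have eq: "det (vector [y, J s x *v y, z, J s x *v z] :: real^4^4) = det (E x) * (s * Q)"
    using det_vector_mult[of "E x" p "J0 s *v p" q "J0 s *v q"] by (simp add: p_def q_def E J)
  have "det (E x) < 0"
    unfolding det_E[OF x] using a_pos[OF coord_in_I[OF x]] nonzero(2)[OF coord_in_I[OF x]] k_pos c_nonzero
    by (simp add: zero_less_mult_iff)
  moreover have "Q > 0"
  proof -
    have "Q \<noteq> 0" using nz eq by auto
    moreover have "Q \<ge> 0" by (simp add: Q_def)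
    ultimately show ?thesis by simp
  qed
  ultimately have "det (E x) * Q < 0"
    by (rule mult_neg_pos)
  then have "(s * s) * - (det (E x) * Q) > 0"
    unfolding s by simp
  also have "(s * s) * - (det (E x) * Q) = - s * (det (E x) * (s * Q))"
    by algebra
  finally show "- s * det (vector [y, J s x *v y, z, J s x *v z] :: real^4^4) > 0"
    unfolding eq .
qed

end

theorem proposition3p5:
  fixes I :: "real set" and t\<^sub>0 \<epsilon> \<sigma> \<Lambda> k :: real and a b :: "real \<Rightarrow> real"
    and e \<theta> :: "3 \<Rightarrow> real^3 \<Rightarrow> real^3"
    and M :: "(real^4) set" and g :: "real^4 \<Rightarrow> real^4^4"
  assumes "open I" and "is_interval I" and "t\<^sub>0 \<in> I"
    and "\<epsilon> \<in> {1, -1}" and "\<sigma> \<in> {1, -1}" and "k > 0"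
    and "heis_frame k e" and "dual_coframe e \<theta>"
    and "smooth_on I a" and "smooth_on I b"
    and "\<forall>t\<in>I. a t \<noteq> 0 \<and> b t \<noteq> 0" and "a t\<^sub>0 = 1" and "b t\<^sub>0 = 1"
    and "M = heis_manifold I" and "g = heis_metric \<epsilon> a b \<theta>"
    and "\<epsilon> = 1 \<Longrightarrow> quaternionic_kaehler M \<sigma> \<Lambda> g"
    and "\<epsilon> = -1 \<Longrightarrow> quaternionic_parakaehler M \<sigma> \<Lambda> g \<and> timelike_centre M g"
    and "heis_ode I \<epsilon> \<Lambda> k a b"
  shows "(\<forall>x\<in>M. let \<omega> = (\<lambda>i. sd_form \<sigma> g a b \<theta> i x); \<nu> = weyl_nu \<epsilon> k a b (x $ 1) in
            inj \<omega> \<and> independent (range \<omega>) \<and>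
            span (range \<omega>) = {\<eta>. two_form \<eta> \<and> hodge \<sigma> (g x) \<eta> = \<eta>} \<and>
            weyl_op g x (\<omega> 1) = (- 2 * \<nu>) *\<^sub>R \<omega> 1 \<and>
            weyl_op g x (\<omega> 2) = \<nu> *\<^sub>R \<omega> 2 \<and>
            weyl_op g x (\<omega> 3) = \<nu> *\<^sub>R \<omega> 3)
       \<and> (\<exists>J\<^sub>1 J\<^sub>2. conformally_kaehler M g J\<^sub>1 \<and> induces_orientation M J\<^sub>1 1 \<and>
                  conformally_kaehler M g J\<^sub>2 \<and> induces_orientation M J\<^sub>2 (-1))"
proof -
  interpret H: heisenberg_metric I \<epsilon> k a b e \<theta>
    using assms by unfold_locales auto
  have M: "M = heis_manifold I" and g: "g = heis_metric \<epsilon> a b \<theta>"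
    by fact+
  have "smooth_on M g \<and> \<Lambda> \<noteq> 0 \<and> einstein M \<Lambda> g \<and> weyl_self_dual M \<sigma> g"
    using assms(4,16,17)
    by (auto simp: quaternionic_kaehler_def quaternionic_parakaehler_def riemannian_def neutral_signature_def
        pseudo_riemannian_def)
  then have smooth: "smooth_on M g" and geometry: "\<Lambda> \<noteq> 0" "einstein M \<Lambda> g" "weyl_self_dual M \<sigma> g"
    by auto
  have "\<sigma> * \<sigma> = 1"
    using assms(5) by auto
  then have 1: "\<forall>x\<in>M. let \<omega> = (\<lambda>i. sd_form \<sigma> g a b \<theta> i x); \<nu> = weyl_nu \<epsilon> k a b (x $ 1) in
            inj \<omega> \<and> independent (range \<omega>) \<and>
            span (range \<omega>) = {\<eta>. two_form \<eta> \<and> hodge \<sigma> (g x) \<eta> = \<eta>} \<and>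
            weyl_op g x (\<omega> 1) = (- 2 * \<nu>) *\<^sub>R \<omega> 1 \<and>
            weyl_op g x (\<omega> 2) = \<nu> *\<^sub>R \<omega> 2 \<and>
            weyl_op g x (\<omega> 3) = \<nu> *\<^sub>R \<omega> 3"
    using H.weyl_eigenforms[OF _ _ geometry(2,3)[unfolded M g] geometry(1) \<open>heis_ode I \<epsilon> \<Lambda> k a b\<close>]
    unfolding M g Let_def by blast
  \<comment> \<open>The sign of \<open>det (E x)\<close>, and with it the induced orientation,
    depends on the sign of \<open>a\<close>. The normalisation at \<open>t\<^sub>0\<close> makes it
    positive, and without zeros it stays so on the interval.\<close>
  have "a t > 0" if "t \<in> I" for t
  proof -
    have "continuous_on I a"
      using \<open>smooth_on I a\<close> unfolding smooth_on_def by (metis ck_on.simps(1))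
    then show ?thesis
      using positive_on_interval[OF \<open>is_interval I\<close>, of a, OF _ H.nonzero(1) \<open>t\<^sub>0 \<in> I\<close> _ that] \<open>a t\<^sub>0 = 1\<close> by simp
  qed
  then have "induces_orientation M (H.J (- 1)) 1" "induces_orientation M (H.J 1) (- 1)"
    using H.induces_orientation_J[of "- 1"] H.induces_orientation_J[of 1] unfolding M by simp_all
  moreover have "conformally_kaehler M g (H.J (- 1))" "conformally_kaehler M g (H.J 1)"
    using H.conformally_kaehler_J[OF \<open>is_interval I\<close>] smooth unfolding M g by simp_all
  ultimately show ?thesis
    using 1 by blast
qed

end
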